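(* Let $\mu$ be a measure on the Borel subsets of $(0,\infty)$ with $\int_0^{\infty}\frac{\lambda}{\lambda^2 + 1} \,\mathrm{d}\mu(\lambda)< \infty$. Define $f_{\mu}:\mathbb{R}\to\mathbb{R}\cup\{\infty\}$ by $f_{\mu}(x) = \int_0^{\infty} \{e^{-\lambda |x|} - e^{-\lambda}\}\,\mathrm{d}\mu(\lambda)$ (where $f_\mu(0)=\int_0^\infty\{1-e^{-\lambda}\}\,\mathrm{d}\mu(\lambda)$ may be $\infty$), and let $$K_{\mu}(z) = \lim_{N\rightarrow\infty} \left(\frac{\cos \pi z}{\pi}\right) \sum_{n=-N}^{N+1} \frac{(-1)^{n}f_{\mu}(n-\tfrac12)}{z - n + \tfrac12},$$ the limit converging uniformly on compact subsets of $\mathbb{C}$ and defining a real entire function. For $\lambda>0$ let $K(\lambda, z) = \left(\frac{\cos \pi z}{\pi}\right)\sum_{n \in \mathbb{Z}} \frac{ (-1)^{n}\, e^{-\lambda|n- \frac{1}{2}|}}{z - n + \frac{1}{2}}$ and $\widehat{K}(\lambda,t)=\int_{-\infty}^\infty K(\lambda,x)e(-tx)\,\mathrm{d}x$. Then: (i) $K_{\mu}(z)$ has exponential type at most $\pi$. (ii) For real $x\neq 0$ the function $\lambda \mapsto e^{-\lambda |x|} - K(\lambda, x)$ is integrable on $(0, \infty)$ with respect to $\mu$. (iii) For all real $x$, $f_{\mu}(x) - K_{\mu}(x) = \int_0^{\infty} \{e^{-\lambda |x|} - K(\lambda, x)\}\,\mathrm{d}\mu(\lambda)$. (iv) The function $x\mapsto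 f_{\mu}(x) - K_{\mu}(x)$ is integrable on $\mathbb{R}$ and $$\int_{-\infty}^{\infty} |f_{\mu}(x) - K_{\mu}(x)|\,\mathrm{d}x = \int_0^{\infty}\{\tfrac{2}{\lambda} - \tfrac{2}{\lambda}\mathrm{sech}(\tfrac{\lambda}{2})\}\,\mathrm{d}\mu(\lambda).$$ (v) If $t\neq 0$ then $$\int_{-\infty}^{\infty} \{f_{\mu}(x) - K_{\mu}(x)\}e(-tx)\,\mathrm{d}x = \int_0^{\infty} \frac{2\lambda}{\lambda^2 + 4\pi^2 t^2}\,\mathrm{d}\mu(\lambda) - \int_0^{\infty} \widehat{K}(\lambda, t)\,\mathrm{d}\mu(\lambda).$$ (vi) If $\widetilde{K}(z)$ is an entire function of exponential type at most $\pi$, then $$\int_{-\infty}^{\infty} |f_{\mu}(x) - \widetilde{K}(x)|\,\mathrm{d}x \geq \int_0^{\infty}\{\tfrac{2}{\lambda} - \tfrac{2}{\lambda}\mathrm{sech}(\tfrac{\lambda}{2})\}\,\mathrm{d}\mu(\lambda).$$ (vii) Equality holds in (vi) if and only if $\widetilde{K}(z) = K_{\mu}(z)$.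
   Context: $e(z)=e^{2\pi i z}$. An entire function $K$ has exponential type at most $\sigma$ if for every $\epsilon>0$ there is $C_\epsilon$ with $|K(z)|\le C_\epsilon e^{(\sigma+\epsilon)|z|}$ for all $z$. For each $\lambda>0$, $x\mapsto K(\lambda,x)$ is integrable on $\mathbb{R}$, so $\widehat K(\lambda,t)$ is well defined. *)

theory Defs
  imports "HOL-Complex_Analysis.Complex_Analysis"
begin

definition e2pi :: "complex \<Rightarrow> complex" where
  "e2pi z = exp (2 * of_real pi * \<i> * z)"

definition exp_type_le :: "(complex \<Rightarrow> complex) \<Rightarrow> real \<Rightarrow> bool" where
  "exp_type_le K \<sigma> \<longleftrightarrow>
     (\<forall>\<epsilon>>0. \<exists>C. \<forall>z. norm (K z) \<le> C * exp ((\<sigma> + \<epsilon>) * norm z))"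

definition ext_int :: "real measure \<Rightarrow> (real \<Rightarrow> real) \<Rightarrow> ereal" where
  "ext_int M g = enn2ereal (\<integral>\<^sup>+ l. ennreal (g l) \<partial>M) - enn2ereal (\<integral>\<^sup>+ l. ennreal (- g l) \<partial>M)"

definition f_mu :: "real measure \<Rightarrow> real \<Rightarrow> ereal" where
  "f_mu M x = ext_int M (\<lambda>l. exp (- l * \<bar>x\<bar>) - exp (- l))"

text \<open>cos(pi z) / (pi (z - a)), with its removable singularity at z = a filled in
  (the value there is the derivative of cos(pi z)/pi at a).\<close>
definition lterm :: "real \<Rightarrow> complex \<Rightarrow> complex" where
  "lterm a z = (if z = of_real a then - of_real (sin (pi * a))
                else cos (of_real pi * z) / (of_real pi * (z - of_real a)))"

definition K_partial :: "real measure \<Rightarrow> nat \<Rightarrow> complex \<Rightarrow> complex" where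
  "K_partial M N z = (\<Sum>n\<in>{- int N .. int N + 1}.
      (-1) ^ nat \<bar>n\<bar> * of_real (real_of_ereal (f_mu M (of_int n - 1/2))) * lterm (of_int n - 1/2) z)"

definition K_mu :: "real measure \<Rightarrow> complex \<Rightarrow> complex" where
  "K_mu M z = lim (\<lambda>N. K_partial M N z)"

definition K_lam :: "real \<Rightarrow> complex \<Rightarrow> complex" where
  "K_lam l z = (\<Sum>\<^sub>\<infinity>n::int. (-1) ^ nat \<bar>n\<bar> * of_real (exp (- l * \<bar>of_int n - 1/2\<bar>)) * lterm (of_int n - 1/2) z)"

definition Khat :: "real \<Rightarrow> real \<Rightarrow> complex" where
  "Khat l t = (\<integral> x. K_lam l (of_real x) * e2pi (- of_real (t * x)) \<partial>lborel)"

text \<open>x \<mapsto> f_mu(x) - K_mu(x) on the real line (value at x = 0 irrelevant, a null set).\<close>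
definition diffF :: "real measure \<Rightarrow> real \<Rightarrow> real" where
  "diffF M x = real_of_ereal (f_mu M x) - Re (K_mu M (of_real x))"

end

theory Submission
  imports Defs
begin

text \<open>
  For a single exponential, \<open>D = exp (- \<lambda> |x|) - K(\<lambda>,x)\<close> changes sign exactly with \<open>cos (\<pi> x)\<close>: for fixed
  \<open>x\<close> the quotient \<open>\<pi> D / cos (\<pi> x)\<close>, as a function of \<open>\<lambda>\<close>, solves \<open>\<Psi>'' = x\<^sup>2 \<Psi> - 2 g\<close> with \<open>g \<ge> 0\<close> and
  vanishes at both ends of \<open>(0, \<infinity>)\<close>, so it is nonnegative by the maximum principle. Since \<open>|D|\<close> is at most
  a multiple of \<open>\<lambda> / (\<lambda>\<^sup>2 + 1)\<close> for each \<open>x \<noteq> 0\<close>, everything can be integrated against the measure, and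
  \<open>f - K\<close> has the sign of \<open>cos (\<pi> x)\<close> as well.

  An integrable entire function of type \<open>\<pi>\<close> is orthogonal to \<open>sgn (cos (\<pi> x))\<close>, because this function is
  a bounded limit of sums of two functions that extend analytically to a half plane and decay there
  like \<open>exp (- \<pi> |Im z|)\<close>. This gives the value of the integral of \<open>|f - K|\<close> and its minimality. In the case of
  equality the competitor also interpolates \<open>f\<close> at the half integers, and an integrable entire function of
  type \<open>\<pi>\<close> that vanishes there is zero by Liouville's theorem applied to its quotient by the cosine.
\<close>

section \<open>Growth of entire functions of exponential type\<close>

text \<open>The hypothesis controls only \<open>l / (l\<^sup>2 + 1)\<close>, so every estimate in
  the parameter must be O(l) at 0 and O(1/l) at infinity. Both exp(-l|x|) and K(l,x) tend to 1 as l
  tends to 0, hence neither is integrated alone: the constant exp(-l) is subtracted from each. For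
  the second difference to interpolate the first, the cardinal series of the constant 1 must sum to
  1, and that series converges only conditionally; this is why the partial fractions of 1/cos are
  needed. The series for \<open>K_mu\<close> has the same defect, since the values of f at the half
  integers are bounded only by a multiple of the node. Pairing the nodes -(k + 1/2) and k + 1/2
  leaves a scalar alternating series times the cosine and a remainder of order 1/k^3, and limits are
  taken through this splitting. The differential equation comes from the same pairing: two
  derivatives in l multiply the k-th term by (k + 1/2)^2, which the partial fraction identity
  exchanges for x^2 and, after division by the cosine, a source not depending on x.\<close>

lemma maximum_modulus_unbounded:
  fixes f :: "complex \<Rightarrow> complex"
  assumes "f holomorphic_on T" "open T" "S \<subseteq> T" "closed S"
    and front: "\<And>z. z \<in> frontier S \<Longrightarrow> norm (f z) \<le> M"
    and far: "\<And>z. z \<in> S \<Longrightarrow> R \<le> norm z \<Longrightarrow> norm (f z) \<le> M"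
    and "z \<in> S"
  shows "norm (f z) \<le> M"
proof (cases "R \<le> norm z")
  case False
  define S' where "S' = S \<inter> cball 0 R"
  have cl: "closed S'" using assms by (auto simp: S'_def)
  show ?thesis
  proof (rule maximum_modulus_frontier[of f S' M])
    show "f holomorphic_on interior S'"
      using assms interior_subset[of S'] by (intro holomorphic_on_subset[OF assms(1)]) (auto simp: S'_def)
    show "continuous_on (closure S') f"
      using cl assms by (auto intro!: holomorphic_on_imp_continuous_on holomorphic_on_subset[of f T] simp: S'_def)
    show "bounded S'" by (auto simp: S'_def intro: bounded_subset)
    show "norm (f x) \<le> M" if "x \<in> frontier S'" for x
    proof -
      have x: "x \<in> S'" "x \<notin> interior S \<inter> ball 0 R"
        using that cl by (auto simp: frontier_def S'_def)
      have "x \<in> S" using x by (auto simp: S'_def)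
      show ?thesis
      proof (cases "R \<le> norm x")
        case True then show ?thesis using far \<open>x \<in> S\<close> by auto
      next
        case False
        then have "x \<in> frontier S" using x \<open>x \<in> S\<close> assms(4) by (auto simp: frontier_def)
        then show ?thesis by (rule front)
      qed
    qed
    show "z \<in> S'" using False \<open>z \<in> S\<close> by (auto simp: S'_def)
  qed
qed (use assms in auto)

text \<open>On the sector |arg w| \<le> \<pi>/4 the power w^(3/2) has argument at most 3\<pi>/8 <
  \<pi>/2, so its real part is at least a fixed multiple of |w|^(3/2). This is the damping exponent
  of the quadrant theorem.\<close>

lemma Re_csqrt_cube_ge:
  assumes "\<bar>Im w\<bar> \<le> Re w"
  shows "norm w * Re (csqrt w) / 3 \<le> Re (w * csqrt w)" "sqrt (norm w) / 2 \<le> Re (csqrt w)"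
proof -
  define p where "p = Re (csqrt w)"
  define q where "q = Im (csqrt w)"
  have s: "csqrt w = Complex p q" by (simp only: p_def q_def complex.collapse)
  have w: "w = (Complex p q)\<^sup>2" using s by (metis power2_csqrt)
  have Rew: "Re w = p\<^sup>2 - q\<^sup>2" and Imw: "Im w = 2 * p * q" by (simp_all add: w power2_eq_square)
  have p0: "p \<ge> 0" unfolding p_def by (rule Re_csqrt)
  have nw: "norm w = p\<^sup>2 + q\<^sup>2" unfolding w norm_power by (simp add: cmod_def)
  have a: "2 * p * \<bar>q\<bar> \<le> p\<^sup>2 - q\<^sup>2" using assms p0 by (simp add: Rew Imw abs_mult)
  \<comment> \<open>The sharp constant is tan(\<pi>/8)^2 = 3 - 2 sqrt 2 < 1/5. The value 1/5 is
    exactly what \<open>(p\<^sup>2 + q\<^sup>2) / 3 \<le> p\<^sup>2 - 3 * q\<^sup>2\<close>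
    requires.\<close>
  have "5 * q\<^sup>2 \<le> p\<^sup>2"
  proof (rule ccontr)
    assume c: "\<not> ?thesis"
    have "\<bar>q\<bar> \<le> p"
    proof -
      have "0 \<le> p\<^sup>2 - q\<^sup>2" using a p0 by (meson abs_ge_zero mult_nonneg_nonneg order_trans zero_le_numeral)
      then show ?thesis using p0 by (metis abs_le_square_iff abs_of_nonneg diff_ge_0_iff_ge)
    qed
    have "(2 * p * \<bar>q\<bar>)\<^sup>2 \<le> (p\<^sup>2 - q\<^sup>2)\<^sup>2"
      using a p0 by (intro power_mono) auto
    then have "4 * p\<^sup>2 * q\<^sup>2 \<le> (p\<^sup>2 - q\<^sup>2)\<^sup>2" by (simp add: power_mult_distrib)
    moreover have "(p\<^sup>2 - q\<^sup>2)\<^sup>2 = p\<^sup>2 * p\<^sup>2 - 2 * p\<^sup>2 * q\<^sup>2 + q\<^sup>2 * q\<^sup>2"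
      by (simp add: power2_eq_square algebra_simps)
    ultimately have "0 \<le> p\<^sup>2 * p\<^sup>2 - 6 * p\<^sup>2 * q\<^sup>2 + q\<^sup>2 * q\<^sup>2" by linarith
    moreover define P Q where "P = p\<^sup>2" and "Q = q\<^sup>2"
    ultimately have i: "0 \<le> P * P - 6 * P * Q + Q * Q" by simp
    have ii: "P < 5 * Q" "Q \<le> P" "0 \<le> Q"
      using c \<open>\<bar>q\<bar> \<le> p\<close> p0 by (auto simp: P_def Q_def abs_le_square_iff[symmetric])
    have "P * P \<le> 5 * Q * P" using ii by (intro mult_right_mono) auto
    moreover have "Q * Q \<le> Q * P" using ii by (intro mult_left_mono) auto
    moreover have "6 * P * Q = 6 * (Q * P)" "5 * Q * P = 5 * (Q * P)" by simp_all
    ultimately have "P * P = 5 * Q * P" using i by linarith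
    then have "P = 0" using ii by auto
    then show False using ii by auto
  qed
  note q = this
  have re: "Re (w * csqrt w) = p * (p\<^sup>2 - 3 * q\<^sup>2)"
    by (simp add: s Rew Imw power2_eq_square algebra_simps)
  have "(p\<^sup>2 + q\<^sup>2) / 3 \<le> p\<^sup>2 - 3 * q\<^sup>2" using q by simp
  from mult_left_mono[OF this p0] show "norm w * Re (csqrt w) / 3 \<le> Re (w * csqrt w)"
    unfolding re nw p_def[symmetric] by (simp add: mult.commute)
  have "q\<^sup>2 \<le> 3 * p\<^sup>2" using q zero_le_power2[of q] by linarith
  then have "norm w \<le> (2 * p)\<^sup>2" unfolding nw power_mult_distrib by simp
  then have "sqrt (norm w) \<le> 2 * p" using p0 by (metis real_sqrt_le_iff real_sqrt_unique mult_nonneg_nonneg zero_le_numeral)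
  then show "sqrt (norm w) / 2 \<le> Re (csqrt w)" by (simp add: p_def)
qed

section \<open>The Phragmen-Lindelof principle in quadrants and half planes\<close>

lemma le_if_le_exp_scaled:
  fixes a M c :: real
  assumes "\<And>\<delta>. \<delta> > 0 \<Longrightarrow> a \<le> M * exp (\<delta> * c)"
  shows "a \<le> M"
proof (rule tendsto_lowerbound[where F = "at_right 0" and f = "\<lambda>\<delta>. M * exp (\<delta> * c)"])
  show "((\<lambda>\<delta>. M * exp (\<delta> * c)) \<longlongrightarrow> M) (at_right 0)"
    by (rule tendsto_eq_intros refl | simp)+
  show "\<forall>\<^sub>F \<delta> in at_right 0. a \<le> M * exp (\<delta> * c)"
    using assms by (auto simp: eventually_at_filter)
qed auto

text \<open>The order of growth in a quadrant is compared with \<open>exp (- \<delta> w powr (3/2))\<close>, where \<open>w\<close> is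
  the variable rotated to the sector around the positive axis and shifted away from the branch point.\<close>
lemma Phragmen_Lindelof_quadrant:
  fixes G :: "complex \<Rightarrow> complex"
  assumes G: "G holomorphic_on UNIV"
    and growth: "\<And>z. norm (G z) \<le> A * exp (B * norm z)"
    and re: "\<And>x. x \<ge> 0 \<Longrightarrow> norm (G (of_real x)) \<le> M"
    and im: "\<And>y. y \<ge> 0 \<Longrightarrow> norm (G (\<i> * of_real y)) \<le> M"
    and M: "M > 0" and z: "Re z \<ge> 0" "Im z \<ge> 0"
  shows "norm (G z) \<le> M"
proof -
  define w where "w = (\<lambda>z. 1 + cis (- pi / 4) * z)"
  define S where "S = {z. Re z \<ge> 0 \<and> Im z \<ge> 0}"
  have cis: "cis (- pi / 4) = Complex (sqrt 2 / 2) (- sqrt 2 / 2)"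
    by (simp add: complex_eq_iff cos_45 sin_45 flip: minus_divide_left)
  have Rew: "Re (w z) = 1 + sqrt 2 / 2 * (Re z + Im z)" and Imw: "Im (w z) = sqrt 2 / 2 * (Im z - Re z)" for z
    unfolding w_def cis by (simp_all add: field_simps)
  have wS: "\<bar>Im (w z)\<bar> \<le> Re (w z)" "Re (w z) \<ge> 1" if "z \<in> S" for z
  proof -
    have "\<bar>Im z - Re z\<bar> \<le> Re z + Im z" using that by (auto simp: S_def)
    then have "sqrt 2 / 2 * \<bar>Im z - Re z\<bar> \<le> sqrt 2 / 2 * (Re z + Im z)"
      by (rule mult_left_mono) auto
    moreover have "\<bar>Im (w z)\<bar> = sqrt 2 / 2 * \<bar>Im z - Re z\<bar>" by (simp add: Imw abs_mult)
    ultimately show "\<bar>Im (w z)\<bar> \<le> Re (w z)" unfolding Rew by linarith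
    show "Re (w z) \<ge> 1" using that by (auto simp: Rew S_def)
  qed
  have wnorm: "norm (w z) \<ge> norm z" if "z \<in> S" for z
  proof -
    have "norm z = norm (cis (- pi / 4) * z)" by (simp add: norm_mult)
    also have "\<dots> \<le> norm (w z)"
    proof -
      have "\<bar>Re (cis (- pi / 4) * z)\<bar> \<le> \<bar>Re (w z)\<bar>"
      proof -
        have "0 \<le> sqrt 2 / 2 * (Re z + Im z)" using that by (auto simp: S_def)
        moreover have "Re (cis (- pi / 4) * z) = Re (w z) - 1" by (simp add: w_def)
        ultimately show ?thesis by (simp add: Rew)
      qed
      moreover have "\<bar>Im (cis (- pi / 4) * z)\<bar> \<le> \<bar>Im (w z)\<bar>" by (simp add: w_def)
      ultimately show ?thesis unfolding cmod_def
        by (intro real_sqrt_le_mono add_mono) (auto simp: abs_le_square_iff)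
    qed
    finally show ?thesis .
  qed
  have "norm (G z) \<le> M * exp (\<delta> * Re (w z * csqrt (w z)))" if "\<delta> > 0" for \<delta> :: real
  proof -
    define T where "T = {z. Re (w z) > 0}"
    define E where "E = (\<lambda>z. exp (- of_real \<delta> * (w z * csqrt (w z))))"
    have nE: "norm (E z) = exp (- \<delta> * Re (w z * csqrt (w z)))" for z
      by (simp add: E_def norm_exp_eq_Re)
    have ReS: "Re (w z * csqrt (w z)) \<ge> norm (w z) * Re (csqrt (w z)) / 3" if "z \<in> S" for z
      using Re_csqrt_cube_ge wS[OF that] by blast
    have Re0: "Re (w z * csqrt (w z)) \<ge> 0" if "z \<in> S" for z
      using ReS[OF that] by (rule order_trans[rotated]) (intro divide_nonneg_nonneg mult_nonneg_nonneg Re_csqrt; simp)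
    have E1: "norm (E z) \<le> 1" if "z \<in> S" for z
      using Re0[OF that] \<open>\<delta> > 0\<close> by (simp add: nE)
    \<comment> \<open>Beyond the first threshold the exponent of \<open>E\<close> exceeds (|B| +
      1)|z|, which cancels the growth of \<open>G\<close> and leaves a spare factor exp(-|z|);
      beyond the second one this spare factor absorbs |A| / M.\<close>
    define R where "R = max (max ((6 * (\<bar>B\<bar> + 1) / \<delta>)\<^sup>2) (\<bar>A\<bar> / M)) 1"
    have "norm (G z * E z) \<le> M"
    proof (rule maximum_modulus_unbounded[where f = "\<lambda>z. G z * E z" and S = S and T = T and R = R])
      show "(\<lambda>z. G z * E z) holomorphic_on T"
        unfolding E_def w_def
        by (intro holomorphic_intros holomorphic_on_subset[OF G]) 
           (auto simp: T_def w_def complex_nonpos_Reals_iff)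
      show "open T" unfolding T_def w_def
        by (intro open_Collect_less continuous_intros)
      show "S \<subseteq> T" using wS(2) by (force simp: T_def)
      show "closed S" unfolding S_def
        by (intro closed_Collect_conj closed_Collect_le continuous_intros)
      show "z \<in> S" using z by (simp add: S_def)
      fix z assume "z \<in> frontier S"
      then have zS: "z \<in> S" and ni: "z \<notin> interior S"
        using \<open>closed S\<close> by (auto simp: frontier_def)
      have "\<not> (Re z > 0 \<and> Im z > 0)"
      proof
        assume "Re z > 0 \<and> Im z > 0"
        moreover have "open {z. Re z > 0 \<and> Im z > 0}"
          by (intro open_Collect_conj open_Collect_less continuous_intros)
        moreover have "{z. Re z > 0 \<and> Im z > 0} \<subseteq> S" by (auto simp: S_def)
        ultimately show False using ni interior_maximal by blast
      qed
      then consider "Re z = 0" | "Im z = 0" using zS by (force simp: S_def)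
      then have "norm (G z) \<le> M"
      proof cases
        case 1
        then have "z = \<i> * of_real (Im z)" by (simp add: complex_eq_iff)
        then show ?thesis using im[of "Im z"] zS by (simp add: S_def)
      next
        case 2
        then have "z = of_real (Re z)" by (simp add: complex_eq_iff)
        then show ?thesis using re[of "Re z"] zS by (simp add: S_def)
      qed
      then show "norm (G z * E z) \<le> M"
        using mult_mono[OF _ E1[OF zS], of "norm (G z)" M] M by (simp add: norm_mult)
    next
      fix z assume zS: "z \<in> S" and far: "R \<le> norm z"
      define p where "p = Re (csqrt (w z))"
      have "6 * (\<bar>B\<bar> + 1) / \<delta> \<le> sqrt (norm z)"
      proof (rule real_le_rsqrt)
        show "(6 * (\<bar>B\<bar> + 1) / \<delta>)\<^sup>2 \<le> norm z" using far by (simp add: R_def)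
      qed
      also have "\<dots> \<le> sqrt (norm (w z))" using wnorm[OF zS] by simp
      also have "\<dots> \<le> 2 * p" using Re_csqrt_cube_ge(2)[OF wS(1)[OF zS]] by (simp add: p_def)
      finally have p: "\<bar>B\<bar> + 1 \<le> \<delta> * p / 3" using \<open>\<delta> > 0\<close> by (simp add: field_simps)
      have "norm z * (\<bar>B\<bar> + 1) \<le> norm (w z) * (\<delta> * p / 3)"
        using p wnorm[OF zS] by (intro mult_mono) auto
      also have "\<dots> \<le> \<delta> * Re (w z * csqrt (w z))"
        using mult_left_mono[OF ReS[OF zS], of \<delta>] \<open>\<delta> > 0\<close> by (simp add: p_def mult_ac)
      finally have e: "norm z * (\<bar>B\<bar> + 1) \<le> \<delta> * Re (w z * csqrt (w z))" .
      have "norm (G z * E z) \<le> (\<bar>A\<bar> * exp (B * norm z)) * exp (- (norm z * (\<bar>B\<bar> + 1)))"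
        unfolding norm_mult
      proof (rule mult_mono)
        show "norm (G z) \<le> \<bar>A\<bar> * exp (B * norm z)"
          using growth[of z] by (rule order_trans) (auto intro: mult_right_mono)
        show "norm (E z) \<le> exp (- (norm z * (\<bar>B\<bar> + 1)))" using e by (simp add: nE)
      qed auto
      also have "\<dots> \<le> \<bar>A\<bar> * exp (- norm z)"
      proof -
        have "B * norm z \<le> \<bar>B\<bar> * norm z" by (intro mult_right_mono) auto
        then show ?thesis by (auto simp: mult.assoc exp_add[symmetric] algebra_simps intro!: mult_left_mono)
      qed
      also have "\<dots> \<le> M"
      proof -
        have "\<bar>A\<bar> / M \<le> norm z" using far by (simp add: R_def)
        also have "\<dots> \<le> exp (norm z)" using exp_ge_add_one_self[of "norm z"] by linarith
        finally show ?thesis using M by (simp add: exp_minus field_simps)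
      qed
      finally show "norm (G z * E z) \<le> M" .
    qed
    then have "norm (G z) * norm (E z) * exp (\<delta> * Re (w z * csqrt (w z))) \<le> M * exp (\<delta> * Re (w z * csqrt (w z)))"
      unfolding norm_mult by (rule mult_right_mono) auto
    then show ?thesis unfolding nE mult.assoc exp_add[symmetric] by (simp del: times_complex.simps csqrt.simps)
  qed
  then show ?thesis by (rule le_if_le_exp_scaled)
qed

text \<open>For a function already known to be bounded, linear damping suffices:
  \<open>1 - \<i> * \<delta> * z\<close> has modulus at least 1 and at least
  \<open>\<delta> * norm z\<close> on the closed upper half plane. Letting \<delta> tend to 0
  improves the rough bound \<open>B\<close> to the boundary bound \<open>M\<close>.\<close>

lemma Phragmen_Lindelof_upper_half_plane:
  fixes G :: "complex \<Rightarrow> complex"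
  assumes G: "G holomorphic_on UNIV"
    and bd: "\<And>z. Im z \<ge> 0 \<Longrightarrow> norm (G z) \<le> B"
    and re: "\<And>x. norm (G (of_real x)) \<le> M"
    and M: "M > 0" and z: "Im z \<ge> 0"
  shows "norm (G z) \<le> M"
proof -
  have "norm (G z) \<le> M * norm (1 - \<i> * of_real \<delta> * z)" if "\<delta> > 0" for \<delta> :: real
  proof -
    define D where "D = (\<lambda>z. 1 - \<i> * of_real \<delta> * z)"
    have nD: "norm (D z) \<ge> 1" "norm (D z) \<ge> \<delta> * norm z" if "Im z \<ge> 0" for z
    proof -
      have "Re (D z) \<ge> 1" using that \<open>\<delta> > 0\<close> by (simp add: D_def)
      then show "norm (D z) \<ge> 1" using complex_Re_le_cmod[of "D z"] by linarith
      have "\<delta> * norm z = norm (\<i> * of_real \<delta> * z)" using \<open>\<delta> > 0\<close> by (simp add: norm_mult)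
      also have "\<dots> \<le> norm (D z)" unfolding cmod_def
        by (rule real_sqrt_le_mono, rule add_mono)
           (use that \<open>\<delta> > 0\<close> in \<open>auto simp: D_def abs_le_square_iff[symmetric]\<close>)
      finally show "norm (D z) \<ge> \<delta> * norm z" .
    qed
    have "norm (G z / D z) \<le> M"
    proof (rule maximum_modulus_unbounded[where f = "\<lambda>z. G z / D z" and S = "{z. Im z \<ge> 0}" and T = "{z. Re (D z) > 0}" and R = "\<bar>B\<bar> / (\<delta> * M) + 1"])
      show "(\<lambda>z. G z / D z) holomorphic_on {z. Re (D z) > 0}"
      proof (rule holomorphic_on_divide[OF holomorphic_on_subset[OF G]])
        show "D holomorphic_on {z. Re (D z) > 0}" unfolding D_def by (intro holomorphic_intros)
      qed auto
      show "open {z. Re (D z) > 0}" unfolding D_def by (intro open_Collect_less continuous_intros)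
      show "{z. 0 \<le> Im z} \<subseteq> {z. 0 < Re (D z)}" using \<open>\<delta> > 0\<close>
        by (auto simp: D_def intro: add_pos_nonneg)
      show "closed {z. 0 \<le> Im z}" by (intro closed_Collect_le continuous_intros)
      show "z \<in> {z. 0 \<le> Im z}" using z by simp
      fix z assume "z \<in> frontier {z. 0 \<le> Im z}"
      then have "Im z = 0"
        using open_halfspace_Im_gt[of 0] interior_maximal[of "{z. 0 < Im z}" "{z. 0 \<le> Im z}"]
          closed_halfspace_Im_ge[of 0]
        by (auto simp: frontier_def subset_iff closure_closed intro: order_antisym leI)
      then have "z = of_real (Re z)" by (simp add: complex_eq_iff)
      then have "norm (G z) \<le> M" using re[of "Re z"] by simp
      then show "norm (G z / D z) \<le> M" using nD(1)[of z] \<open>Im z = 0\<close> M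
        by (auto simp: norm_divide divide_simps intro: order_trans[of _ M])
    next
      fix z assume z: "z \<in> {z. 0 \<le> Im z}" and far: "\<bar>B\<bar> / (\<delta> * M) + 1 \<le> norm z"
      have "norm (G z) \<le> \<bar>B\<bar>" using bd[of z] z by auto
      also have "\<dots> \<le> M * (\<delta> * norm z)" using far M \<open>\<delta> > 0\<close>
      proof -
        have "\<bar>B\<bar> / (\<delta> * M) \<le> norm z" using far by simp
        then show ?thesis using M \<open>\<delta> > 0\<close> by (simp add: field_simps)
      qed
      also have "\<dots> \<le> M * norm (D z)" using nD(2)[of z] z M by (intro mult_left_mono) auto
      finally show "norm (G z / D z) \<le> M" using nD(1)[of z] z
        by (auto simp: norm_divide divide_simps)
    qed
    moreover have "norm (D z) > 0" using nD(1)[OF z] by linarith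
    ultimately show ?thesis by (simp add: norm_divide D_def field_simps)
  qed
  note * = this
  show ?thesis
  proof (rule tendsto_lowerbound[where F = "at_right 0" and f = "\<lambda>\<delta>. M * norm (1 - \<i> * of_real \<delta> * z)"])
    show "((\<lambda>\<delta>. M * cmod (1 - \<i> * complex_of_real \<delta> * z)) \<longlongrightarrow> M) (at_right 0)"
      by (rule tendsto_eq_intros refl | simp)+
    show "\<forall>\<^sub>F \<delta> in at_right 0. norm (G z) \<le> M * norm (1 - \<i> * of_real \<delta> * z)"
      using * by (auto simp: eventually_at_filter)
  qed auto
qed

text \<open>The factor exp(i(\<sigma> + \<epsilon>)z) leaves the modulus on the real axis unchanged
  and cancels the growth on the positive imaginary axis. There only the constant \<open>C\<close> of
  the exponential type is available, so the two quadrants give a bound by \<open>M'\<close>, and the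
  half plane version then restores \<open>M\<close>. Finally \<epsilon> tends to 0.\<close>

lemma exp_type_le_bounded_on_upper:
  assumes H: "H holomorphic_on UNIV" "exp_type_le H \<sigma>"
    and re: "\<And>x. norm (H (of_real x)) \<le> M"
    and M: "M > 0" and z: "Im z \<ge> 0"
  shows "norm (H z) \<le> M * exp (\<sigma> * Im z)"
proof -
  have "norm (H z) * exp (- \<sigma> * Im z) \<le> M * exp (\<epsilon> * Im z)" if "\<epsilon> > 0" for \<epsilon>
  proof -
    define G where "G = (\<lambda>z. H z * exp (\<i> * of_real (\<sigma> + \<epsilon>) * z))"
    have G: "G holomorphic_on UNIV" unfolding G_def by (intro holomorphic_intros H)
    have nG: "norm (G z) = norm (H z) * exp (- ((\<sigma> + \<epsilon>) * Im z))" for z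
      by (simp add: G_def norm_mult norm_exp_eq_Re)
    from H(2) \<open>\<epsilon> > 0\<close> obtain C where C: "\<And>z. norm (H z) \<le> C * exp ((\<sigma> + \<epsilon>) * norm z)"
      unfolding exp_type_le_def by metis
    have C0: "C \<ge> 0" using order_trans[OF norm_ge_zero C[of 0]] by simp
    have growth: "norm (G z) \<le> C * exp (2 * \<bar>\<sigma> + \<epsilon>\<bar> * norm z)" for z
    proof -
      have "norm (G z) \<le> (C * exp ((\<sigma> + \<epsilon>) * norm z)) * exp (- ((\<sigma> + \<epsilon>) * Im z))"
        unfolding nG by (intro mult_right_mono C) auto
      also have "\<dots> = C * exp ((\<sigma> + \<epsilon>) * (norm z - Im z))"
        by (simp add: exp_add[symmetric] algebra_simps)
      also have "\<dots> \<le> C * exp (2 * \<bar>\<sigma> + \<epsilon>\<bar> * norm z)"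
      proof -
        have "(\<sigma> + \<epsilon>) * (norm z - Im z) \<le> \<bar>\<sigma> + \<epsilon>\<bar> * (2 * norm z)"
          using abs_Im_le_cmod[of z] by (intro mult_mono) auto
        then show ?thesis using C0 by (intro mult_left_mono) (auto simp: mult_ac)
      qed
      finally show ?thesis .
    qed
    define M' where "M' = max M C + 1"
    have M': "M \<le> M'" "C \<le> M'" "M' > 0" using C0 M by (auto simp: M'_def)
    have reG: "norm (G (of_real x)) \<le> M" for x using re[of x] by (simp add: nG)
    have imG: "norm (G (\<i> * of_real y)) \<le> C" if "y \<ge> 0" for y
    proof -
      have "norm (G (\<i> * of_real y)) \<le> (C * exp ((\<sigma> + \<epsilon>) * y)) * exp (- ((\<sigma> + \<epsilon>) * y))"
        unfolding nG using C[of "\<i> * of_real y"] that C0 by (intro mult_mono) (auto simp: norm_mult)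
      also have "\<dots> = C * exp ((\<sigma> + \<epsilon>) * y + - ((\<sigma> + \<epsilon>) * y))" by (simp only: exp_add mult.assoc)
      also have "\<dots> = C" by simp
      finally show ?thesis .
    qed
    have "norm (G z) \<le> M"
    proof (rule Phragmen_Lindelof_upper_half_plane[OF G _ reG M z])
      fix z assume z: "0 \<le> Im z"
      show "norm (G z) \<le> M'"
      proof (cases "Re z \<ge> 0")
        case True
        show ?thesis
          by (rule Phragmen_Lindelof_quadrant[OF G growth _ _ M'(3) True z])
             (use reG imG M' in \<open>force intro: order_trans\<close>)+
      next
        case False
        \<comment> \<open>Multiplication by \<open>\<i>\<close> carries the first quadrant onto the
          second, with the positive real axis going to the positive imaginary one.\<close>
        define G2 where "G2 = (\<lambda>z. G (\<i> * z))"
        have "norm (G2 (- \<i> * z)) \<le> M'"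
        proof (rule Phragmen_Lindelof_quadrant[where G = G2 and A = C and B = "2 * \<bar>\<sigma> + \<epsilon>\<bar>"])
          show "G2 holomorphic_on UNIV" unfolding G2_def
            by (rule holomorphic_on_compose[of "\<lambda>z. \<i> * z" UNIV G, unfolded o_def])
               (auto intro!: holomorphic_intros holomorphic_on_subset[OF G])
          show "norm (G2 z) \<le> C * exp (2 * \<bar>\<sigma> + \<epsilon>\<bar> * norm z)" for z
            using growth[of "\<i> * z"] by (simp add: G2_def norm_mult)
          show "norm (G2 (of_real x)) \<le> M'" if "x \<ge> 0" for x
            using imG[OF that] M' by (simp add: G2_def)
          show "norm (G2 (\<i> * of_real y)) \<le> M'" if "y \<ge> 0" for y
            using reG[of "-y"] M' by (simp add: G2_def)
        qed (use M' z False in auto)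
        then show ?thesis by (simp add: G2_def)
      qed
    qed
    then have "norm (H z) * exp (- ((\<sigma> + \<epsilon>) * Im z)) \<le> M" by (simp add: nG)
    then have "norm (H z) * exp (- ((\<sigma> + \<epsilon>) * Im z)) * exp (\<epsilon> * Im z) \<le> M * exp (\<epsilon> * Im z)"
      by (rule mult_right_mono) auto
    then show ?thesis by (simp add: mult.assoc exp_add[symmetric] algebra_simps)
  qed
  then have "norm (H z) * exp (- \<sigma> * Im z) \<le> M" by (rule le_if_le_exp_scaled)
  then show ?thesis by (simp add: exp_minus field_simps)
qed

lemma exp_type_le_compose_uminus:
  assumes "exp_type_le H \<sigma>"
  shows "exp_type_le (\<lambda>z. H (- z)) \<sigma>"
  using assms unfolding exp_type_le_def by (metis norm_minus_cancel)

lemma holomorphic_on_UNIV_uminus: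
  assumes "H holomorphic_on UNIV"
  shows "(\<lambda>z. H (- z)) holomorphic_on UNIV"
  by (rule holomorphic_on_compose[of uminus UNIV H, unfolded o_def])
     (auto intro!: holomorphic_intros holomorphic_on_subset[OF assms])

proposition exp_type_le_bounded_on_reals:
  assumes H: "H holomorphic_on UNIV" "exp_type_le H \<sigma>"
    and re: "\<And>x. norm (H (of_real x)) \<le> M" and M: "M > 0"
  shows "norm (H z) \<le> M * exp (\<sigma> * \<bar>Im z\<bar>)"
proof (cases "Im z \<ge> 0")
  case True
  then show ?thesis using exp_type_le_bounded_on_upper[OF H re M True] by simp
next
  case False
  have "norm (H (- of_real x)) \<le> M" for x using re[of "- x"] by simp
  from exp_type_le_bounded_on_upper[OF holomorphic_on_UNIV_uminus[OF H(1)] exp_type_le_compose_uminus[OF H(2)] this M, of "- z"]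
  show ?thesis using False by simp
qed

section \<open>From boundedness to integrability on the real line\<close>

lemma norm_integral_Icc_le:
  fixes f :: "real \<Rightarrow> complex"
  assumes "integrable lborel f"
  shows "norm (integral {a..b} f) \<le> (\<integral>x. norm (f x) \<partial>lborel)"
proof -
  have si: "set_integrable lborel {a..b} f"
    using assms unfolding set_integrable_def by (rule integrable_mult_indicator[rotated]) auto
  have "norm (integral {a..b} f) = norm (LINT x:{a..b}|lborel. f x)"
    using set_borel_integral_eq_integral(2)[OF si] by simp
  also have "\<dots> \<le> (\<integral>x. norm (indicator {a..b} x *\<^sub>R f x) \<partial>lborel)"
    unfolding set_lebesgue_integral_def by (rule integral_norm_bound)
  also have "\<dots> \<le> (\<integral>x. norm (f x) \<partial>lborel)"
  proof (rule integral_mono)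
    show "integrable lborel (\<lambda>x. norm (indicator {a..b} x *\<^sub>R f x))"
      using si unfolding set_integrable_def by (rule integrable_norm)
  qed (use assms in \<open>auto simp: indicator_def\<close>)
  finally show ?thesis .
qed

lemma entire_primitive:
  assumes "F holomorphic_on UNIV"
  obtains H where "\<And>z. (H has_field_derivative F z) (at z)" "H 0 = 0"
proof -
  obtain g where g: "\<And>x. (g has_field_derivative F x) (at x)"
    using holomorphic_convex_primitive'[OF convex_UNIV open_UNIV assms] by auto
  show ?thesis
    by (rule that[of "\<lambda>z. g z - g 0"]) (auto intro!: derivative_eq_intros g)
qed

text \<open>The mean value bound costs a factor \<open>norm z\<close>, which is absorbed by one half
  of \<epsilon> while the other half is spent on the type of \<open>F\<close>.\<close>

lemma exp_type_le_primitive: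
  assumes H: "\<And>z. (H has_field_derivative F z) (at z)" "H 0 = 0"
    and F: "exp_type_le F \<sigma>" and "\<sigma> \<ge> 0"
  shows "exp_type_le H \<sigma>"
  unfolding exp_type_le_def
proof (intro allI impI)
  fix \<epsilon> :: real assume e: "\<epsilon> > 0"
  then obtain C where C: "\<And>z. norm (F z) \<le> C * exp ((\<sigma> + \<epsilon> / 2) * norm z)"
    using F unfolding exp_type_le_def by (meson half_gt_zero)
  have C0: "C \<ge> 0" using order_trans[OF norm_ge_zero C[of 0]] by simp
  have "norm (H z) \<le> (2 * C / \<epsilon>) * exp ((\<sigma> + \<epsilon>) * norm z)" for z
  proof -
    have "norm (H z - H 0) \<le> (C * exp ((\<sigma> + \<epsilon> / 2) * norm z)) * norm (z - 0)"
    proof (rule field_differentiable_bound[where S = "cball 0 (norm z)" and f' = F])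
      show "(H has_field_derivative F w) (at w within cball 0 (norm z))" for w
        using H(1) has_field_derivative_at_within by blast
      show "norm (F w) \<le> C * exp ((\<sigma> + \<epsilon> / 2) * norm z)" if "w \<in> cball 0 (norm z)" for w
        using that C0 e \<open>\<sigma> \<ge> 0\<close> by (intro order_trans[OF C[of w]] mult_left_mono) (auto intro!: mult_left_mono)
    qed auto
    also have "\<dots> \<le> (C * exp ((\<sigma> + \<epsilon> / 2) * norm z)) * ((2 / \<epsilon>) * exp (\<epsilon> / 2 * norm z))"
    proof (rule mult_left_mono)
      have "\<epsilon> / 2 * norm z \<le> exp (\<epsilon> / 2 * norm z)"
        using exp_ge_add_one_self[of "\<epsilon> / 2 * norm z"] by linarith
      then show "norm (z - 0) \<le> 2 / \<epsilon> * exp (\<epsilon> / 2 * norm z)"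
        using e by (simp add: field_simps)
    qed (use C0 in auto)
    also have "\<dots> = (2 * C / \<epsilon>) * exp ((\<sigma> + \<epsilon> / 2) * norm z + \<epsilon> / 2 * norm z)"
      by (simp add: exp_add)
    also have "(\<sigma> + \<epsilon> / 2) * norm z + \<epsilon> / 2 * norm z = (\<sigma> + \<epsilon>) * norm z"
      by (simp add: field_simps)
    finally show ?thesis using H(2) by simp
  qed
  then show "\<exists>C. \<forall>z. norm (H z) \<le> C * exp ((\<sigma> + \<epsilon>) * norm z)" by blast
qed

text \<open>The primitive is bounded on the real line, so the growth bound holds for it, and Cauchy's
  estimate carries the bound over to the function itself.\<close>
proposition exp_type_le_integrable_bound:
  assumes F: "F holomorphic_on UNIV" "exp_type_le F \<sigma>" and "\<sigma> \<ge> 0"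
    and int: "integrable lborel (\<lambda>x. F (of_real x))"
  obtains C where "C > 0" "\<And>z. norm (F z) \<le> C * exp (\<sigma> * \<bar>Im z\<bar>)"
proof -
  obtain H where H: "\<And>z. (H has_field_derivative F z) (at z)" "H 0 = 0"
    using entire_primitive[OF F(1)] by blast
  define M where "M = (\<integral>x. norm (F (of_real x)) \<partial>lborel) + 1"
  have M0: "M > 0" unfolding M_def by (intro add_nonneg_pos integral_nonneg) auto
  have HM: "norm (H (of_real x)) \<le> M" for x
  proof -
    have *: "((\<lambda>x. F (of_real x)) has_integral (H (of_real b) - H (of_real a))) {a..b}" if "a \<le> b" for a b
    proof (rule fundamental_theorem_of_calculus[OF that])
      fix x assume "x \<in> {a..b}"
      show "((\<lambda>x. H (of_real x)) has_vector_derivative F (of_real x)) (at x within {a..b})"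
        by (rule has_vector_derivative_real_field[OF H(1)])
    qed
    have **: "norm (H (of_real b) - H (of_real a)) \<le> M" if "a \<le> b" for a b
      using norm_integral_Icc_le[OF int, of a b] integral_unique[OF *[OF that]] by (simp add: M_def)
    show ?thesis using **[of 0 x] **[of x 0] H(2) by (cases "0 \<le> x") auto
  qed
  have Hh: "H holomorphic_on A" for A
    using H(1) by (auto simp: holomorphic_on_def field_differentiable_def intro: has_field_derivative_at_within)
  have Hb: "norm (H z) \<le> M * exp (\<sigma> * \<bar>Im z\<bar>)" for z
    by (rule exp_type_le_bounded_on_reals[OF Hh exp_type_le_primitive[OF H F(2) \<open>\<sigma> \<ge> 0\<close>] HM M0])
  have "norm (F z) \<le> (M * exp \<sigma>) * exp (\<sigma> * \<bar>Im z\<bar>)" for z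
  proof -
    have "norm ((deriv ^^ 1) H z) \<le> fact 1 * (M * exp (\<sigma> * (\<bar>Im z\<bar> + 1))) / 1 ^ 1"
    proof (rule Cauchy_inequality)
      show "H holomorphic_on ball z 1" "continuous_on (cball z 1) H"
        using Hh by (auto intro: holomorphic_on_imp_continuous_on)
      show "norm (H x) \<le> M * exp (\<sigma> * (\<bar>Im z\<bar> + 1))" if "norm (z - x) = 1" for x
      proof -
        have "\<bar>Im x\<bar> \<le> \<bar>Im z\<bar> + 1" using abs_Im_le_cmod[of "z - x"] that by simp
        then have "M * exp (\<sigma> * \<bar>Im x\<bar>) \<le> M * exp (\<sigma> * (\<bar>Im z\<bar> + 1))"
          using M0 \<open>\<sigma> \<ge> 0\<close> by (intro mult_left_mono) (auto intro!: mult_left_mono)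
        then show ?thesis using Hb[of x] by linarith
      qed
    qed auto
    then show ?thesis using DERIV_imp_deriv[OF H(1)[of z]] by (simp add: exp_add algebra_simps)
  qed
  then show ?thesis using M0 by (intro that[of "M * exp \<sigma>"]) auto
qed

section \<open>Contour shift into the lower half plane\<close>

lemma integral_over_reals_eq_limit:
  fixes f :: "real \<Rightarrow> complex"
  assumes "integrable lborel f"
  shows "(\<lambda>n. integral {- real n..real n} f) \<longlonglongrightarrow> (\<integral>x. f x \<partial>lborel)"
proof -
  have [measurable]: "f \<in> borel_measurable borel" using assms by auto
  have "(\<lambda>n. \<integral>x. indicator {- real n..real n} x *\<^sub>R f x \<partial>lborel) \<longlonglongrightarrow> (\<integral>x. f x \<partial>lborel)"
  proof (rule integral_dominated_convergence[where w = "\<lambda>x. norm (f x)"])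
    show "AE x in lborel. (\<lambda>n. indicator {- real n..real n} x *\<^sub>R f x) \<longlonglongrightarrow> f x"
    proof (intro AE_I2 tendsto_eventually)
      fix x
      have "eventually (\<lambda>n. real n \<ge> \<bar>x\<bar>) sequentially"
        by (rule eventually_ge_at_top[of "nat \<lceil>\<bar>x\<bar>\<rceil>", THEN eventually_mono]) linarith
      then show "\<forall>\<^sub>F n in sequentially. indicator {- real n..real n} x *\<^sub>R f x = f x"
        by eventually_elim (auto simp: indicator_def)
    qed
  qed (use assms in \<open>auto simp: indicator_def\<close>)
  moreover have "(\<integral>x. indicator {- real n..real n} x *\<^sub>R f x \<partial>lborel) = integral {- real n..real n} f" for n
  proof -
    have "set_integrable lborel {- real n..real n} f"
      using assms unfolding set_integrable_def by (rule integrable_mult_indicator[rotated]) auto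
    from set_borel_integral_eq_integral(2)[OF this] show ?thesis by (simp add: set_lebesgue_integral_def)
  qed
  ultimately show ?thesis by simp
qed

lemma Im_path_image_lower_semicircle:
  assumes "R \<ge> 0" "z \<in> path_image (part_circlepath 0 R (- pi) 0)"
  shows "Im z \<le> 0" "norm z = R"
proof -
  obtain t where t: "- pi \<le> t" "t \<le> 0" "z = of_real R * exp (\<i> * of_real t)"
    using assms by (auto simp: path_image_part_circlepath)
  then have "Im z = R * sin t" "norm z = R" using assms by (auto simp: Im_exp norm_mult)
  moreover have "sin t \<le> 0" using t sin_ge_zero[of "- t"] by simp
  ultimately show "Im z \<le> 0" "norm z = R" using assms by (auto simp: mult_nonneg_nonpos)
qed

text \<open>The factor \<open>(1 + i \<delta> z)\<^sup>-\<^sup>2\<close> has its pole in the upper half plane and makes the integral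
  over large lower semicircles small.\<close>
lemma integral_eq_0_lower_half_plane:
  fixes F \<phi> :: "complex \<Rightarrow> complex"
  assumes F: "F holomorphic_on UNIV" and int: "integrable lborel (\<lambda>x. F (of_real x))"
    and Fb: "\<And>z. norm (F z) \<le> C * exp (\<sigma> * \<bar>Im z\<bar>)"
    and \<phi>: "\<phi> holomorphic_on {z. Im z < \<eta>}" and "\<eta> > 0"
    and \<phi>b: "\<And>z. Im z \<le> 0 \<Longrightarrow> norm (\<phi> z) \<le> B * exp (- \<sigma> * \<bar>Im z\<bar>)"
  shows "(\<integral>x. F (of_real x) * \<phi> (of_real x) \<partial>lborel) = 0"
proof -
  have C0: "C \<ge> 0" using order_trans[OF norm_ge_zero Fb[of 0]] by simp
  have B0: "B \<ge> 0" using order_trans[OF norm_ge_zero \<phi>b[of 0]] by simp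
  have b\<phi>: "norm (\<phi> (of_real x)) \<le> B" for x using \<phi>b[of "of_real x"] by simp
  have cF: "continuous_on UNIV (\<lambda>x::real. F (of_real x))"
    by (rule continuous_on_compose2[OF holomorphic_on_imp_continuous_on[OF F]]) (auto intro: continuous_intros)
  have c\<phi>: "continuous_on UNIV (\<lambda>x::real. \<phi> (of_real x))"
    by (rule continuous_on_compose2[OF holomorphic_on_imp_continuous_on[OF \<phi>]])
       (use \<open>\<eta> > 0\<close> in \<open>auto intro: continuous_intros\<close>)
  have [measurable]: "(\<lambda>x. F (of_real x)) \<in> borel_measurable borel" "(\<lambda>x. \<phi> (of_real x)) \<in> borel_measurable borel"
    by (rule borel_measurable_continuous_onI[OF cF], rule borel_measurable_continuous_onI[OF c\<phi>])
  define D where "D = (\<lambda>\<delta> z. 1 + \<i> * of_real \<delta> * z)"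
  have nD: "norm (D \<delta> z) \<ge> 1" "norm (D \<delta> z) \<ge> \<delta> * norm z" if "\<delta> > 0" "Im z \<le> 0" for \<delta> z
  proof -
    have R: "Re (D \<delta> z) \<ge> 1" using that by (simp add: D_def mult_nonneg_nonpos)
    then show "norm (D \<delta> z) \<ge> 1" using complex_Re_le_cmod[of "D \<delta> z"] by linarith
    have "\<bar>Re (\<i> * of_real \<delta> * z)\<bar> \<le> \<bar>Re (D \<delta> z)\<bar>" 
      using mult_nonneg_nonpos[of \<delta> "Im z"] that by (simp add: D_def)
    moreover have "\<delta> * norm z = norm (\<i> * of_real \<delta> * z)" using that by (simp add: norm_mult)
    moreover have "Im (D \<delta> z) = Im (\<i> * of_real \<delta> * z)" by (simp add: D_def)
    ultimately show "norm (D \<delta> z) \<ge> \<delta> * norm z"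
      by (simp add: cmod_def abs_le_square_iff del: times_complex.simps)
  qed
  have meas[measurable]: "(\<lambda>x. D \<delta> (of_real x)) \<in> borel_measurable borel" for \<delta>
    unfolding D_def by measurable
  have zero: "(\<integral>x. F (of_real x) * \<phi> (of_real x) / (D \<delta> (of_real x))\<^sup>2 \<partial>lborel) = 0" if d: "\<delta> > 0" for \<delta>
  proof -
    define G where "G = (\<lambda>z. F z * \<phi> z / (D \<delta> z)\<^sup>2)"
    \<comment> \<open>The damping factor has its pole at \<open>\<i> / \<delta>\<close>, so the
      integrand is holomorphic on this convex open half plane, which contains the closed lower one;
      Cauchy's theorem applies without any topology of paths.\<close>
    define S where "S = {z. Im z < \<eta>} \<inter> {z. Im z < 1 / \<delta>}"
    have Dnz: "D \<delta> z \<noteq> 0" if "z \<in> S" for z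
    proof
      assume "D \<delta> z = 0"
      then have "Re (D \<delta> z) = 0" by simp
      then show False using that d by (simp add: S_def D_def field_simps)
    qed
    have G: "G holomorphic_on S" unfolding G_def
      by (intro holomorphic_on_divide holomorphic_on_mult holomorphic_on_subset[OF F] holomorphic_on_subset[OF \<phi>])
         (use Dnz in \<open>auto simp: S_def D_def intro!: holomorphic_intros\<close>)
    have conv: "convex S" unfolding S_def by (intro convex_Int convex_halfspace_Im_lt)
    have lower: "z \<in> S" if "Im z \<le> 0" for z using that d \<open>\<eta> > 0\<close>
      by (auto simp: S_def intro: le_less_trans)
    have Gb: "norm (G z) \<le> C * B / (norm (D \<delta> z))\<^sup>2" if "Im z \<le> 0" for z
    proof -
      have "norm (F z) * norm (\<phi> z) \<le> (C * exp (\<sigma> * \<bar>Im z\<bar>)) * (B * exp (- \<sigma> * \<bar>Im z\<bar>))"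
        using C0 by (intro mult_mono Fb \<phi>b that) auto
      also have "\<dots> = C * B * exp (\<sigma> * \<bar>Im z\<bar> + - \<sigma> * \<bar>Im z\<bar>)" by (simp only: exp_add mult_ac)
      also have "\<dots> = C * B" by simp
      finally show ?thesis by (simp add: G_def norm_mult norm_divide norm_power divide_right_mono)
    qed
    have semi: "norm (integral {- R..R} (\<lambda>x. G (of_real x))) \<le> C * B * pi / (\<delta>\<^sup>2 * R)" if R: "R > 0" for R
    proof -
      let ?p = "part_circlepath 0 R (- pi) 0" and ?l = "linepath (of_real R) (of_real (- R) :: complex)"
      have pi1: "path_image ?p \<subseteq> S" using Im_path_image_lower_semicircle lower R by (meson less_imp_le subsetI)
      have li1: "path_image ?l \<subseteq> S" using lower conv by (auto simp: closed_segment_subset)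
      have pe: "pathfinish ?p = pathstart ?l" "pathfinish ?l = pathstart ?p"
        by (simp_all add: exp_minus)
      have ci: "G contour_integrable_on ?p" "G contour_integrable_on ?l"
        using G pi1 li1 by (auto intro!: contour_integrable_continuous_part_circlepath contour_integrable_continuous_linepath
            holomorphic_on_imp_continuous_on intro: holomorphic_on_subset)
      have "(G has_contour_integral 0) (?p +++ ?l)"
        by (rule Cauchy_theorem_convex_simple[OF G conv])
           (use pe pi1 li1 in \<open>auto simp: path_image_join valid_path_join\<close>)
      moreover have "(G has_contour_integral (contour_integral ?p G + contour_integral ?l G)) (?p +++ ?l)"
        using ci by (intro has_contour_integral_join has_contour_integral_integral) auto
      ultimately have "contour_integral ?p G + contour_integral ?l G = 0"
        using has_contour_integral_unique by blast
      moreover have "contour_integral ?l G = - contour_integral (linepath (of_real (- R)) (of_real R)) G"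
        using contour_integral_reverse_linepath[of "of_real (- R)" "of_real R" G] ci(2)
        by (metis G conv closed_segment_commute contour_integral_reversepath reversepath_linepath valid_path_linepath)
      moreover have "contour_integral (linepath (of_real (- R)) (of_real R)) G = integral {- R..R} (\<lambda>x. G (of_real x))"
        using R by (subst contour_integral_linepath_Reals_eq) auto
      ultimately have "integral {- R..R} (\<lambda>x. G (of_real x)) = contour_integral ?p G" by (simp add: algebra_simps)
      \<comment> \<open>On the semicircle the exponentials of \<open>F\<close> and
        \<open>\<phi>\<close> cancel. The squared damping factor leaves O(1/R^2) against an arc of
        length \<pi> R; a first power would only give boundedness.\<close>
      moreover have "norm (contour_integral ?p G) \<le> (C * B / (\<delta>\<^sup>2 * R\<^sup>2)) * R * (0 - - pi)"
      proof (rule has_contour_integral_bound_part_circlepath[OF has_contour_integral_integral[OF ci(1)]])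
        fix z assume z: "z \<in> path_image ?p"
        have z': "Im z \<le> 0" "norm z = R" using Im_path_image_lower_semicircle[OF _ z] R by auto
        have "(\<delta> * R)\<^sup>2 \<le> (norm (D \<delta> z))\<^sup>2" using nD(2)[OF d z'(1)] z'(2) d R by (intro power_mono) auto
        then have "C * B / (norm (D \<delta> z))\<^sup>2 \<le> C * B / (\<delta>\<^sup>2 * R\<^sup>2)"
          using C0 B0 d R nD(1)[OF d z'(1)] by (intro divide_left_mono) (auto simp: power_mult_distrib intro!: mult_pos_pos)
        then show "norm (G z) \<le> C * B / (\<delta>\<^sup>2 * R\<^sup>2)" using Gb[OF z'(1)] by linarith
      qed (use C0 B0 R in auto)
      ultimately show ?thesis using R d by (simp add: power2_eq_square field_simps)
    qed
    have intG: "integrable lborel (\<lambda>x. G (of_real x))"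
    proof (rule Bochner_Integration.integrable_bound[OF integrable_mult_left[OF integrable_norm[OF int], of B]])
      show "AE x in lborel. norm (G (of_real x)) \<le> norm (norm (F (of_real x)) * B)"
      proof (intro AE_I2)
        fix x :: real
        have "norm (G (of_real x)) \<le> norm (F (of_real x)) * norm (\<phi> (of_real x)) / 1"
          unfolding G_def norm_divide norm_mult norm_power
          by (intro frac_le one_le_power nD d) auto
        then show "norm (G (of_real x)) \<le> norm (norm (F (of_real x)) * B)"
          using mult_left_mono[OF b\<phi>[of x], of "norm (F (of_real x))"] B0 by simp
      qed
    qed (simp add: G_def)
    have "(\<lambda>n. integral {- real n..real n} (\<lambda>x. G (of_real x))) \<longlonglongrightarrow> 0"
    proof (rule Lim_null_comparison)
      show "\<forall>\<^sub>F n in sequentially. norm (integral {- real n..real n} (\<lambda>x. G (of_real x))) \<le> C * B * pi / \<delta>\<^sup>2 * inverse (real n)"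
        using eventually_gt_at_top[of 0] by eventually_elim (use semi in \<open>force simp: field_simps\<close>)
      show "(\<lambda>n. C * B * pi / \<delta>\<^sup>2 * inverse (real n)) \<longlonglongrightarrow> 0"
        by (rule tendsto_mult_right_zero) (rule lim_inverse_n)
    qed
    with integral_over_reals_eq_limit[OF intG] have "(\<integral>x. G (of_real x) \<partial>lborel) = 0"
      using LIMSEQ_unique by blast
    then show ?thesis by (simp add: G_def)
  qed
  \<comment> \<open>The damping is removed by dominated convergence: its denominator has modulus at
    least 1 on the real line for every \<delta>.\<close>
  have "(\<lambda>n. \<integral>x. F (of_real x) * \<phi> (of_real x) / (D (inverse (real (Suc n))) (of_real x))\<^sup>2 \<partial>lborel) \<longlonglongrightarrow>
     (\<integral>x. F (of_real x) * \<phi> (of_real x) \<partial>lborel)"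
  proof (rule integral_dominated_convergence[where w = "\<lambda>x. norm (F (of_real x)) * B"])
    show "AE x in lborel. (\<lambda>n. F (of_real x) * \<phi> (of_real x) / (D (inverse (real (Suc n))) (of_real x))\<^sup>2) \<longlonglongrightarrow> F (of_real x) * \<phi> (of_real x)"
    proof (intro AE_I2)
      fix x :: real
      have "(\<lambda>n. F (of_real x) * \<phi> (of_real x) / (D (inverse (real (Suc n))) (of_real x))\<^sup>2) \<longlonglongrightarrow> F (of_real x) * \<phi> (of_real x) / (1 + \<i> * of_real 0 * of_real x)\<^sup>2"
        unfolding D_def by (intro tendsto_intros LIMSEQ_inverse_real_of_nat) auto
      then show "(\<lambda>n. F (of_real x) * \<phi> (of_real x) / (D (inverse (real (Suc n))) (of_real x))\<^sup>2) \<longlonglongrightarrow> F (of_real x) * \<phi> (of_real x)"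
        by simp
    qed
    show "integrable lborel (\<lambda>x. norm (F (of_real x)) * B)" using int by auto
    show "AE x in lborel. norm (F (of_real x) * \<phi> (of_real x) / (D (inverse (real (Suc n))) (of_real x))\<^sup>2) \<le> norm (F (of_real x)) * B" for n
    proof (intro AE_I2)
      fix x :: real
      have "norm (F (of_real x) * \<phi> (of_real x) / (D (inverse (real (Suc n))) (of_real x))\<^sup>2) \<le> norm (F (of_real x)) * norm (\<phi> (of_real x)) / 1"
        unfolding norm_divide norm_mult norm_power
        by (intro frac_le one_le_power nD) auto
      then show "norm (F (of_real x) * \<phi> (of_real x) / (D (inverse (real (Suc n))) (of_real x))\<^sup>2) \<le> norm (F (of_real x)) * B"
        using mult_left_mono[OF b\<phi>[of x], of "norm (F (of_real x))"] by simp
    qed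
  qed measurable
  then have "(\<lambda>n::nat. 0) \<longlonglongrightarrow> (\<integral>x. F (of_real x) * \<phi> (of_real x) \<partial>lborel)"
    using zero by simp
  then show ?thesis using LIMSEQ_unique tendsto_const by blast
qed

section \<open>The sign of the cosine\<close>

text \<open>The derivative 1/(1 + z^2) is at most 1/(1 - r^2) on the disc. A bound linear in
  \<open>norm w\<close> is wanted because, for w = r exp(-i \<pi> z), it becomes the decay
  exp(-\<pi>|Im z|) in the lower half plane.\<close>

lemma norm_Arctan_le:
  assumes "norm w \<le> r" "r < 1"
  shows "norm (Arctan w) \<le> norm w / (1 - r\<^sup>2)"
proof -
  have r0: "0 \<le> r" using assms order_trans[OF norm_ge_zero] by blast
  have r1: "r\<^sup>2 < 1" using r0 assms by (simp add: abs_square_less_1)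
  have nz: "1 - r\<^sup>2 \<le> norm (1 + z\<^sup>2)" if "z \<in> cball 0 r" for z :: complex
  proof -
    have "norm (z\<^sup>2) \<le> r\<^sup>2" using that by (auto simp: norm_power intro: power_mono)
    moreover have "norm (1::complex) - norm (z\<^sup>2) \<le> norm (1 + z\<^sup>2)" by (rule norm_diff_ineq)
    ultimately show ?thesis by simp
  qed
  have "norm (Arctan w - Arctan 0) \<le> inverse (1 - r\<^sup>2) * norm (w - 0)"
  proof (rule field_differentiable_bound[where S = "cball 0 r" and f' = "\<lambda>z. inverse (1 + z\<^sup>2)"])
    fix z :: complex assume z: "z \<in> cball 0 r"
    have "\<bar>Im z\<bar> < 1" using abs_Im_le_cmod[of z] z assms by auto
    then show "(Arctan has_field_derivative inverse (1 + z\<^sup>2)) (at z within cball 0 r)"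
      by (rule has_field_derivative_at_within[OF has_field_derivative_Arctan])
    show "norm (inverse (1 + z\<^sup>2)) \<le> inverse (1 - r\<^sup>2)"
      using le_imp_inverse_le[OF nz[OF z]] r1 by (simp add: norm_inverse)
  qed (use assms r0 in auto)
  then show ?thesis by (simp add: divide_inverse mult.commute)
qed

text \<open>Makes the two half plane extensions conjugate to each other on the real line, so that
  their sum is twice a real part.\<close>

lemma cnj_Arctan:
  assumes "norm w < 1"
  shows "Arctan (cnj w) = cnj (Arctan w)"
proof -
  have w: "\<bar>Im w\<bar> < 1" using abs_Im_le_cmod[of w] assms by linarith
  have "w\<^sup>2 \<noteq> - 1"
  proof
    assume "w\<^sup>2 = - 1"
    then have "(norm w)\<^sup>2 = 1" by (metis norm_minus_cancel norm_one norm_power)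
    then have "norm w = 1" using norm_ge_zero[of w] by (auto simp: power2_eq_1_iff)
    then show False using assms by simp
  qed
  then have "cnj w = cnj (tan (Arctan w))" by simp
  also have "\<dots> = tan (cnj (Arctan w))" by (simp add: tan_def cnj_sin cnj_cos)
  finally have "Arctan (cnj w) = Arctan (tan (cnj (Arctan w)))" by simp
  also have "\<dots> = cnj (Arctan w)"
    using Re_Arctan_bounds[of w] w by (intro Arctan_tan) auto
  finally show ?thesis .
qed

text \<open>Arctan w is (i/2) Ln((1 - iw)/(1 + iw)). For w on the unit circle the quotient is purely
  imaginary, equal to -i t with t = cos \<theta> / (1 - sin \<theta>), so the imaginary part of its
  logarithm is -\<pi>/2 or \<pi>/2 according to the sign of the cosine.\<close>

lemma Re_Arctan_unit_circle:
  assumes "cos \<theta> \<noteq> 0"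
  shows "Re (Arctan (cis \<theta>)) = pi / 4 * sgn (cos \<theta>)"
proof -
  have n: "(norm (1 + \<i> * cis \<theta>))\<^sup>2 = 2 - 2 * sin \<theta>"
    unfolding cmod_power2 using sin_cos_squared_add[of \<theta>] by (simp add: power2_eq_square algebra_simps)
  define t where "t = 2 * cos \<theta> / (2 - 2 * sin \<theta>)"
  have "sin \<theta> \<noteq> 1"
    using assms sin_cos_squared_add[of \<theta>] by (auto simp del: sin_cos_squared_add sin_cos_squared_add2)
  then have s1: "2 - 2 * sin \<theta> > 0" using sin_le_one[of \<theta>] by linarith
  have nz: "1 + \<i> * cis \<theta> \<noteq> 0" using n s1 by auto
  have "(1 - \<i> * cis \<theta>) * (2 - 2 * sin \<theta>) = - \<i> * of_real (2 * cos \<theta>) * (1 + \<i> * cis \<theta>)"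
  proof (rule complex_eqI)
    show "Re ((1 - \<i> * cis \<theta>) * (2 - 2 * sin \<theta>)) = Re (- \<i> * of_real (2 * cos \<theta>) * (1 + \<i> * cis \<theta>))"
      using arg_cong[OF sin_cos_squared_add3[of \<theta>], of "\<lambda>t. 2 * t"]
      by (simp add: algebra_simps del: sin_cos_squared_add3)
    show "Im ((1 - \<i> * cis \<theta>) * (2 - 2 * sin \<theta>)) = Im (- \<i> * of_real (2 * cos \<theta>) * (1 + \<i> * cis \<theta>))"
      by (simp add: algebra_simps)
  qed
  then have q: "(1 - \<i> * cis \<theta>) / (1 + \<i> * cis \<theta>) = of_real t * (- \<i>)"
    using nz s1 by (simp add: t_def field_simps flip: of_real_mult of_real_diff)
  have Arc: "Re (Arctan (cis \<theta>)) = - Im (Ln (of_real t * (- \<i>))) / 2"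
    unfolding Arctan_def q by simp
  show ?thesis
  proof (cases "cos \<theta> > 0")
    case True
    then have "t > 0" using s1 by (simp add: t_def)
    then have "Ln (of_real t * (- \<i>)) = Ln (of_real t) + Ln (- \<i>)" by (intro Ln_times_of_real) auto
    then show ?thesis using True \<open>t > 0\<close> by (simp add: Arc Ln_of_real)
  next
    case False
    then have c: "cos \<theta> < 0" using assms by simp
    then have "t < 0" using s1 by (simp add: t_def divide_neg_pos)
    then have "Ln (of_real (- t) * \<i>) = Ln (of_real (- t)) + Ln \<i>" by (intro Ln_times_of_real) auto
    then show ?thesis using c \<open>t < 0\<close> Ln_of_real[of "- t"] by (simp add: Arc)
  qed
qed

lemma countable_zeros_cos_pi: "countable {x::real. cos (pi * x) = 0}"
proof (rule countable_subset)
  show "{x::real. cos (pi * x) = 0} \<subseteq> (\<lambda>i::int. of_int i / 2) ` UNIV"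
  proof
    fix x :: real assume "x \<in> {x. cos (pi * x) = 0}"
    then obtain i :: int where "pi * x = of_int i * (pi / 2)" by (auto simp: cos_zero_iff_int)
    then have "x = of_int i / 2" by (simp add: field_simps)
    then show "x \<in> (\<lambda>i::int. of_int i / 2) ` UNIV" by blast
  qed
qed auto

lemma AE_cos_pi_nonzero: "AE x in lborel. cos (pi * x) \<noteq> (0::real)"
proof (rule AE_I'[of "{x::real. cos (pi * x) = 0}"])
  show "{x::real. cos (pi * x) = 0} \<in> null_sets lborel"
    by (rule countable_imp_null_set_lborel[OF countable_zeros_cos_pi])
qed auto

text \<open>Abel summation of the Fourier series of \<open>sgn (cos (\<pi> x))\<close>: the function
  \<open>(2/\<pi>) (Arctan (r e(-x/2)) + Arctan (r e(x/2)))\<close> is bounded, tends to the sign as \<open>r\<close> tends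
  to 1, and each summand extends to a decaying analytic function in a half plane.\<close>
proposition integral_sgn_cos_eq_0:
  fixes F :: "complex \<Rightarrow> complex"
  assumes F: "F holomorphic_on UNIV" and int: "integrable lborel (\<lambda>x. F (of_real x))"
    and Fb: "\<And>z. norm (F z) \<le> C * exp (pi * \<bar>Im z\<bar>)"
  shows "(\<integral>x. F (of_real x) * of_real (sgn (cos (pi * x))) \<partial>lborel) = 0"
proof -
  define \<phi> where "\<phi> = (\<lambda>r z. Arctan (of_real r * exp (- \<i> * of_real pi * z)))"
  have cF: "continuous_on UNIV (\<lambda>x::real. F (of_real x))"
    by (rule continuous_on_compose2[OF holomorphic_on_imp_continuous_on[OF F]]) (auto intro: continuous_intros)
  have [measurable]: "(\<lambda>x. F (of_real x)) \<in> borel_measurable borel"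
    by (rule borel_measurable_continuous_onI[OF cF])
  have nw: "norm (of_real r * exp (- \<i> * of_real pi * z)) = r * exp (pi * Im z)" if "r > 0" for r :: real and z
    using that by (simp add: norm_mult)
  \<comment> \<open>Stated for a general \<open>H\<close>: it serves for \<open>F\<close> itself and
    for its reflection, which handles the summand that is analytic in the upper half plane.\<close>
  have half: "(\<integral>x. H (of_real x) * \<phi> r (of_real x) \<partial>lborel) = 0"
    if H: "H holomorphic_on UNIV" and Hint: "integrable lborel (\<lambda>x. H (of_real x))"
      and Hb: "\<And>z. norm (H z) \<le> C * exp (pi * \<bar>Im z\<bar>)" and r: "0 < r" "r < 1" for H r
  \<comment> \<open>\<open>\<eta>\<close> is the height at which r exp(\<pi> Im z) reaches 1, so
    that below it the argument stays in the domain of \<open>Arctan\<close>; \<open>B\<close> is the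
    constant of \<open>norm_Arctan_le\<close>, whose linear factor supplies the exponential.\<close>
  proof (rule integral_eq_0_lower_half_plane[OF H Hint Hb, where \<eta> = "- ln r / pi" and B = "r / (1 - r\<^sup>2)"])
    show "\<phi> r holomorphic_on {z. Im z < - ln r / pi}" unfolding \<phi>_def
    proof (rule holomorphic_on_compose[of "\<lambda>z. of_real r * exp (- \<i> * of_real pi * z)" _ Arctan, unfolded o_def])
      show "Arctan holomorphic_on (\<lambda>z. of_real r * exp (- \<i> * of_real pi * z)) ` {z. Im z < - ln r / pi}"
      proof (rule holomorphic_on_Arctan)
        fix w assume "w \<in> (\<lambda>z. of_real r * exp (- \<i> * of_real pi * z)) ` {z. Im z < - ln r / pi}"
        then obtain z where z: "w = of_real r * exp (- \<i> * of_real pi * z)" "Im z < - ln r / pi" by auto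
        have "pi * Im z < - ln r" using z by (simp add: field_simps)
        then have "norm w < r * exp (- ln r)" unfolding z nw[OF r(1)] using r by simp
        also have "\<dots> = 1" using r by (simp add: exp_minus)
        finally show "\<bar>Im w\<bar> < 1" using abs_Im_le_cmod[of w] by linarith
      qed
    qed (intro holomorphic_intros)
    show "0 < - ln r / pi" using r by (simp add: divide_neg_pos)
    fix z assume z: "Im z \<le> 0"
    have "norm (of_real r * exp (- \<i> * of_real pi * z)) \<le> r"
      unfolding nw[OF r(1)] using z r by (simp add: mult_nonneg_nonpos)
    from norm_Arctan_le[OF this r(2)]
    show "norm (\<phi> r z) \<le> r / (1 - r\<^sup>2) * exp (- pi * \<bar>Im z\<bar>)"
      unfolding \<phi>_def nw[OF r(1)] using z by simp
  qed
  define u where "u = (\<lambda>r x. 2 * Re (Arctan (of_real r * cis (pi * x))))"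
  have u_eq: "of_real (u r x) = \<phi> r (of_real x) + \<phi> r (- of_real x)" if r: "0 < r" "r < 1" for r x
  proof -
    have e: "exp (- \<i> * of_real pi * of_real x) = cnj (cis (pi * x))" "exp (- \<i> * of_real pi * (- of_real x)) = cis (pi * x)"
      by (simp_all add: cis_conv_exp mult_ac exp_cnj)
    have "\<phi> r (of_real x) = Arctan (cnj (of_real r * cis (pi * x)))" unfolding \<phi>_def e by simp
    also have "\<dots> = cnj (Arctan (of_real r * cis (pi * x)))"
      using r by (intro cnj_Arctan) (simp add: norm_mult)
    finally show ?thesis unfolding u_def \<phi>_def e
      by (simp add: complex_add_cnj add.commute)
  qed
  have \<phi>c: "continuous_on UNIV (\<lambda>x::real. \<phi> r (of_real x))" if r: "0 < r" "r < 1" for r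
    unfolding \<phi>_def
  proof (rule continuous_on_compose2[where s = UNIV and t = "ball 0 1" and g = Arctan])
    show "continuous_on (ball 0 1) Arctan"
    proof (rule continuous_on_Arctan)
      fix z :: complex assume "z \<in> ball 0 1"
      then show "\<bar>Im z\<bar> < 1" using abs_Im_le_cmod[of z] by auto
    qed
    show "(\<lambda>x. of_real r * exp (- \<i> * of_real pi * of_real x)) ` UNIV \<subseteq> ball 0 1"
      using nw[of r "of_real _"] r by (auto simp del: mult_minus_left)
  qed (intro continuous_intros)
  have zero: "(\<integral>x. F (of_real x) * of_real (u r x) \<partial>lborel) = 0" if r: "0 < r" "r < 1" for r
  proof -
    have \<phi>b: "norm (\<phi> r (of_real x)) \<le> r / (1 - r\<^sup>2)" for x
    proof -
      have "norm (of_real r * exp (- \<i> * of_real pi * of_real x)) \<le> r"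
        unfolding nw[OF r(1)] by simp
      from norm_Arctan_le[OF this r(2)] show ?thesis
        unfolding \<phi>_def nw[OF r(1)] by simp
    qed
    have [measurable]: "(\<lambda>x. \<phi> r (of_real x)) \<in> borel_measurable borel" 
      by (rule borel_measurable_continuous_onI[OF \<phi>c[OF r]])
    have bd: "integrable lborel (\<lambda>x. G x * \<phi> r (of_real x))" if "integrable lborel G" for G :: "real \<Rightarrow> complex"
    proof (rule Bochner_Integration.integrable_bound[OF integrable_mult_left[OF integrable_norm[OF that], of "r / (1 - r\<^sup>2)"]])
      show "AE x in lborel. norm (G x * \<phi> r (of_real x)) \<le> norm (norm (G x) * (r / (1 - r\<^sup>2)))"
      proof (intro AE_I2)
        fix x show "norm (G x * \<phi> r (of_real x)) \<le> norm (norm (G x) * (r / (1 - r\<^sup>2)))"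
          using mult_left_mono[OF \<phi>b[of x], of "norm (G x)"] unfolding norm_mult real_norm_def
          by (rule order_trans[OF _ abs_ge_self]) auto
      qed
    qed (use that in measurable)
    have Fm: "integrable lborel (\<lambda>x. F (- of_real x))"
      using lborel_integrable_real_affine[OF int, of "-1" 0] by simp
    have i1: "integrable lborel (\<lambda>x. F (of_real x) * \<phi> r (of_real x))" by (rule bd[OF int])
    have i2': "integrable lborel (\<lambda>x. F (- of_real x) * \<phi> r (of_real x))" by (rule bd[OF Fm])
    have i2: "integrable lborel (\<lambda>x. F (of_real x) * \<phi> r (- of_real x))"
      using lborel_integrable_real_affine[OF i2', of "-1" 0] by simp
    have "(\<integral>x. F (- of_real x) * \<phi> r (of_real x) \<partial>lborel) = 0"
    proof (rule half[OF holomorphic_on_UNIV_uminus[OF F] Fm _ r])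
      show "norm (F (- z)) \<le> C * exp (pi * \<bar>Im z\<bar>)" for z using Fb[of "- z"] by simp
    qed
    then have z2: "(\<integral>x. F (of_real x) * \<phi> r (- of_real x) \<partial>lborel) = 0"
      using lborel_integral_real_affine[of "-1" "\<lambda>x. F (- of_real x) * \<phi> r (of_real x)" 0] by simp
    have "(\<integral>x. F (of_real x) * of_real (u r x) \<partial>lborel) =
      (\<integral>x. F (of_real x) * \<phi> r (of_real x) + F (of_real x) * \<phi> r (- of_real x) \<partial>lborel)"
      by (simp only: u_eq[OF r] distrib_left)
    also have "\<dots> = 0" using half[OF F int Fb r] z2 by (simp add: Bochner_Integration.integral_add[OF i1 i2])
    finally show ?thesis .
  qed
  define rn where "rn = (\<lambda>n. 1 - inverse (real (Suc (Suc n))))"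
  have rn: "0 < rn n" "rn n < 1" for n by (simp_all add: rn_def field_simps)
  have rl: "rn \<longlonglongrightarrow> 1" unfolding rn_def
    using tendsto_diff[OF tendsto_const LIMSEQ_Suc[OF LIMSEQ_inverse_real_of_nat], of 1] by simp
  have [measurable]: "(\<lambda>x. complex_of_real (u (rn n) x)) \<in> borel_measurable borel" for n
  proof (rule borel_measurable_continuous_onI)
    have "continuous_on UNIV (\<lambda>x::real. \<phi> (rn n) (of_real x) + \<phi> (rn n) (- of_real x))"
      using continuous_on_compose2[OF \<phi>c[OF rn, of n], of UNIV uminus] continuous_on_minus[OF continuous_on_id]
      by (intro continuous_on_add \<phi>c rn) auto
    then show "continuous_on UNIV (\<lambda>x. complex_of_real (u (rn n) x))"
      by (simp only: u_eq[OF rn])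
  qed
  have "(\<lambda>n. \<integral>x. F (of_real x) * of_real (u (rn n) x) \<partial>lborel) \<longlonglongrightarrow>
      (\<integral>x. F (of_real x) * of_real (pi / 2 * sgn (cos (pi * x))) \<partial>lborel)"
  proof (rule integral_dominated_convergence[where w = "\<lambda>x. norm (F (of_real x)) * pi"])
    show "AE x in lborel. (\<lambda>n. F (of_real x) * of_real (u (rn n) x)) \<longlonglongrightarrow> F (of_real x) * of_real (pi / 2 * sgn (cos (pi * x)))"
      using AE_cos_pi_nonzero
    proof eventually_elim
      case (elim x)
      have "isCont Arctan (cis (pi * x))"
        using elim by (intro continuous_at_Arctan) auto
      moreover have "(\<lambda>n. of_real (rn n) * cis (pi * x)) \<longlonglongrightarrow> of_real 1 * cis (pi * x)"
        by (intro tendsto_intros rl)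
      ultimately have "(\<lambda>n. Arctan (of_real (rn n) * cis (pi * x))) \<longlonglongrightarrow> Arctan (cis (pi * x))"
        using isCont_tendsto_compose[of "cis (pi * x)" Arctan] by simp
      then have "(\<lambda>n. F (of_real x) * of_real (u (rn n) x)) \<longlonglongrightarrow> F (of_real x) * of_real (2 * Re (Arctan (cis (pi * x))))"
        unfolding u_def by (intro tendsto_intros)
      then show ?case by (simp add: Re_Arctan_unit_circle[OF elim])
    qed
    \<comment> \<open>The bound r/(1 - r^2) blows up as r tends to 1; the estimate |Re Arctan| <
      \<pi>/2 gives a dominating function independent of r.\<close>
    show "AE x in lborel. norm (F (of_real x) * of_real (u (rn n) x)) \<le> norm (F (of_real x)) * pi" for n
    proof (intro AE_I2)
      fix x
      have "\<bar>Im (of_real (rn n) * cis (pi * x))\<bar> < 1"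
      proof -
        have "norm (of_real (rn n) * cis (pi * x)) < 1" using rn[of n] by (simp add: norm_mult)
        then show ?thesis using abs_Im_le_cmod order_le_less_trans by blast
      qed
      then have "\<bar>u (rn n) x\<bar> \<le> pi" using Re_Arctan_bounds[of "of_real (rn n) * cis (pi * x)"]
        unfolding u_def by linarith
      then show "norm (F (of_real x) * of_real (u (rn n) x)) \<le> norm (F (of_real x)) * pi"
        by (simp add: norm_mult mult_left_mono)
    qed
  qed (use int in simp_all)
  moreover have "(\<integral>x. F (of_real x) * of_real (u (rn n) x) \<partial>lborel) = 0" for n by (rule zero[OF rn])
  ultimately have "(\<lambda>n::nat. 0) \<longlonglongrightarrow> (\<integral>x. F (of_real x) * of_real (pi / 2 * sgn (cos (pi * x))) \<partial>lborel)"
    by (simp only:)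
  then have "(\<integral>x. F (of_real x) * of_real (pi / 2 * sgn (cos (pi * x))) \<partial>lborel) = 0"
    by (rule LIMSEQ_unique[OF _ tendsto_const])
  moreover have "(\<integral>x. F (of_real x) * of_real (pi / 2 * sgn (cos (pi * x))) \<partial>lborel) =
     (\<integral>x. of_real (pi / 2) * (F (of_real x) * of_real (sgn (cos (pi * x)))) \<partial>lborel)"
    by (intro Bochner_Integration.integral_cong) auto
  ultimately show ?thesis by (simp del: of_real_divide)
qed

section \<open>Division by the cosine\<close>

lemma cos_pi_eq_0_iff_complex:
  fixes z :: complex
  shows "cos (of_real pi * z) = 0 \<longleftrightarrow> (\<exists>n::int. z = of_real (of_int n + 1 / 2))"
proof -
  have "of_real pi * z = of_real (of_int n * pi) + of_real pi / 2 \<longleftrightarrow> z = of_real (of_int n + 1 / 2)" for n :: int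
  proof -
    have "of_real pi * z = of_real (of_int n * pi) + of_real pi / 2 \<longleftrightarrow> of_real pi * z = of_real pi * of_real (of_int n + 1 / 2)"
      by (simp add: algebra_simps)
    also have "\<dots> \<longleftrightarrow> z = of_real (of_int n + 1 / 2)" by (subst mult_cancel_left) simp
    finally show ?thesis .
  qed
  then show ?thesis by (simp add: cos_eq_0)
qed

lemma sin_pi_nonzero_if_cos_pi_zero:
  assumes "cos (of_real pi * z) = (0::complex)"
  shows "sin (of_real pi * z) \<noteq> 0"
  using assms sin_cos_squared_add[of "of_real pi * z"] by (auto simp del: sin_cos_squared_add sin_cos_squared_add2)

lemma norm_cos_pi_ge_Im:
  assumes "\<bar>Im z\<bar> \<ge> 1"
  shows "exp (pi * \<bar>Im z\<bar>) / 4 \<le> norm (cos (of_real pi * z))"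
proof -
  define y where "y = pi * \<bar>Im z\<bar>"
  have "y \<ge> 1" using assms pi_ge_two unfolding y_def
    by (metis mult_mono mult_1 one_le_numeral order_trans pi_ge_zero zero_le_one)
  have e: "exp y \<ge> 2" using exp_ge_add_one_self[of y] \<open>y \<ge> 1\<close> by linarith
  have "inverse (exp y) \<le> exp y / 2" using e mult_mono[OF e e] by (simp add: field_simps)
  then have "(exp y / 2)\<^sup>2 \<le> (exp y - inverse (exp y))\<^sup>2"
    using e by (intro power_mono) auto
  moreover have "(exp y - inverse (exp y))\<^sup>2 = (exp (pi * Im z) - inverse (exp (pi * Im z)))\<^sup>2"
    by (cases "Im z \<ge> 0") (auto simp: y_def exp_minus power2_commute)
  moreover have "(norm (cos (of_real pi * z)))\<^sup>2 \<ge> (exp (pi * Im z) - inverse (exp (pi * Im z)))\<^sup>2 / 4"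
    unfolding norm_cos_squared by simp
  ultimately have "(exp y / 4)\<^sup>2 \<le> (norm (cos (of_real pi * z)))\<^sup>2"
    by (simp add: power_divide)
  then show ?thesis unfolding y_def by (rule power2_le_imp_le) auto
qed

text \<open>On vertical lines through integers, midway between the zeros, |cos(\<pi> z)| equals
  cosh(\<pi> Im z). Together with the bound for |Im z| \<ge> 1 this controls the cosine on the
  boundary of a box around each zero.\<close>

lemma norm_cos_pi_ge_Int:
  assumes "Re z \<in> \<int>"
  shows "exp (pi * \<bar>Im z\<bar>) / 4 \<le> norm (cos (of_real pi * z))"
proof -
  define y where "y = pi * \<bar>Im z\<bar>"
  obtain m where m: "Re z = of_int m" using assms by (auto elim: Ints_cases)
  have "(cos (pi * Re z))\<^sup>2 = 1"
    unfolding m cos_squared_eq using sin_zero_iff_int2[of "pi * of_int m"] by (auto simp: mult.commute)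
  then have "(norm (cos (of_real pi * z)))\<^sup>2 = 1 + (exp (pi * Im z) - inverse (exp (pi * Im z)))\<^sup>2 / 4"
    unfolding norm_cos_squared by simp
  also have "\<dots> = 1 + (exp y - inverse (exp y))\<^sup>2 / 4"
    by (cases "Im z \<ge> 0") (auto simp: y_def exp_minus power2_commute)
  also have "\<dots> = (exp y + inverse (exp y))\<^sup>2 / 4"
    by (simp add: power2_eq_square field_simps)
  also have "\<dots> = ((exp y + inverse (exp y)) / 2)\<^sup>2" by (simp add: power_divide)
  finally have "(exp y / 4)\<^sup>2 \<le> (norm (cos (of_real pi * z)))\<^sup>2"
    by (simp only:) (rule power_mono, auto)
  then show ?thesis unfolding y_def by (rule power2_le_imp_le) auto
qed

lemma closed_box_frontier:
  assumes "z \<in> frontier {z. a \<le> Re z \<and> Re z \<le> b \<and> \<bar>Im z\<bar> \<le> c}"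
  shows "a \<le> Re z" "Re z \<le> b" "\<bar>Im z\<bar> \<le> c" "Re z = a \<or> Re z = b \<or> \<bar>Im z\<bar> = c"
proof -
  let ?S = "{z. a \<le> Re z \<and> Re z \<le> b \<and> \<bar>Im z\<bar> \<le> c}" and ?U = "{z. a < Re z \<and> Re z < b \<and> \<bar>Im z\<bar> < c}"
  have "closed ?S" by (intro closed_Collect_conj closed_Collect_le continuous_intros)
  then have "z \<in> ?S" "z \<notin> interior ?S" using assms by (auto simp: frontier_def)
  moreover have "open ?U" by (intro open_Collect_conj open_Collect_less continuous_intros)
  then have "?U \<subseteq> interior ?S" by (intro interior_maximal) auto
  ultimately show "a \<le> Re z" "Re z \<le> b" "\<bar>Im z\<bar> \<le> c" "Re z = a \<or> Re z = b \<or> \<bar>Im z\<bar> = c" by force+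
qed

text \<open>The zeros of the cosine are simple, so the quotient extends. Its bound is immediate
  wherever the cosine is comparable to exp(\<pi>|Im z|), and elsewhere follows from the maximum
  principle on a box. One factor 4 is the loss in the cosine, the others come from 1 + |w| \<le> 4(1
  + |z|) for w in the box of z.\<close>

lemma entire_divide_cos_pi:
  fixes G :: "complex \<Rightarrow> complex"
  assumes G: "G holomorphic_on UNIV" and zeros: "\<And>z. cos (of_real pi * z) = 0 \<Longrightarrow> G z = 0"
    and bound: "\<And>z. norm (G z) \<le> C * (1 + norm z) ^ k * exp (pi * \<bar>Im z\<bar>)"
  obtains Q where "Q holomorphic_on UNIV" "\<And>z. G z = Q z * cos (of_real pi * z)"
    "\<And>z. norm (Q z) \<le> 4 ^ Suc k * C * (1 + norm z) ^ k"
proof -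
  define c where "c = (\<lambda>z::complex. cos (of_real pi * z))"
  define Z where "Z = {z. c z = 0}"
  \<comment> \<open>The value at a zero is the limit given by l'Hopital's rule; continuity there
    makes the singularity removable.\<close>
  define Q where "Q = (\<lambda>z. if c z = 0 then deriv G z / (- of_real pi * sin (of_real pi * z)) else G z / c z)"
  have C0: "C \<ge> 0" using order_trans[OF norm_ge_zero bound[of 0]] by simp
  have ch: "c holomorphic_on A" for A unfolding c_def by (intro holomorphic_intros)
  have oZ: "open (- Z)"
    unfolding Z_def Collect_neg_eq[symmetric] c_def by (intro open_Collect_neq continuous_intros)
  have Q1: "Q holomorphic_on - Z"
  proof (rule holomorphic_transform)
    show "(\<lambda>z. G z / c z) holomorphic_on - Z"
      by (intro holomorphic_on_divide ch holomorphic_on_subset[OF G]) (auto simp: Z_def)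
  qed (auto simp: Q_def Z_def)
  have "Q field_differentiable at a" for a
  proof (cases "a \<in> Z")
    case False
    then show ?thesis using Q1 oZ by (auto intro: holomorphic_on_imp_differentiable_at)
  next
    case True
    have iso: "ball a 1 - {a} \<subseteq> - Z"
    proof
      fix w assume w: "w \<in> ball a 1 - {a}"
      show "w \<in> - Z"
      proof
        assume "w \<in> Z"
        then obtain m n :: int where mn: "w = of_real (of_int m + 1 / 2)" "a = of_real (of_int n + 1 / 2)"
          using True unfolding Z_def c_def by (auto simp: cos_pi_eq_0_iff_complex)
        have "dist a w = \<bar>real_of_int (n - m)\<bar>" 
          unfolding dist_norm mn by (simp flip: of_real_diff add: norm_of_real del: of_real_add)
        then have "\<bar>real_of_int (n - m)\<bar> < 1" using w by simp
        then have "n = m" by linarith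
        then show False using w mn by simp
      qed
    qed
    have Gd: "(G has_field_derivative deriv G a) (at a)"
      using G by (meson UNIV_I holomorphic_derivI open_UNIV)
    have cd: "(c has_field_derivative - of_real pi * sin (of_real pi * a)) (at a)"
      unfolding c_def by (auto intro!: derivative_eq_intros)
    have "((\<lambda>w. G w / c w) \<longlongrightarrow> Q a) (at a)"
    proof (rule lhopital_complex_simple[OF Gd cd])
      show "G a = 0" "c a = 0" using True zeros by (auto simp: Z_def c_def)
      show "- of_real pi * sin (of_real pi * a) \<noteq> 0"
        using True sin_pi_nonzero_if_cos_pi_zero[of a] by (auto simp: Z_def c_def)
      show "deriv G a / (- of_real pi * sin (of_real pi * a)) = Q a"
        using True by (simp add: Q_def Z_def)
    qed
    then have "(Q \<longlongrightarrow> Q a) (at a)"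
    proof (rule Lim_transform_within_open[where s = "ball a 1"])
      fix w assume "w \<in> ball a 1" "w \<noteq> a"
      then show "G w / c w = Q w" using iso by (auto simp: Q_def Z_def)
    qed auto
    then have "(Q \<longlongrightarrow> Q a) (at a within ball a 1)" by (rule tendsto_within_subset) auto
    then have "Q holomorphic_on ball a 1"
      using no_isolated_singularity'[of "{a}" Q "ball a 1"] holomorphic_on_subset[OF Q1 iso] by simp
    then show ?thesis by (auto intro: holomorphic_on_imp_differentiable_at[of _ "ball a 1"])
  qed
  then have Qh: "Q holomorphic_on A" for A by (auto simp: holomorphic_on_def field_differentiable_at_within)
  have eq: "G z = Q z * c z" for z using zeros[of z] by (auto simp: Q_def c_def)
  have far: "norm (Q z) \<le> 4 * C * (1 + norm z) ^ k" if "exp (pi * \<bar>Im z\<bar>) / 4 \<le> norm (c z)" for z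
  proof -
    have p: "norm (c z) > 0" using that exp_gt_zero[of "pi * \<bar>Im z\<bar>"] by linarith
    have "norm (Q z) * norm (c z) \<le> C * (1 + norm z) ^ k * exp (pi * \<bar>Im z\<bar>)"
      using bound[of z] unfolding eq norm_mult .
    also have "\<dots> \<le> C * (1 + norm z) ^ k * (4 * norm (c z))"
      using that C0 by (intro mult_left_mono) auto
    finally show ?thesis using p by simp
  qed
  have Qb: "norm (Q z) \<le> 4 ^ Suc k * C * (1 + norm z) ^ k" for z
  proof (cases "\<bar>Im z\<bar> \<ge> 1")
    case True
    have "norm (Q z) \<le> 4 * C * (1 + norm z) ^ k"
      using far[of z] norm_cos_pi_ge_Im[OF True] by (simp add: c_def)
    also have "\<dots> \<le> 4 ^ Suc k * C * (1 + norm z) ^ k"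
      using C0 by (intro mult_right_mono) auto
    finally show ?thesis .
  next
    case False
    define m where "m = \<lfloor>Re z\<rfloor>"
    \<comment> \<open>This box contains exactly one zero, at m + 1/2, and the cosine is bounded
      below on all four sides: the vertical ones lie over integers, the horizontal ones have |Im w|
      = 1.\<close>
    define S where "S = {w. of_int m \<le> Re w \<and> Re w \<le> of_int (m + 1) \<and> \<bar>Im w\<bar> \<le> 1}"
    have near: "norm w \<le> norm z + 3" if "w \<in> S" for w
    proof -
      have "norm (w - z) \<le> \<bar>Re (w - z)\<bar> + \<bar>Im (w - z)\<bar>" by (rule cmod_le)
      moreover have "\<bar>Re (w - z)\<bar> \<le> 1" using that unfolding S_def m_def by simp linarith
      moreover have "\<bar>Im (w - z)\<bar> \<le> 2" using that False unfolding S_def by simp linarith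
      ultimately have "norm (w - z) \<le> 3" by linarith
      then show ?thesis using norm_triangle_ineq[of z "w - z"] by simp
    qed
    show ?thesis
    proof (rule maximum_modulus_frontier[of Q S])
      show "Q holomorphic_on interior S" "continuous_on (closure S) Q"
        using Qh by (auto intro: holomorphic_on_imp_continuous_on)
      show "bounded S" using near by (auto simp: bounded_iff)
      show "z \<in> S" using False by (auto simp: S_def m_def)
      fix w assume w: "w \<in> frontier S"
      note f = closed_box_frontier[OF w[unfolded S_def]]
      have wS: "w \<in> S" using f by (simp add: S_def)
      have "exp (pi * \<bar>Im w\<bar>) / 4 \<le> norm (c w)"
        using f(4) norm_cos_pi_ge_Int[of w] norm_cos_pi_ge_Im[of w] by (auto simp: c_def)
      then have "norm (Q w) \<le> 4 * C * (1 + norm w) ^ k" by (rule far)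
      also have "\<dots> \<le> 4 * C * (4 * (1 + norm z)) ^ k"
        using near[OF wS] C0 norm_ge_zero[of z] norm_ge_zero[of w]
        by (intro mult_left_mono power_mono) (simp_all del: norm_ge_zero)
      finally show "norm (Q w) \<le> 4 ^ Suc k * C * (1 + norm z) ^ k"
        unfolding power_mult_distrib by (simp add: mult_ac)
    qed
  qed
  show ?thesis by (rule that[OF Qh eq[unfolded c_def] Qb])
qed

section \<open>Uniqueness for integrable functions and for antiperiodic polynomials\<close>

lemma not_integrable_cos_pi: "\<not> integrable lborel (\<lambda>x::real. complex_of_real (cos (pi * x)))"
proof
  assume "integrable lborel (\<lambda>x::real. complex_of_real (cos (pi * x)))"
  \<comment> \<open>The square is dominated by |cos(\<pi> x)| and has the explicit integral n over
    [-n, n], which is unbounded.\<close>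
  then have i: "integrable lborel (\<lambda>x::real. complex_of_real ((cos (pi * x))\<^sup>2))"
  proof (rule Bochner_Integration.integrable_bound)
    show "AE x in lborel. norm (complex_of_real ((cos (pi * x))\<^sup>2)) \<le> norm (complex_of_real (cos (pi * x)))"
    proof (intro AE_I2)
      fix x :: real
      have "\<bar>cos (pi * x)\<bar> * \<bar>cos (pi * x)\<bar> \<le> \<bar>cos (pi * x)\<bar> * 1"
        by (intro mult_left_mono) auto
      then show "norm (complex_of_real ((cos (pi * x))\<^sup>2)) \<le> norm (complex_of_real (cos (pi * x)))"
        by (simp only: norm_of_real power2_eq_square abs_mult mult_1_right)
    qed
  qed measurable
  have "integral {- real n..real n} (\<lambda>x. complex_of_real ((cos (pi * x))\<^sup>2)) = of_nat n" for n
  proof (rule integral_unique)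
    have "((\<lambda>x. (cos (pi * x))\<^sup>2) has_integral 
      (real n / 2 + sin (2 * pi * real n) / (4 * pi)) - (- real n / 2 + sin (2 * pi * - real n) / (4 * pi))) {- real n..real n}"
    proof (rule fundamental_theorem_of_calculus)
      fix x :: real
      have "((\<lambda>x. x / 2 + sin (2 * pi * x) / (4 * pi)) has_field_derivative (cos (pi * x))\<^sup>2) (at x within {- real n..real n})"
      proof (rule DERIV_cong)
        show "((\<lambda>x. x / 2 + sin (2 * pi * x) / (4 * pi)) has_field_derivative 1 / 2 + cos (2 * pi * x) * (2 * pi) / (4 * pi)) (at x within {- real n..real n})"
          by (auto intro!: derivative_eq_intros)
        show "1 / 2 + cos (2 * pi * x) * (2 * pi) / (4 * pi) = (cos (pi * x))\<^sup>2"
          using cos_double_cos[of "pi * x"] by (simp add: mult.assoc diff_divide_distrib)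
      qed
      then show "((\<lambda>x. x / 2 + sin (2 * pi * x) / (4 * pi)) has_vector_derivative (cos (pi * x))\<^sup>2) (at x within {- real n..real n})"
        by (simp add: has_real_derivative_iff_has_vector_derivative)
    qed simp
    moreover have "sin (2 * pi * real n) = 0" using sin_npi2[of "2 * n"] by (simp add: mult_ac)
    ultimately have "((\<lambda>x. (cos (pi * x))\<^sup>2) has_integral real n) {- real n..real n}" by simp
    from has_integral_of_real[OF this] show "((\<lambda>x. complex_of_real ((cos (pi * x))\<^sup>2)) has_integral of_nat n) {- real n..real n}"
      by simp
  qed
  with integral_over_reals_eq_limit[OF i]
  have "convergent (\<lambda>n. of_nat n :: complex)" by (auto simp: convergent_def)
  then have "Bseq (\<lambda>n. of_nat n :: complex)" by (rule convergent_imp_Bseq)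
  then obtain K where "\<And>n. norm (of_nat n :: complex) \<le> K" by (auto simp: Bseq_def)
  then have K: "real n \<le> K" for n by simp
  show False using K[of "nat \<lceil>K\<rceil> + 1"] by linarith
qed

text \<open>With growth exponent k = 0 the quotient is bounded, hence constant. So \<open>F\<close>
  is a multiple of the cosine, and only the zero multiple is integrable.\<close>

proposition exp_type_pi_eq_0_if_zero_on_half_integers:
  assumes F: "F holomorphic_on UNIV" and int: "integrable lborel (\<lambda>x. F (of_real x))"
    and Fb: "\<And>z. norm (F z) \<le> C * exp (pi * \<bar>Im z\<bar>)"
    and zeros: "\<And>z. cos (of_real pi * z) = 0 \<Longrightarrow> F z = 0"
  shows "F z = 0"
proof -
  obtain Q where Q: "Q holomorphic_on UNIV" "\<And>z. F z = Q z * cos (of_real pi * z)" "\<And>z. norm (Q z) \<le> 4 * C"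
    by (rule entire_divide_cos_pi[OF F zeros, of C 0]) (use Fb in auto)
  have "bounded (range Q)" using Q(3) by (auto simp: bounded_iff)
  from Liouville_theorem[OF Q(1) this] obtain c where c: "\<And>z. Q z = c" by (auto simp: constant_on_def)
  have "c = 0"
  proof (rule ccontr)
    assume "c \<noteq> 0"
    have "integrable lborel (\<lambda>x. inverse c * F (of_real x))" using int by simp
    then have "integrable lborel (\<lambda>x::real. complex_of_real (cos (pi * x)))"
      using \<open>c \<noteq> 0\<close> by (simp add: Q(2) c cos_of_real mult.assoc[symmetric] flip: of_real_mult)
    then show False using not_integrable_cos_pi by blast
  qed
  then show ?thesis by (simp add: Q(2) c)
qed

text \<open>\<open>Q\<close> is a polynomial that takes the value \<open>Q 0\<close> at every even
  natural number, hence is constant, and an antiperiodic constant vanishes. Antiperiodicity is asked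
  only at naturals, where the cosine to be divided out is known not to vanish.\<close>

lemma antiperiodic_polynomial_growth_eq_0:
  fixes Q :: "complex \<Rightarrow> complex"
  assumes Q: "Q holomorphic_on UNIV" and b: "\<And>z. norm (Q z) \<le> C * (1 + norm z) ^ k"
    and anti: "\<And>n. Q (of_nat n + 1) = - Q (of_nat n)"
  shows "Q z = 0"
proof -
  have C0: "C \<ge> 0" using order_trans[OF norm_ge_zero b[of 0]] by simp
  define c where "c = (\<lambda>i. (deriv ^^ i) Q 0 / fact i)"
  have poly: "Q w = (\<Sum>i\<le>k. c i * w ^ i)" for w unfolding c_def
  proof (rule Liouville_polynomial[OF Q, where A = 1 and B = "C * 2 ^ k"])
    fix z :: complex assume "1 \<le> norm z"
    then have "C * (1 + norm z) ^ k \<le> C * (2 * norm z) ^ k"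
      using C0 by (intro mult_left_mono power_mono) auto
    then show "norm (Q z) \<le> C * 2 ^ k * norm z ^ k"
      using b[of z] by (simp add: power_mult_distrib mult_ac)
  qed
  have per: "Q (of_nat (2 * n)) = Q 0" for n
  proof (induction n)
    case (Suc n)
    have "Q (of_nat (2 * Suc n)) = Q (of_nat (2 * n + 1) + 1)" by (simp add: add_ac)
    also have "\<dots> = - Q (of_nat (2 * n + 1))" by (simp only: anti)
    also have "\<dots> = - Q (of_nat (2 * n) + 1)" by (simp add: add_ac)
    also have "\<dots> = Q (of_nat (2 * n))" by (simp only: anti minus_minus)
    finally show ?case using Suc by simp
  qed simp
  \<comment> \<open>The coefficients of \<open>Q w - Q 0\<close>, whose root set is
    infinite.\<close>
  define c' where "c' = (\<lambda>i. if i = 0 then c 0 - Q 0 else c i)"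
  have poly': "Q w - Q 0 = (\<Sum>i\<le>k. c' i * w ^ i)" for w
    unfolding poly[of w] c'_def by (simp add: sum.atMost_shift)
  have "\<not> (\<exists>i\<le>k. c' i \<noteq> 0)"
  proof
    assume "\<exists>i\<le>k. c' i \<noteq> 0"
    then have "finite {w. (\<Sum>i\<le>k. c' i * w ^ i) = 0}" by (subst polyfun_finite_roots)
    moreover have "range (\<lambda>n. of_nat (2 * n) :: complex) \<subseteq> {w. (\<Sum>i\<le>k. c' i * w ^ i) = 0}"
      using per by (auto simp flip: poly')
    moreover have "infinite (range (\<lambda>n. of_nat (2 * n) :: complex))"
      by (rule range_inj_infinite) (auto intro!: injI simp flip: of_nat_mult)
    ultimately show False using finite_subset by blast
  qed
  then have const: "Q w = Q 0" for w using poly'[of w] by simp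
  have "Q 0 = - Q 0" using anti[of 0] const[of 1] by simp
  then show ?thesis using const[of z] by simp
qed

section \<open>Cardinal series at the half integers\<close>

definition half :: "nat \<Rightarrow> real" where
  "half k = real k + 1 / 2"

text \<open>The summands of the symmetric partial sum for n = -k and n = k + 1 taken together: their
  nodes are opposite, and an even function has the same value at both. The result is even, equal to
  1 at its two nodes and 0 at all other half integers.\<close>

definition cardinal_term :: "nat \<Rightarrow> complex \<Rightarrow> complex" where
  "cardinal_term k z = (-1) ^ k * (lterm (- half k) z - lterm (half k) z)"

lemma half_ge: "half k \<ge> 1 / 2" and half_pos [simp]: "half k > 0" and half_nonneg [simp]: "half k \<ge> 0"
  and half_nonzero [simp]: "half k \<noteq> 0"
  by (simp_all add: half_def add_nonneg_pos)

lemma filterlim_half: "filterlim half at_top sequentially"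
  unfolding half_def[abs_def] add.commute[of _ "1 / 2"]
  by (intro filterlim_tendsto_add_at_top[OF tendsto_const] filterlim_real_sequentially)

lemma cos_pi_half [simp]: "cos (pi * half k) = 0"
  unfolding cos_zero_iff_int2 by (rule exI[of _ "int k"]) (simp add: half_def algebra_simps)

lemma sin_pi_half [simp]: "sin (pi * half k) = (-1) ^ k"
proof -
  have "sin (pi * half k) = sin (real k * pi + pi / 2)" by (simp add: half_def algebra_simps)
  then show ?thesis by (simp only: sin_add cos_npi) simp
qed

lemma norm_cos_le_exp_Im: "norm (cos (w::complex)) \<le> exp \<bar>Im w\<bar>"
  and norm_sin_le_exp_Im: "norm (sin w) \<le> exp \<bar>Im w\<bar>"
proof -
  have a: "norm (exp (\<i> * w)) \<le> exp \<bar>Im w\<bar>" "norm (exp (- (\<i> * w))) \<le> exp \<bar>Im w\<bar>"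
    by (simp_all add: abs_if)
  show "norm (cos w) \<le> exp \<bar>Im w\<bar>"
    using norm_triangle_ineq[of "exp (\<i> * w)" "exp (- (\<i> * w))"] a
    unfolding cos_exp_eq norm_divide by (simp del: norm_exp_eq_Re)
  show "norm (sin w) \<le> exp \<bar>Im w\<bar>"
    using norm_triangle_ineq4[of "exp (\<i> * w)" "exp (- (\<i> * w))"] a
    unfolding sin_exp_eq norm_divide norm_mult by (simp del: norm_exp_eq_Re)
qed

lemma norm_cos_pi_le: "norm (cos (of_real pi * z)) \<le> exp (pi * \<bar>Im z\<bar>)"
  using norm_cos_le_exp_Im[of "of_real pi * z"] by (simp add: abs_mult)

lemma has_derivative_cos_pi:
  fixes z :: complex
  shows "((\<lambda>z. cos (of_real pi * z) / of_real pi) has_field_derivative - sin (of_real pi * z)) (at z within A)"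
  by (auto intro!: derivative_eq_intros)

lemma lterm_holomorphic:
  assumes "cos (pi * a) = 0"
  shows "lterm a holomorphic_on A"
proof -
  have "lterm a holomorphic_on UNIV"
  proof (rule pole_theorem_open_0[where g = "\<lambda>z. cos (of_real pi * z) / of_real pi" and a = "of_real a"])
    show "cos (of_real pi * of_real a) / of_real pi = (0::complex)"
      using assms by (simp add: cos_of_real flip: of_real_mult)
    show "lterm a (of_real a) = deriv (\<lambda>z. cos (of_real pi * z) / of_real pi) (of_real a)"
      using DERIV_imp_deriv[OF has_derivative_cos_pi[of "of_real a" UNIV]]
      by (simp add: lterm_def sin_of_real flip: of_real_mult)
  qed (auto simp: lterm_def intro!: holomorphic_intros)
  then show ?thesis by (rule holomorphic_on_subset) auto
qed

text \<open>Since the cosine vanishes at \<open>a\<close>, this is a difference quotient of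
  cos(\<pi> z)/\<pi>; bounding the derivative on the strip |Im w| \<le> |Im z| makes the estimate
  uniform in the node, even close to it.\<close>

lemma norm_lterm_le:
  assumes "cos (pi * a) = 0"
  shows "norm (lterm a z) \<le> exp (pi * \<bar>Im z\<bar>)"
proof (cases "z = of_real a")
  case True
  then have "norm (lterm a z) = \<bar>sin (pi * a)\<bar>" by (simp add: lterm_def)
  also have "\<dots> \<le> 1" by (rule abs_sin_le_one)
  also have "\<dots> \<le> exp (pi * \<bar>Im z\<bar>)" by simp
  finally show ?thesis .
next
  case False
  define c where "c = (\<lambda>z::complex. cos (of_real pi * z) / of_real pi)"
  have ca: "c (of_real a) = 0" using assms by (simp add: c_def cos_of_real flip: of_real_mult)
  have "norm (c z - c (of_real a)) \<le> exp (pi * \<bar>Im z\<bar>) * norm (z - of_real a)"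
  proof (rule field_differentiable_bound[where S = "{w. \<bar>Im w\<bar> \<le> \<bar>Im z\<bar>}"])
    show "convex {w. \<bar>Im w\<bar> \<le> \<bar>Im z\<bar>}"
    proof -
      have "{w. \<bar>Im w\<bar> \<le> \<bar>Im z\<bar>} = {w. Im w \<le> \<bar>Im z\<bar>} \<inter> {w. Im w \<ge> - \<bar>Im z\<bar>}" by auto
      then show ?thesis by (simp add: convex_Int convex_halfspace_Im_le convex_halfspace_Im_ge)
    qed
    show "(c has_field_derivative - sin (of_real pi * w)) (at w within {w. \<bar>Im w\<bar> \<le> \<bar>Im z\<bar>})" for w
      unfolding c_def by (rule has_derivative_cos_pi)
    show "norm (- sin (of_real pi * w)) \<le> exp (pi * \<bar>Im z\<bar>)" if "w \<in> {w. \<bar>Im w\<bar> \<le> \<bar>Im z\<bar>}" for w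
    proof -
      have "norm (- sin (of_real pi * w)) \<le> exp (pi * \<bar>Im w\<bar>)"
        using norm_sin_le_exp_Im[of "of_real pi * w"] by (simp add: abs_mult)
      also have "\<dots> \<le> exp (pi * \<bar>Im z\<bar>)" using that by simp
      finally show ?thesis .
    qed
  qed auto
  moreover have "lterm a z = c z / (z - of_real a)" using False by (simp add: lterm_def c_def)
  ultimately show ?thesis using False
    by (simp add: ca norm_divide) (simp add: pos_divide_le_eq)
qed

lemma lterm_minus: "lterm (- a) (- z) = - lterm a z"
  by (auto simp: lterm_def minus_equation_iff[of z] divide_simps) (auto simp: algebra_simps)

lemma cardinal_term_holomorphic: "cardinal_term k holomorphic_on A"
  unfolding cardinal_term_def[abs_def] by (intro holomorphic_intros lterm_holomorphic) simp_all

lemma norm_cardinal_term_le: "norm (cardinal_term k z) \<le> 2 * exp (pi * \<bar>Im z\<bar>)"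
proof -
  have "norm (cardinal_term k z) \<le> norm (lterm (- half k) z) + norm (lterm (half k) z)"
    by (simp add: cardinal_term_def norm_mult norm_power norm_triangle_ineq4)
  also have "\<dots> \<le> exp (pi * \<bar>Im z\<bar>) + exp (pi * \<bar>Im z\<bar>)"
    by (intro add_mono norm_lterm_le) simp_all
  finally show ?thesis by simp
qed

lemma cardinal_term_minus [simp]: "cardinal_term k (- z) = cardinal_term k z"
  using lterm_minus[of "half k" z] lterm_minus[of "- half k" z] by (simp add: cardinal_term_def)

lemma lterm_of_real: "lterm a (of_real x) \<in> \<real>"
  by (auto simp: lterm_def cos_of_real simp flip: of_real_mult of_real_diff of_real_divide)

lemma cardinal_term_of_real: "cardinal_term k (of_real x) \<in> \<real>"
  unfolding cardinal_term_def by (intro Reals_mult Reals_diff Reals_power lterm_of_real) auto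

lemma cardinal_term_half: "cardinal_term k (of_real (half m)) = (if k = m then 1 else 0)"
proof -
  have "lterm a (of_real (half m)) = (if half m = a then - of_real (sin (pi * a)) else 0)" for a
    by (auto simp: lterm_def cos_of_real simp flip: of_real_mult)
  moreover have "half m \<noteq> - half k" using half_pos[of m] half_pos[of k] by linarith
  moreover have "half m = half k \<longleftrightarrow> k = m" by (auto simp: half_def)
  ultimately show ?thesis by (auto simp: cardinal_term_def power_mult_distrib[symmetric])
qed

text \<open>Both sides vanish at the removable singularities \<open>\<plusminus> half k\<close>.\<close>
lemma cardinal_term_identity:
  "(1 - (z / of_real (half k))\<^sup>2) * cardinal_term k z = (-1) ^ k * (2 / of_real (pi * half k)) * cos (of_real pi * z)"
proof -
  define a where "a = complex_of_real (half k)"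
  have a0: "a \<noteq> 0" and cos0: "cos (of_real pi * a) = 0"
    by (simp_all add: a_def cos_of_real flip: of_real_mult)
  show ?thesis
  proof (cases "z = a \<or> z = - a")
    case True
    then have "cos (of_real pi * z) = 0" using cos0 by auto
    moreover have "(z / a)\<^sup>2 = 1" using True a0 by auto
    ultimately show ?thesis by (simp add: a_def)
  next
    case False
    then have "z \<noteq> a" "z \<noteq> - a" "z + a \<noteq> 0" "z - a \<noteq> 0" by (auto simp: add_eq_0_iff)
    then have L: "cardinal_term k z = (-1) ^ k * (cos (of_real pi * z) / (of_real pi * (z + a)) - cos (of_real pi * z) / (of_real pi * (z - a)))"
      by (simp add: cardinal_term_def lterm_def a_def)
    show ?thesis unfolding L a_def[symmetric] of_real_mult
      using \<open>z + a \<noteq> 0\<close> \<open>z - a \<noteq> 0\<close> a0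
      by (simp add: divide_simps) (simp add: power2_eq_square algebra_simps)
  qed
qed

text \<open>What remains of \<open>cardinal_term\<close> after its alternating leading part of order
  1/k is removed by the partial fraction identity. It is of order 1/k^3, so coefficients growing
  like k still give an absolutely convergent series.\<close>

definition cardinal_rest :: "nat \<Rightarrow> complex \<Rightarrow> complex" where
  "cardinal_rest k z = (z / of_real (half k))\<^sup>2 * cardinal_term k z"

lemma cardinal_term_split:
  "cardinal_term k z = (-1) ^ k / of_real (half k) * (2 / of_real pi * cos (of_real pi * z)) + cardinal_rest k z"
  using cardinal_term_identity[of z k] by (simp add: cardinal_rest_def algebra_simps)

text \<open>For nodes within distance 2|z| of the origin the uniform bound suffices. For the others
  |z / half k| \<le> 1/2, so the factor in \<open>cardinal_term_identity\<close> has modulus at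
  least 3/4 and can be divided out.\<close>

lemma half_mult_norm_cardinal_term_le:
  "half k * norm (cardinal_term k z) \<le> 4 * (1 + norm z) * exp (pi * \<bar>Im z\<bar>)"
proof (cases "half k < 2 * norm z")
  case True
  have "half k * norm (cardinal_term k z) \<le> (2 * norm z) * (2 * exp (pi * \<bar>Im z\<bar>))"
    using True half_pos[of k] by (intro mult_mono norm_cardinal_term_le) auto
  also have "\<dots> \<le> 4 * (1 + norm z) * exp (pi * \<bar>Im z\<bar>)" by (simp add: algebra_simps)
  finally show ?thesis .
next
  case False
  have "norm ((z / of_real (half k))\<^sup>2) \<le> (1 / 2)\<^sup>2"
    using False half_pos[of k] unfolding norm_power by (intro power_mono) (auto simp: norm_divide divide_simps)
  moreover have "norm (1::complex) - norm ((z / of_real (half k))\<^sup>2) \<le> norm (1 - (z / of_real (half k))\<^sup>2)"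
    by (rule norm_triangle_ineq2)
  ultimately have "3 / 4 \<le> norm (1 - (z / of_real (half k))\<^sup>2)" by (simp add: power_divide)
  then have "3 / 4 * (half k * norm (cardinal_term k z)) \<le> norm (1 - (z / of_real (half k))\<^sup>2) * (half k * norm (cardinal_term k z))"
    using half_pos[of k] by (intro mult_right_mono) auto
  also have "\<dots> = half k * norm ((1 - (z / of_real (half k))\<^sup>2) * cardinal_term k z)" by (simp add: norm_mult)
  also have "\<dots> = 2 / pi * norm (cos (of_real pi * z))" using half_pos[of k]
    unfolding cardinal_term_identity by (simp add: norm_mult norm_divide norm_power)
  also have "\<dots> \<le> 1 * exp (pi * \<bar>Im z\<bar>)"
    using pi_ge_two by (intro mult_mono norm_cos_pi_le) auto
  finally have "half k * norm (cardinal_term k z) \<le> 4 / 3 * exp (pi * \<bar>Im z\<bar>)" by simp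
  also have "\<dots> \<le> 4 * (1 + norm z) * exp (pi * \<bar>Im z\<bar>)" by (intro mult_right_mono) auto
  finally show ?thesis .
qed

lemma norm_cardinal_rest_le:
  "norm (cardinal_rest k z) \<le> 4 * (1 + norm z) ^ 3 * exp (pi * \<bar>Im z\<bar>) / half k ^ 3"
proof -
  have "norm (cardinal_rest k z) = (norm z)\<^sup>2 * (half k * norm (cardinal_term k z)) / half k ^ 3"
    using half_pos[of k] by (simp add: cardinal_rest_def norm_mult norm_power norm_divide power2_eq_square power3_eq_cube field_simps)
  also have "\<dots> \<le> (1 + norm z)\<^sup>2 * (4 * (1 + norm z) * exp (pi * \<bar>Im z\<bar>)) / half k ^ 3"
    using half_pos[of k] by (intro divide_right_mono mult_mono[OF power_mono half_mult_norm_cardinal_term_le]) auto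
  also have "\<dots> = 4 * (1 + norm z) ^ 3 * exp (pi * \<bar>Im z\<bar>) / half k ^ 3"
    by (simp add: power2_eq_square power3_eq_cube)
  finally show ?thesis .
qed

lemma summable_inverse_half_squared: "summable (\<lambda>k. 1 / (half k)\<^sup>2)"
proof (rule summable_comparison_test')
  show "summable (\<lambda>k. 4 * inverse (real (Suc k) ^ 2))"
    using inverse_power_summable[of 2, where 'a = real] by (intro summable_mult) (subst summable_Suc_iff, simp)
  fix k
  have "(real (Suc k) / 2)\<^sup>2 \<le> (half k)\<^sup>2" by (intro power_mono) (auto simp: half_def)
  then have "1 / (half k)\<^sup>2 \<le> 1 / (real (Suc k) / 2)\<^sup>2" by (intro divide_left_mono) auto
  then show "norm (1 / (half k)\<^sup>2) \<le> 4 * inverse (real (Suc k) ^ 2)"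
    by (simp add: power_divide field_simps)
qed

lemma scaled_cardinal_rest_le:
  assumes "\<bar>c\<bar> \<le> B * half k"
  shows "norm (of_real c * cardinal_rest k z) \<le> B * (4 * (1 + norm z) ^ 3 * exp (pi * \<bar>Im z\<bar>)) * (1 / (half k)\<^sup>2)"
proof -
  have "norm (of_real c * cardinal_rest k z) \<le> (B * half k) * (4 * (1 + norm z) ^ 3 * exp (pi * \<bar>Im z\<bar>) / half k ^ 3)"
    unfolding norm_mult norm_of_real
    using assms order_trans[OF abs_ge_zero assms] by (intro mult_mono norm_cardinal_rest_le) auto
  also have "\<dots> = B * (4 * (1 + norm z) ^ 3 * exp (pi * \<bar>Im z\<bar>)) * (1 / (half k)\<^sup>2)"
    using half_pos[of k] by (simp add: power2_eq_square power3_eq_cube)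
  finally show ?thesis .
qed

text \<open>All conditional convergence sits in the scalar series with limit
  \<open>\<alpha>\<close>, which multiplies one fixed entire function. The remainders are dominated,
  on each disc, by a multiple of the sum of 1/(k + 1/2)^2, so the Weierstrass test applies.\<close>

proposition cardinal_series:
  fixes c :: "nat \<Rightarrow> real"
  assumes c: "\<And>k. \<bar>c k\<bar> \<le> B * half k" and \<alpha>: "(\<lambda>N. \<Sum>k\<le>N. (-1) ^ k * c k / half k) \<longlonglongrightarrow> \<alpha>"
  obtains G C where "G holomorphic_on UNIV"
    "\<And>R. uniform_limit (cball 0 R) (\<lambda>N z. \<Sum>k\<le>N. of_real (c k) * cardinal_term k z) G sequentially"
    "\<And>z. norm (G z) \<le> C * (1 + norm z) ^ 3 * exp (pi * \<bar>Im z\<bar>)"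
    "\<And>z. G z = of_real \<alpha> * (2 / of_real pi * cos (of_real pi * z)) + (\<Sum>k. of_real (c k) * cardinal_rest k z)"
proof -
  define S where "S = (\<Sum>k. 1 / (half k)\<^sup>2)"
  have B0: "B \<ge> 0"
  proof -
    have "0 \<le> B * half 0" using order_trans[OF abs_ge_zero c[of 0]] .
    then show ?thesis using half_pos[of 0] by (simp add: zero_le_mult_iff)
  qed
  have S0: "S \<ge> 0" unfolding S_def by (rule suminf_nonneg[OF summable_inverse_half_squared]) auto
  define E where "E = (\<lambda>z. 4 * (1 + norm z) ^ 3 * exp (pi * \<bar>Im (z::complex)\<bar>))"
  have E0: "E z \<ge> 0" for z by (simp add: E_def)
  define T where "T = (\<lambda>z. \<Sum>k. of_real (c k) * cardinal_rest k z)"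
  define P where "P = (\<lambda>z::complex. 2 / of_real pi * cos (of_real pi * z))"
  define G where "G = (\<lambda>z. of_real \<alpha> * P z + T z)"
  have bd: "norm (of_real (c k) * cardinal_rest k z) \<le> B * E z * (1 / (half k)\<^sup>2)" for k z
    unfolding E_def by (rule scaled_cardinal_rest_le[OF c])
  have T: "norm (T z) \<le> B * E z * S" for z
  proof -
    have "norm (T z) \<le> (\<Sum>k. B * E z * (1 / (half k)\<^sup>2))"
      unfolding T_def by (rule norm_suminf_le[OF bd summable_mult[OF summable_inverse_half_squared]])
    then show ?thesis by (simp only: suminf_mult[OF summable_inverse_half_squared] S_def)
  qed
  have P: "norm (P z) \<le> E z" for z
  proof -
    have "norm (P z) = 2 / pi * norm (cos (of_real pi * z))" by (simp add: P_def norm_mult norm_divide)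
    also have "\<dots> \<le> 4 * (1 + norm z) ^ 3 * exp (pi * \<bar>Im z\<bar>)"
    proof (intro mult_mono norm_cos_pi_le)
      have "2 / pi \<le> 4 * 1" using pi_ge_two by (simp add: field_simps)
      also have "\<dots> \<le> 4 * (1 + norm z) ^ 3" by (intro mult_left_mono one_le_power) auto
      finally show "2 / pi \<le> 4 * (1 + norm z) ^ 3" .
    qed auto
    finally show ?thesis by (simp add: E_def)
  qed
  have Gb: "norm (G z) \<le> 4 * (\<bar>\<alpha>\<bar> + B * S) * (1 + norm z) ^ 3 * exp (pi * \<bar>Im z\<bar>)" for z
  proof -
    have "norm (G z) \<le> \<bar>\<alpha>\<bar> * E z + B * E z * S"
      unfolding G_def using mult_left_mono[OF P[of z], of "\<bar>\<alpha>\<bar>"] T[of z]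
      by (intro norm_triangle_le) (simp add: norm_mult)
    also have "\<dots> = 4 * (\<bar>\<alpha>\<bar> + B * S) * (1 + norm z) ^ 3 * exp (pi * \<bar>Im z\<bar>)"
      by (simp add: E_def algebra_simps)
    finally show ?thesis .
  qed
  have ul: "uniform_limit (cball 0 R) (\<lambda>N z. \<Sum>k\<le>N. of_real (c k) * cardinal_term k z) G sequentially" for R
  proof -
    define E' where "E' = 4 * (1 + \<bar>R\<bar>) ^ 3 * exp (pi * \<bar>R\<bar>)"
    have EE: "E z \<le> E'" if "z \<in> cball 0 R" for z
    proof -
      have "\<bar>Im z\<bar> \<le> \<bar>R\<bar>" "norm z \<le> \<bar>R\<bar>" using abs_Im_le_cmod[of z] that by auto
      then show ?thesis unfolding E_def E'_def by (intro mult_mono power_mono) auto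
    qed
    have "uniform_limit (cball 0 R) (\<lambda>n z. \<Sum>k<n. of_real (c k) * cardinal_rest k z) T sequentially"
      unfolding T_def
    proof (rule Weierstrass_m_test)
      show "norm (of_real (c k) * cardinal_rest k z) \<le> B * E' * (1 / (half k)\<^sup>2)" if "z \<in> cball 0 R" for k z
        using bd[of k z] mult_right_mono[OF mult_left_mono[OF EE[OF that] B0], of "1 / (half k)\<^sup>2"] by simp
      show "summable (\<lambda>k. B * E' * (1 / (half k)\<^sup>2))" by (rule summable_mult[OF summable_inverse_half_squared])
    qed
    from filterlim_compose[OF this filterlim_Suc]
    have 1: "uniform_limit (cball 0 R) (\<lambda>n z. \<Sum>k\<le>n. of_real (c k) * cardinal_rest k z) T sequentially"
      by (simp add: lessThan_Suc_atMost)
    have 2: "uniform_limit (cball 0 R) (\<lambda>N z. of_real (\<Sum>k\<le>N. (-1) ^ k * c k / half k) * P z) (\<lambda>z. of_real \<alpha> * P z) sequentially"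
    proof (rule uniform_limitI)
      fix e :: real assume e: "e > 0"
      have "E' > 0" unfolding E'_def by (intro mult_pos_pos zero_less_power) auto
      then have "\<forall>\<^sub>F N in sequentially. dist (\<Sum>k\<le>N. (-1) ^ k * c k / half k) \<alpha> < e / E'"
        using e by (intro tendstoD[OF \<alpha>]) auto
      then show "\<forall>\<^sub>F N in sequentially. \<forall>z\<in>cball 0 R. dist (of_real (\<Sum>k\<le>N. (-1) ^ k * c k / half k) * P z) (of_real \<alpha> * P z) < e"
      proof eventually_elim
        case (elim N)
        show ?case
        proof
          fix z :: complex assume z: "z \<in> cball 0 R"
          define x where "x = (\<Sum>k\<le>N. (-1) ^ k * c k / half k)"
          have "dist (of_real x * P z) (of_real \<alpha> * P z) = \<bar>x - \<alpha>\<bar> * norm (P z)"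
            unfolding dist_norm by (simp flip: left_diff_distrib of_real_diff add: norm_mult)
          also have "\<dots> \<le> \<bar>x - \<alpha>\<bar> * E'" using P[of z] EE[OF z] by (intro mult_left_mono) auto
          also have "\<dots> < e" using elim \<open>E' > 0\<close> by (simp add: dist_real_def x_def field_simps)
          finally show "dist (of_real (\<Sum>k\<le>N. (-1) ^ k * c k / half k) * P z) (of_real \<alpha> * P z) < e" by (simp add: x_def)
        qed
      qed
    qed
    have "(\<lambda>N z. \<Sum>k\<le>N. of_real (c k) * cardinal_term k z) =
      (\<lambda>N z. of_real (\<Sum>k\<le>N. (-1) ^ k * c k / half k) * P z + (\<Sum>k\<le>N. of_real (c k) * cardinal_rest k z))"
    proof (intro ext)
      fix N z
      have "of_real (c k) * cardinal_term k z = of_real ((-1) ^ k * c k / half k) * P z + of_real (c k) * cardinal_rest k z" for k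
        by (subst cardinal_term_split) (simp add: P_def field_simps)
      then show "(\<Sum>k\<le>N. of_real (c k) * cardinal_term k z) =
        of_real (\<Sum>k\<le>N. (-1) ^ k * c k / half k) * P z + (\<Sum>k\<le>N. of_real (c k) * cardinal_rest k z)"
        by (simp add: sum.distrib sum_distrib_right)
    qed
    then show ?thesis using uniform_limit_add[OF 2 1] by (simp add: G_def)
  qed
  have "G holomorphic_on UNIV"
  proof (rule holomorphic_uniform_sequence[where f = "\<lambda>N z. \<Sum>k\<le>N. of_real (c k) * cardinal_term k z"])
    show "(\<lambda>z. \<Sum>k\<le>N. of_real (c k) * cardinal_term k z) holomorphic_on UNIV" for N
      by (intro holomorphic_intros cardinal_term_holomorphic)
    fix x :: complex
    have "cball x 1 \<subseteq> cball 0 (norm x + 1)"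
    proof
      fix w assume "w \<in> cball x 1"
      then show "w \<in> cball 0 (norm x + 1)"
        using norm_triangle_ineq2[of w x] by (simp add: dist_norm norm_minus_commute)
    qed
    then show "\<exists>d>0. cball x d \<subseteq> UNIV \<and> uniform_limit (cball x d) (\<lambda>N z. \<Sum>k\<le>N. of_real (c k) * cardinal_term k z) G sequentially"
      using uniform_limit_on_subset[OF ul] by (intro exI[of _ 1]) auto
  qed auto
  moreover have "G z = of_real \<alpha> * (2 / of_real pi * cos (of_real pi * z)) + (\<Sum>k. of_real (c k) * cardinal_rest k z)" for z
    by (simp only: G_def P_def T_def)
  ultimately show ?thesis using ul Gb by (intro that)
qed

section \<open>The cardinal series of the constant 1\<close>

lemma lterm_tendsto_0:
  "(\<lambda>N. lterm (half N) z) \<longlonglongrightarrow> 0" "(\<lambda>N. lterm (- half N) z) \<longlonglongrightarrow> 0"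
proof -
  note inf = filterlim_half
  have *: "(\<lambda>N. cos (of_real pi * z) / (of_real pi * (z - of_real (s * half N)))) \<longlonglongrightarrow> 0" if "\<bar>s\<bar> = 1" for s
  proof -
    have "filterlim (\<lambda>N. norm (z - complex_of_real (s * half N))) at_top sequentially"
    proof (rule filterlim_at_top_mono)
      show "filterlim (\<lambda>N. - norm z + half N) at_top sequentially"
        by (rule filterlim_tendsto_add_at_top[OF tendsto_const inf])
      show "\<forall>\<^sub>F N in sequentially. - norm z + half N \<le> norm (z - complex_of_real (s * half N))"
      proof (intro always_eventually allI)
        fix N
        have "norm (complex_of_real (s * half N)) = half N" using that half_pos[of N] by (simp add: norm_mult abs_mult)
        then show "- norm z + half N \<le> norm (z - complex_of_real (s * half N))"
          using norm_triangle_ineq2[of "complex_of_real (s * half N)" z] by (simp add: norm_minus_commute)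
      qed
    qed
    then have "filterlim (\<lambda>N. z - complex_of_real (s * half N)) at_infinity sequentially"
      by (rule filterlim_norm_at_top_imp_at_infinity)
    then have "filterlim (\<lambda>N. of_real pi * (z - complex_of_real (s * half N))) at_infinity sequentially"
      by (intro tendsto_mult_filterlim_at_infinity[OF tendsto_const]) auto
    then show ?thesis by (intro tendsto_divide_0[OF tendsto_const])
  qed
  have ev: "\<forall>\<^sub>F N in sequentially. half N > norm z"
    using inf by (simp add: filterlim_at_top_dense)
  show "(\<lambda>N. lterm (half N) z) \<longlonglongrightarrow> 0"
  proof (rule Lim_transform_eventually[OF *[of 1]])
    show "\<forall>\<^sub>F N in sequentially. cos (of_real pi * z) / (of_real pi * (z - of_real (1 * half N))) = lterm (half N) z"
      using ev by eventually_elim (auto simp: lterm_def)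
  qed auto
  show "(\<lambda>N. lterm (- half N) z) \<longlonglongrightarrow> 0"
  proof (rule Lim_transform_eventually[OF *[of "- 1"]])
    show "\<forall>\<^sub>F N in sequentially. cos (of_real pi * z) / (of_real pi * (z - of_real (- 1 * half N))) = lterm (- half N) z"
      using ev by eventually_elim (auto simp: lterm_def)
  qed auto
qed

lemma lterm_plus_one: "lterm a (z + 1) = - lterm (a - 1) z"
proof -
  have 1: "cos (of_real pi * (z + 1)) = - cos (of_real pi * z)" by (simp add: distrib_left cos_add)
  have 2: "sin (pi * (a - 1)) = - sin (pi * a)" by (simp add: right_diff_distrib sin_diff)
  show ?thesis unfolding lterm_def 1 2 by (auto simp: algebra_simps eq_diff_eq)
qed

text \<open>Translation by 1 moves every node one step, so the partial sum gains a term at its left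
  end and loses one at its right end. Both tend to 0, which makes the limit periodic.\<close>

lemma sum_cardinal_term_plus_one:
  "(\<Sum>k\<le>N. cardinal_term k (z + 1)) = (\<Sum>k\<le>N. cardinal_term k z)
     + (-1) ^ Suc N * lterm (- half (Suc N)) z + (-1) ^ N * lterm (half N) z"
proof (induction N)
  case 0
  show ?case by (simp add: cardinal_term_def lterm_plus_one half_def)
next
  case (Suc N)
  have h: "half (Suc N) - 1 = half N" "- half (Suc N) - 1 = - half (Suc (Suc N))" by (simp_all add: half_def)
  have step: "cardinal_term (Suc N) (z + 1) = (-1) ^ Suc N * (lterm (half N) z - lterm (- half (Suc (Suc N))) z)"
    unfolding cardinal_term_def lterm_plus_one h by simp
  show ?case unfolding sum.atMost_Suc Suc.IH step
    by (simp add: cardinal_term_def[of "Suc N"] algebra_simps)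
qed

lemma summable_alternating_inverse_half: "summable (\<lambda>k. (-1) ^ k / half k)"
proof -
  have "summable (\<lambda>k. (-1) ^ k * inverse (half k))"
  proof (rule summable_Leibniz(1))
    show "(\<lambda>k. inverse (half k)) \<longlonglongrightarrow> 0" by (rule tendsto_inverse_0_at_top[OF filterlim_half])
    show "monoseq (\<lambda>k. inverse (half k))"
      by (rule decseq_imp_monoseq) (auto simp: decseq_def half_def divide_simps)
  qed
  then show ?thesis by (simp add: divide_inverse)
qed

text \<open>The partial fraction expansion of \<open>\<pi> / cos (\<pi> z)\<close>: the sum minus 1 is \<open>cos (\<pi> z)\<close> times an
  entire function that is both of polynomial growth and antiperiodic.\<close>
proposition cardinal_series_one: "(\<lambda>N. \<Sum>k\<le>N. cardinal_term k z) \<longlonglongrightarrow> 1"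
proof -
  have a: "(\<lambda>N. \<Sum>k\<le>N. (-1) ^ k * 1 / half k) \<longlonglongrightarrow> (\<Sum>k. (-1) ^ k / half k)"
    using summable_LIMSEQ'[OF summable_alternating_inverse_half] by simp
  have b: "\<bar>1\<bar> \<le> 2 * half k" for k using half_ge[of k] by simp
  obtain G C where G: "G holomorphic_on UNIV"
    "\<And>R. uniform_limit (cball 0 R) (\<lambda>N z. \<Sum>k\<le>N. of_real 1 * cardinal_term k z) G sequentially"
    "\<And>z. norm (G z) \<le> C * (1 + norm z) ^ 3 * exp (pi * \<bar>Im z\<bar>)"
    by (rule cardinal_series[OF b a]) (rule that; assumption)
  have lim: "(\<lambda>N. \<Sum>k\<le>N. cardinal_term k z) \<longlonglongrightarrow> G z" for z
    using tendsto_uniform_limitI[OF G(2)[of "norm z"], of z] by simp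
  have per: "G (z + 1) = G z" for z
  proof (rule LIMSEQ_unique[OF lim])
    have z0: "(\<lambda>N. (-1) ^ N * x N :: complex) \<longlonglongrightarrow> 0" if "x \<longlonglongrightarrow> 0" for x
      using that by (subst tendsto_norm_zero_iff[symmetric]) (simp add: norm_mult norm_power tendsto_norm_zero_iff)
    have "(\<lambda>N. (\<Sum>k\<le>N. cardinal_term k z) + (-1) ^ Suc N * lterm (- half (Suc N)) z + (-1) ^ N * lterm (half N) z) \<longlonglongrightarrow> G z + 0 + 0"
      by (intro tendsto_add lim z0 lterm_tendsto_0 LIMSEQ_Suc[OF z0[OF lterm_tendsto_0(2)]])
    then show "(\<lambda>N. \<Sum>k\<le>N. cardinal_term k (z + 1)) \<longlonglongrightarrow> G z"
      by (simp only: sum_cardinal_term_plus_one add_0_right)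
  qed
  have half1: "G (of_real (half m)) = 1" for m
  proof (rule LIMSEQ_unique[OF lim])
    show "(\<lambda>N. \<Sum>k\<le>N. cardinal_term k (of_real (half m))) \<longlonglongrightarrow> 1"
    proof (rule tendsto_eventually)
      show "\<forall>\<^sub>F N in sequentially. (\<Sum>k\<le>N. cardinal_term k (of_real (half m))) = 1"
        using eventually_ge_at_top[of m] by eventually_elim (simp add: cardinal_term_half)
    qed
  qed
  have even: "G (- z) = G z" for z
    using LIMSEQ_unique[OF lim[of "- z"]] lim[of z] by simp
  have zeros: "G z - 1 = 0" if cz: "cos (of_real pi * z) = 0" for z
  proof -
    obtain n :: int where n: "z = of_real (of_int n + 1 / 2)" using cz unfolding cos_pi_eq_0_iff_complex by blast
    show ?thesis
    proof (cases "n \<ge> 0")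
      case True
      then have "z = of_real (half (nat n))" by (simp add: n half_def)
      then show ?thesis using half1 by simp
    next
      case False
      then have "- z = of_real (half (nat (- n - 1)))" by (simp add: n half_def)
      then have "G (- z) = 1" by (simp only: half1)
      then show ?thesis using even[of z] by simp
    qed
  qed
  have bd: "norm (G z - 1) \<le> (C + 1) * (1 + norm z) ^ 3 * exp (pi * \<bar>Im z\<bar>)" for z
  proof -
    have "1 * 1 \<le> (1 + norm z) ^ 3 * exp (pi * \<bar>Im z\<bar>)" by (intro mult_mono one_le_power) auto
    then show ?thesis using norm_triangle_ineq4[of "G z" 1] G(3)[of z] by (simp add: algebra_simps)
  qed
  obtain Q where Q: "Q holomorphic_on UNIV" "\<And>z. G z - 1 = Q z * cos (of_real pi * z)"
    "\<And>z. norm (Q z) \<le> 4 ^ Suc 3 * (C + 1) * (1 + norm z) ^ 3"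
    by (rule entire_divide_cos_pi[OF _ zeros bd]) (auto intro!: holomorphic_intros G(1))
  have "Q z = 0"
  \<comment> \<open>\<open>G - 1\<close> has period 1 while the cosine changes sign under
    translation by 1, so the quotient is antiperiodic wherever the cosine is nonzero.\<close>
  proof (rule antiperiodic_polynomial_growth_eq_0[OF Q(1) Q(3)])
    fix n
    have c: "cos (of_real pi * (of_nat n + 1)) = - cos (of_real pi * of_nat n :: complex)"
      by (simp add: distrib_left cos_add)
    have nz: "cos (of_real pi * of_nat n) \<noteq> (0::complex)"
    proof
      assume "cos (of_real pi * of_nat n) = (0::complex)"
      then obtain m :: int where "of_nat n = complex_of_real (of_int m + 1 / 2)" unfolding cos_pi_eq_0_iff_complex by blast
      then have "complex_of_real (real n) = complex_of_real (of_int m + 1 / 2)" by simp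
      then have "real n = of_int m + 1 / 2" by (simp only: of_real_eq_iff)
      then have "2 * int n = 2 * m + 1" by linarith
      then show False by presburger
    qed
    have "Q (of_nat n + 1) * cos (of_real pi * (of_nat n + 1)) = Q (of_nat n) * cos (of_real pi * of_nat n)"
      using Q(2)[of "of_nat n + 1"] Q(2)[of "of_nat n"] per[of "of_nat n"] by simp
    then have "(Q (of_nat n + 1) + Q (of_nat n)) * cos (of_real pi * of_nat n) = 0"
      unfolding c distrib_right by (metis add.left_inverse minus_mult_right minus_minus)
    then show "Q (of_nat n + 1) = - Q (of_nat n)"
      using nz by (simp add: eq_neg_iff_add_eq_0)
  qed
  then have "G z = 1" using Q(2)[of z] by simp
  then show ?thesis using lim[of z] by simp
qed

section \<open>Estimates in the parameter\<close>

lemma alternating_sum_bounds: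
  fixes b :: "nat \<Rightarrow> real"
  assumes "\<And>k. b (Suc k) \<le> b k" "\<And>k. b k \<ge> 0"
  shows "0 \<le> (\<Sum>k<n. (-1) ^ k * b k)" "(\<Sum>k<n. (-1) ^ k * b k) \<le> b 0"
proof -
  have "0 \<le> (\<Sum>k<n. (-1) ^ k * b k) \<and> (\<Sum>k<n. (-1) ^ k * b k) \<le> b 0"
    using assms
  proof (induction n arbitrary: b)
    case (Suc n)
    have "(\<Sum>k<Suc n. (-1) ^ k * b k) = b 0 - (\<Sum>k<n. (-1) ^ k * b (Suc k))"
      unfolding sum.lessThan_Suc_shift by (simp add: sum_negf)
    moreover have "0 \<le> (\<Sum>k<n. (-1) ^ k * b (Suc k)) \<and> (\<Sum>k<n. (-1) ^ k * b (Suc k)) \<le> b (Suc 0)"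
      using Suc.IH[of "\<lambda>k. b (Suc k)"] Suc.prems by simp
    ultimately show ?case using Suc.prems(1)[of 0] by linarith
  qed simp
  then show "0 \<le> (\<Sum>k<n. (-1) ^ k * b k)" "(\<Sum>k<n. (-1) ^ k * b k) \<le> b 0" by auto
qed

text \<open>The integrand of the hypothesis on the measure, comparable to the minimum of l and 1/l.
  A bound by a multiple of it is what integrability in the parameter is reduced to.\<close>

definition lam_weight :: "real \<Rightarrow> real" where
  "lam_weight l = l / (l\<^sup>2 + 1)"

lemma lam_weight_pos: "l > 0 \<Longrightarrow> lam_weight l > 0"
  and lam_weight_nonneg [simp]: "l > 0 \<Longrightarrow> lam_weight l \<ge> 0"
  by (simp_all add: lam_weight_def add_nonneg_pos)

lemma exp_minus_le_lam:
  fixes l m :: real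
  assumes "l > 0" "m > 0"
  shows "exp (- (l * m)) \<le> (1 + 2 / m\<^sup>2) / (l\<^sup>2 + 1)"
proof -
  have a: "1 + (l * m)\<^sup>2 / 2 \<le> exp (l * m)"
    using exp_lower_Taylor_quadratic[OF less_imp_le[OF mult_pos_pos[OF assms]]] mult_pos_pos[OF assms] by linarith
  have b: "l\<^sup>2 + 1 \<le> (1 + 2 / m\<^sup>2) * (1 + (l * m)\<^sup>2 / 2)"
    using assms by (simp add: power_mult_distrib field_simps)
  have "l\<^sup>2 + 1 \<le> (1 + 2 / m\<^sup>2) * exp (l * m)"
    by (rule order_trans[OF b mult_left_mono[OF a]]) simp
  moreover have "l\<^sup>2 + 1 > 0" by (simp add: add_nonneg_pos)
  ultimately show ?thesis by (simp add: exp_minus field_simps)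
qed

text \<open>By convexity of the exponential the difference is at most l|x - 1| exp(-l m) with m the
  smaller of the two points x and 1. The factor l settles small l, the exponential settles large l;
  as x tends to 0 the constant degenerates.\<close>

lemma abs_exp_diff_le:
  assumes "l > 0" "x > (0::real)"
  shows "\<bar>exp (- (l * x)) - exp (- l)\<bar> \<le> (1 + 2 / (min x 1)\<^sup>2) * \<bar>x - 1\<bar> * lam_weight l"
proof -
  define m where "m = min x 1"
  have m: "m > 0" using assms by (simp add: m_def)
  have *: "exp (- (l * a)) - exp (- (l * b)) \<le> l * (b - a) * exp (- (l * a))" for a b
  proof -
    have "exp (- (l * b)) = exp (- (l * a)) * exp (- (l * (b - a)))" by (simp add: exp_add[symmetric] algebra_simps)
    moreover have "1 - l * (b - a) \<le> exp (- (l * (b - a)))" using exp_ge_add_one_self[of "- (l * (b - a))"] by simp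
    then have "exp (- (l * a)) * (1 - l * (b - a)) \<le> exp (- (l * a)) * exp (- (l * (b - a)))"
      by (intro mult_left_mono) auto
    ultimately show ?thesis by (simp add: algebra_simps)
  qed
  have "\<bar>exp (- (l * x)) - exp (- l)\<bar> \<le> l * \<bar>x - 1\<bar> * exp (- (l * m))"
  proof (cases "x \<le> 1")
    case True
    then have "exp (- l) \<le> exp (- (l * x))" using assms by simp
    then show ?thesis using *[of x 1] True by (simp add: m_def)
  next
    case False
    then have "exp (- (l * x)) \<le> exp (- l)" using assms by simp
    then show ?thesis using *[of 1 x] False by (simp add: m_def)
  qed
  also have "\<dots> \<le> l * \<bar>x - 1\<bar> * ((1 + 2 / m\<^sup>2) / (l\<^sup>2 + 1))"
    using assms by (intro mult_left_mono exp_minus_le_lam m) auto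
  finally show ?thesis by (simp add: m_def lam_weight_def mult_ac)
qed

lemma abs_exp_half_diff_le:
  assumes "l > 0"
  shows "\<bar>exp (- (l * half k)) - exp (- l)\<bar> \<le> 9 * lam_weight l * half k"
proof -
  define a where "a = half k"
  have a: "a \<ge> 1 / 2" using half_ge[of k] by (simp add: a_def)
  \<comment> \<open>Every node is at least 1/2, which bounds 1 + 2/min(a,1)^2 by 1 + 2/(1/4) =
    9.\<close>
  have "(1 / 2)\<^sup>2 \<le> (min a 1)\<^sup>2" using a by (intro power_mono) auto
  then have "2 / (min a 1)\<^sup>2 \<le> 2 / (1 / 2)\<^sup>2" using a by (intro divide_left_mono) auto
  then have "1 + 2 / (min a 1)\<^sup>2 \<le> 9" by (simp add: power_divide)
  moreover have "\<bar>a - 1\<bar> \<le> a" using a by auto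
  ultimately have "(1 + 2 / (min a 1)\<^sup>2) * \<bar>a - 1\<bar> \<le> 9 * a" using a by (intro mult_mono) auto
  then have "(1 + 2 / (min a 1)\<^sup>2) * \<bar>a - 1\<bar> * lam_weight l \<le> 9 * a * lam_weight l"
    using assms by (intro mult_right_mono) auto
  moreover have "\<bar>exp (- (l * a)) - exp (- l)\<bar> \<le> (1 + 2 / (min a 1)\<^sup>2) * \<bar>a - 1\<bar> * lam_weight l"
    using a assms by (intro abs_exp_diff_le) auto
  ultimately show ?thesis unfolding a_def by (simp add: mult_ac)
qed

text \<open>The scalar in front of (2/\<pi>) cos(\<pi> z) when the partial sum with coefficients
  exp(-l half k) is expanded by \<open>cardinal_term_split\<close>. The parameter l = 0 corresponds
  to the constant function 1.\<close>

definition alt_sum :: "nat \<Rightarrow> real \<Rightarrow> real" where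
  "alt_sum N l = (\<Sum>k\<le>N. (-1) ^ k * exp (- (l * half k)) / half k)"

lemma half_Suc: "half (Suc k) = half k + 1"
  by (simp add: half_def)

lemma alt_sum_bounds:
  assumes "l \<ge> 0"
  shows "0 \<le> alt_sum N l" "alt_sum N l \<le> 2 * exp (- (l / 2))"
proof -
  have *: "exp (- (l * half (Suc k))) / half (Suc k) \<le> exp (- (l * half k)) / half k" for k
    using assms by (intro frac_le) (auto simp: half_Suc intro!: mult_left_mono)
  have "alt_sum N l = (\<Sum>k<Suc N. (-1) ^ k * (exp (- (l * half k)) / half k))"
    by (simp add: alt_sum_def lessThan_Suc_atMost)
  then show "0 \<le> alt_sum N l" "alt_sum N l \<le> 2 * exp (- (l / 2))"
    using alternating_sum_bounds[of "\<lambda>k. exp (- (l * half k)) / half k" "Suc N", OF *] by (simp_all add: half_def)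
qed

text \<open>These are chord slopes from 0 of the concave function 1 - exp(-l x). Their monotonicity
  makes \<open>alt_sum N 0 - alt_sum N l\<close> an alternating sum with decreasing terms, hence at
  most its first term and so at most l, uniformly in N.\<close>

lemma one_minus_exp_over_antimono:
  assumes "l \<ge> 0" "0 < a" "a \<le> (b::real)"
  shows "(1 - exp (- (l * b))) / b \<le> (1 - exp (- (l * a))) / a"
proof -
  have "exp (((1 - a / b)) *\<^sub>R 0 + (a / b) *\<^sub>R (- (l * b))) \<le> (1 - a / b) * exp 0 + (a / b) * exp (- (l * b))"
    by (rule convex_onD[OF exp_convex]) (use assms in \<open>auto simp: field_simps\<close>)
  moreover have "((1 - a / b)) *\<^sub>R 0 + (a / b) *\<^sub>R (- (l * b)) = - (l * a)"
    using assms by simp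
  ultimately have "exp (- (l * a)) \<le> 1 - a / b + (a / b) * exp (- (l * b))"
    by (simp only: exp_zero mult_1_right)
  then have "b * exp (- (l * a)) \<le> b * (1 - a / b + (a / b) * exp (- (l * b)))"
    using assms by (intro mult_left_mono) auto
  also have "\<dots> = b - a + a * exp (- (l * b))" using assms by (simp add: algebra_simps)
  finally have "a * (1 - exp (- (l * b))) \<le> b * (1 - exp (- (l * a)))"
    by (simp add: algebra_simps)
  then show ?thesis using assms by (simp add: field_simps)
qed

lemma alt_sum_diff_bounds:
  assumes "l \<ge> 0"
  shows "0 \<le> alt_sum N 0 - alt_sum N l" "alt_sum N 0 - alt_sum N l \<le> l"
proof -
  have *: "(1 - exp (- (l * half (Suc k)))) / half (Suc k) \<le> (1 - exp (- (l * half k))) / half k" for k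
    using assms by (intro one_minus_exp_over_antimono) (auto simp: half_Suc)
  have "alt_sum N 0 - alt_sum N l = (\<Sum>k<Suc N. (-1) ^ k * ((1 - exp (- (l * half k))) / half k))"
    unfolding alt_sum_def lessThan_Suc_atMost sum_subtractf[symmetric]
    by (intro sum.cong) (auto simp: field_simps)
  moreover have "(1 - exp (- (l * half 0))) / half 0 \<le> l"
    using exp_ge_add_one_self[of "- (l / 2)"] by (simp add: half_def)
  ultimately show "0 \<le> alt_sum N 0 - alt_sum N l" "alt_sum N 0 - alt_sum N l \<le> l"
    using alternating_sum_bounds[of "\<lambda>k. (1 - exp (- (l * half k))) / half k" "Suc N", OF *] assms
    by simp_all
qed

text \<open>Uniformity in \<open>N\<close> makes this a domination. For l \<le> 1 the sum is split
  at \<open>alt_sum N 0\<close> into two differences of order l; for l > 1 each term decays like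
  exp(-l/2). The constant is 4 times the 9 that \<open>exp_minus_le_lam\<close> gives at m =
  1/2.\<close>

lemma alt_sum_weight_bound:
  assumes "l > 0"
  shows "\<bar>alt_sum N l - exp (- l) * alt_sum N 0\<bar> \<le> 36 * lam_weight l"
proof (cases "l \<le> 1")
  case True
  have e: "1 - exp (- l) \<le> l" "exp (- l) \<le> 1" using exp_ge_add_one_self[of "- l"] assms by auto
  have "\<bar>(1 - exp (- l)) * alt_sum N 0\<bar> \<le> l * 2"
    using alt_sum_bounds[of 0 N] e assms by (simp add: abs_mult) (intro mult_mono, auto)
  moreover have "alt_sum N l - exp (- l) * alt_sum N 0 = (1 - exp (- l)) * alt_sum N 0 - (alt_sum N 0 - alt_sum N l)"
    by (simp add: algebra_simps)
  ultimately have "\<bar>alt_sum N l - exp (- l) * alt_sum N 0\<bar> \<le> 3 * l"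
    using alt_sum_diff_bounds[of l N] assms by linarith
  moreover have "l * (l\<^sup>2 + 1) \<le> l * 12" using True assms
    using power_le_one[of l 2] by (intro mult_left_mono) auto
  then have "3 * l \<le> 36 * lam_weight l"
    using assms by (simp add: lam_weight_def pos_le_divide_eq add_nonneg_pos)
  ultimately show ?thesis by linarith
next
  case False
  have "exp (- l) \<le> exp (- (l / 2))" using assms by simp
  then have "exp (- l) * alt_sum N 0 \<le> exp (- (l / 2)) * 2"
    using alt_sum_bounds[of 0 N] by (intro mult_mono) auto
  then have "\<bar>alt_sum N l - exp (- l) * alt_sum N 0\<bar> \<le> 4 * exp (- (l * (1 / 2)))"
  proof -
    have "0 \<le> exp (- l) * alt_sum N 0" using alt_sum_bounds[of 0 N] by simp
    moreover have "exp (- (l * (1 / 2))) = exp (- (l / 2))" by simp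
    moreover have "exp (- (l / 2)) > 0" by simp
    ultimately show ?thesis
      using \<open>exp (- l) * alt_sum N 0 \<le> exp (- (l / 2)) * 2\<close> alt_sum_bounds[of l N] assms by linarith
  qed
  also have "\<dots> \<le> 4 * ((1 + 2 / (1 / 2)\<^sup>2) / (l\<^sup>2 + 1))"
    using assms by (intro mult_left_mono exp_minus_le_lam) auto
  also have "\<dots> = 36 * (1 / (l\<^sup>2 + 1))" by (simp add: power_divide)
  also have "\<dots> \<le> 36 * lam_weight l" unfolding lam_weight_def
    using False by (intro mult_left_mono divide_right_mono) auto
  finally show ?thesis .
qed

lemma alt_sum_convergent:
  assumes "l \<ge> 0"
  shows "(\<lambda>N. alt_sum N l) \<longlonglongrightarrow> (\<Sum>k. (-1) ^ k * (exp (- (l * half k)) / half k))"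
proof -
  have "summable (\<lambda>k. (-1) ^ k * (exp (- (l * half k)) / half k))"
  proof (rule summable_Leibniz'(1))
    show "(\<lambda>k. exp (- (l * half k)) / half k) \<longlonglongrightarrow> 0"
    proof (rule tendsto_sandwich[OF _ _ tendsto_const tendsto_inverse_0_at_top[OF filterlim_half]])
      show "\<forall>\<^sub>F k in sequentially. exp (- (l * half k)) / half k \<le> inverse (half k)"
        using assms by (intro always_eventually allI) (simp add: divide_inverse)
    qed auto
    show "exp (- (l * half (Suc k))) / half (Suc k) \<le> exp (- (l * half k)) / half k" for k
      using assms by (intro frac_le) (auto simp: half_Suc intro!: mult_left_mono)
  qed auto
  from summable_LIMSEQ'[OF this] show ?thesis by (simp add: alt_sum_def)
qed

text \<open>The partial sum for the function exp(-l|x|) - exp(-l); integrated over the measure it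
  becomes \<open>K_partial\<close>.\<close>

definition cardinal_exp_sum :: "real \<Rightarrow> nat \<Rightarrow> complex \<Rightarrow> complex" where
  "cardinal_exp_sum l N z = (\<Sum>k\<le>N. of_real (exp (- (l * half k)) - exp (- l)) * cardinal_term k z)"

text \<open>The dominating function for the limit in \<open>N\<close>. The leading part is bounded
  by \<open>alt_sum_weight_bound\<close>, the remainder by the coefficient bound 9 times the factor
  4 of \<open>norm_cardinal_rest_le\<close>; both give 36.\<close>

lemma norm_cardinal_exp_sum_le:
  assumes "l > 0"
  shows "norm (cardinal_exp_sum l N z) \<le>
    36 * (1 + (\<Sum>k. 1 / (half k)\<^sup>2)) * (1 + norm z) ^ 3 * exp (pi * \<bar>Im z\<bar>) * lam_weight l"
proof -
  define S where "S = (\<Sum>k. 1 / (half k)\<^sup>2)"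
  define P where "P = 2 / of_real pi * cos (of_real pi * z)"
  define e where "e = exp (pi * \<bar>Im z\<bar>)"
  define c where "c = (\<lambda>k. exp (- (l * half k)) - exp (- l))"
  have w: "lam_weight l \<ge> 0" using assms by simp
  have eq: "cardinal_exp_sum l N z = of_real (alt_sum N l - exp (- l) * alt_sum N 0) * P + (\<Sum>k\<le>N. of_real (c k) * cardinal_rest k z)"
  proof -
    have "of_real (c k) * cardinal_term k z = of_real ((-1) ^ k * exp (- (l * half k)) / half k - exp (- l) * ((-1) ^ k / half k)) * P + of_real (c k) * cardinal_rest k z" for k
      by (subst cardinal_term_split) (simp add: P_def c_def field_simps)
    moreover have "alt_sum N l - exp (- l) * alt_sum N 0 = (\<Sum>k\<le>N. (-1) ^ k * exp (- (l * half k)) / half k - exp (- l) * ((-1) ^ k / half k))"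
      by (simp add: alt_sum_def sum_subtractf sum_distrib_left)
    moreover have "cardinal_exp_sum l N z = (\<Sum>k\<le>N. of_real (c k) * cardinal_term k z)"
      by (simp add: cardinal_exp_sum_def c_def)
    ultimately show ?thesis
      by (simp only: of_real_sum sum_distrib_right sum.distrib)
  qed
  have "norm (\<Sum>k\<le>N. of_real (c k) * cardinal_rest k z) \<le> (\<Sum>k\<le>N. 9 * lam_weight l * (4 * (1 + norm z) ^ 3 * e) * (1 / (half k)\<^sup>2))"
    unfolding e_def c_def
    by (intro sum_norm_le scaled_cardinal_rest_le abs_exp_half_diff_le assms)
  also have "\<dots> = 9 * lam_weight l * (4 * (1 + norm z) ^ 3 * e) * (\<Sum>k\<le>N. 1 / (half k)\<^sup>2)"
    by (rule sum_distrib_left[symmetric])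
  also have "\<dots> \<le> 9 * lam_weight l * (4 * (1 + norm z) ^ 3 * e) * S"
    unfolding S_def e_def using w
    by (intro mult_left_mono sum_le_suminf summable_inverse_half_squared) auto
  finally have R: "norm (\<Sum>k\<le>N. of_real (c k) * cardinal_rest k z) \<le> 36 * S * (1 + norm z) ^ 3 * e * lam_weight l"
    by (simp add: mult_ac)
  have nP: "norm P \<le> (1 + norm z) ^ 3 * e"
  proof -
    have "norm P = 2 / pi * norm (cos (of_real pi * z))" by (simp add: P_def norm_mult norm_divide)
    also have "\<dots> \<le> (1 + norm z) ^ 3 * e" unfolding e_def
    proof (intro mult_mono norm_cos_pi_le)
      have "2 / pi \<le> 1" using pi_ge_two by (simp add: field_simps)
      also have "\<dots> \<le> (1 + norm z) ^ 3" by (intro one_le_power) auto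
      finally show "2 / pi \<le> (1 + norm z) ^ 3" .
    qed auto
    finally show ?thesis .
  qed
  have "norm (of_real (alt_sum N l - exp (- l) * alt_sum N 0) * P) \<le> (36 * lam_weight l) * ((1 + norm z) ^ 3 * e)"
    unfolding norm_mult norm_of_real using w by (intro mult_mono alt_sum_weight_bound nP assms) auto
  with R have "norm (cardinal_exp_sum l N z) \<le> (36 * lam_weight l) * ((1 + norm z) ^ 3 * e) + 36 * S * (1 + norm z) ^ 3 * e * lam_weight l"
    unfolding eq by (intro norm_triangle_le) linarith
  then show ?thesis by (simp add: S_def e_def algebra_simps)
qed

section \<open>Exponential series in the parameter and a maximum principle\<close>

lemma summable_power_half_exp:
  assumes "d > 0"
  shows "summable (\<lambda>k. half k ^ q * exp (- (d * half k)))"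
proof (rule summable_comparison_test')
  \<comment> \<open>With A = q + 2, raising d a / A \<le> exp(d a / A) to the power A gives a^A
    \<le> (A/d)^A exp(d a). The two extra powers leave the summable factor 1/a^2.\<close>
  define C where "C = (real (q + 2) / d) ^ (q + 2)"
  show "summable (\<lambda>k. C * (1 / (half k)\<^sup>2))" by (rule summable_mult[OF summable_inverse_half_squared])
  fix k
  define a where "a = half k"
  have a: "a > 0" by (simp add: a_def)
  define A where "A = real (q + 2)"
  have A: "A > 0" by (simp add: A_def)
  have "(d * a / A) ^ (q + 2) \<le> exp (d * a / A) ^ (q + 2)"
  proof (rule power_mono)
    show "d * a / A \<le> exp (d * a / A)"
      using exp_ge_add_one_self[of "d * a / A"] by linarith
  qed (use a assms A in auto)
  also have "\<dots> = exp (real (q + 2) * (d * a / A))"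
    by (simp only: exp_of_nat_mult)
  also have "\<dots> = exp (d * a)" using A by (simp add: A_def)
  finally have "C * (d * a / A) ^ (q + 2) \<le> C * exp (d * a)"
    using assms A by (intro mult_left_mono) (auto simp: C_def A_def)
  moreover have "C * (d * a / A) ^ (q + 2) = a ^ (q + 2)"
    unfolding C_def A_def[symmetric] power_mult_distrib[symmetric] using assms A by simp
  ultimately have "a ^ (q + 2) \<le> C * exp (d * a)" by simp
  then have "a ^ q * exp (- (d * a)) \<le> C * (1 / a\<^sup>2)"
    using a by (simp add: exp_minus power_add field_simps power2_eq_square)
  then show "norm (half k ^ q * exp (- (d * half k))) \<le> C * (1 / (half k)\<^sup>2)"
    by (simp add: a_def)
qed

text \<open>On [l/2, \<infinity>) the differentiated series is dominated by a summable one.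
  Coefficients of polynomial growth are allowed so that the result can be applied again to the
  derived series.\<close>

lemma has_derivative_exp_series:
  fixes b :: "nat \<Rightarrow> real"
  assumes b: "\<And>k. \<bar>b k\<bar> \<le> B * half k ^ p" and "l > 0"
  shows "((\<lambda>l. \<Sum>k. b k * exp (- (l * half k))) has_real_derivative - (\<Sum>k. b k * half k * exp (- (l * half k)))) (at l)"
    "summable (\<lambda>k. b k * exp (- (l * half k)))"
proof -
  have B0: "B \<ge> 0"
  proof -
    have "0 \<le> B * half 0 ^ p" using order_trans[OF abs_ge_zero b[of 0]] .
    then show ?thesis using zero_less_power[OF half_pos[of 0], of p] by (simp add: zero_le_mult_iff)
  qed
  define S where "S = {l / 2..}"
  have bd: "\<bar>b k\<bar> * half k ^ j * exp (- (x * half k)) \<le> B * (half k ^ (p + j) * exp (- (l / 2 * half k)))" if "x \<ge> l / 2" for k x j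
  proof -
    have "l / 2 * half k \<le> x * half k" using that by (intro mult_right_mono) auto
    then have "\<bar>b k\<bar> * half k ^ j * exp (- (x * half k)) \<le> (B * half k ^ p) * half k ^ j * exp (- (l / 2 * half k))"
      using B0 by (intro mult_mono b) auto
    then show ?thesis by (simp add: power_add mult_ac)
  qed
  have sm: "summable (\<lambda>k. B * (half k ^ (p + j) * exp (- (l / 2 * half k))))" for j
    using \<open>l > 0\<close> by (intro summable_mult summable_power_half_exp) auto
  have s0: "summable (\<lambda>k. b k * exp (- (l * half k)))"
  proof (rule summable_comparison_test'[OF sm[of 0]])
    show "norm (b k * exp (- (l * half k))) \<le> B * (half k ^ (p + 0) * exp (- (l / 2 * half k)))" for k
      using bd[of l k 0] \<open>l > 0\<close> by (simp add: abs_mult)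
  qed
  have uc: "uniformly_convergent_on S (\<lambda>n x. \<Sum>i<n. - (b i * half i * exp (- (x * half i))))"
  proof (rule Weierstrass_m_test')
    fix k x assume "x \<in> S"
    then show "norm (- (b k * half k * exp (- (x * half k)))) \<le> B * (half k ^ (p + 1) * exp (- (l / 2 * half k)))"
      using bd[of x k 1] by (simp add: S_def abs_mult)
  qed (rule sm)
  have int: "l \<in> interior S" unfolding S_def using \<open>l > 0\<close>
    by (intro interiorI[of "{l / 2<..}"]) auto
  have der: "((\<lambda>x. b n * exp (- (x * half n))) has_field_derivative - (b n * half n * exp (- (x * half n)))) (at x within S)" for n x
    by (auto intro!: derivative_eq_intros)
  have "((\<lambda>l. \<Sum>k. b k * exp (- (l * half k))) has_real_derivative (\<Sum>k. - (b k * half k * exp (- (l * half k))))) (at l)"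
    by (rule has_field_derivative_series'(2)[OF _ der uc _ s0 int]) (use \<open>l > 0\<close> in \<open>auto simp: S_def convex_real_interval\<close>)
  moreover have "summable (\<lambda>k. b k * half k * exp (- (l * half k)))"
  proof (rule summable_comparison_test'[OF sm[of 1]])
    show "norm (b k * half k * exp (- (l * half k))) \<le> B * (half k ^ (p + 1) * exp (- (l / 2 * half k)))" for k
      using bd[of l k 1] \<open>l > 0\<close> by (simp add: abs_mult)
  qed
  ultimately show "((\<lambda>l. \<Sum>k. b k * exp (- (l * half k))) has_real_derivative - (\<Sum>k. b k * half k * exp (- (l * half k)))) (at l)"
    by (simp add: suminf_minus)
  show "summable (\<lambda>k. b k * exp (- (l * half k)))" by (rule s0)
qed

lemma alternating_exp_series: 
  assumes "l > 0"
  shows "(\<Sum>k. (-1) ^ k * exp (- (l * half k))) = 1 / (2 * cosh (l / 2))"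
proof -
  have "(\<lambda>k. exp (- (l / 2)) * (- exp (- l)) ^ k) sums (exp (- (l / 2)) * (1 / (1 - - exp (- l))))"
    using assms by (intro sums_mult geometric_sums) auto
  moreover have "exp (- (l / 2)) * (- exp (- l)) ^ k = (-1) ^ k * exp (- (l * half k))" for k
  proof -
    have "exp (- (l / 2)) * (- exp (- l)) ^ k = (-1) ^ k * (exp (- (l / 2)) * exp (- l) ^ k)"
      by (subst power_minus) simp
    also have "exp (- (l / 2)) * exp (- l) ^ k = exp (- (l * half k))"
      by (subst exp_of_nat_mult[symmetric]) (simp add: exp_add[symmetric] half_def algebra_simps)
    finally show ?thesis .
  qed
  moreover have "exp (- (l / 2)) * (1 / (1 - - exp (- l))) = 1 / (2 * cosh (l / 2))"
  proof -
    have "exp (- l) = exp (- (l / 2)) * exp (- (l / 2))" by (simp add: exp_add[symmetric])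
    moreover have "exp (l / 2) * exp (- (l / 2)) = 1" by (simp add: exp_add[symmetric])
    moreover have "exp (- (l / 2)) > 0" "exp (l / 2) > 0" by simp_all
    moreover define u v where "u = exp (l / 2)" and "v = exp (- (l / 2))"
    ultimately have uv: "u * v = 1" "u > 0" "v > 0" "exp (- l) = v * v" by auto
    have "1 + v * v > 0" "u + v > 0" using uv by (auto intro: add_pos_pos)
    then have "v * (1 / (1 + v * v)) = 1 / (u + v)"
      using uv by (simp add: field_simps)
    moreover have "2 * cosh (l / 2) = u + v" by (simp add: cosh_def u_def v_def)
    ultimately show ?thesis using uv by (simp add: v_def[symmetric])
  qed
  ultimately show ?thesis by (simp add: sums_iff)
qed

text \<open>Minus the derivative of the closed form 1/(2 cosh(l/2)), that is sinh(l/2)/(4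
  cosh(l/2)^2). It is the source term of the differential equation, and both bounds are needed to
  compare with constants.\<close>

lemma alternating_exp_series_deriv:
  assumes "l > 0"
  shows "0 \<le> (\<Sum>k. (-1) ^ k * half k * exp (- (l * half k)))"
    "(\<Sum>k. (-1) ^ k * half k * exp (- (l * half k))) \<le> 1 / 4"
proof -
  define g where "g = (\<Sum>k. (-1) ^ k * half k * exp (- (l * half k)))"
  have "((\<lambda>l. \<Sum>k. (-1) ^ k * exp (- (l * half k))) has_real_derivative - g) (at l)"
    unfolding g_def by (rule has_derivative_exp_series(1)[of _ 1 0]) (use assms in auto)
  moreover have "((\<lambda>l. \<Sum>k. (-1) ^ k * exp (- (l * half k))) has_real_derivative - (sinh (l / 2) / (4 * (cosh (l / 2))\<^sup>2))) (at l)"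
  proof (rule has_field_derivative_transform_within_open[where S = "{0<..}" and f = "\<lambda>l. 1 / (2 * cosh (l / 2))"])
    show "((\<lambda>l. 1 / (2 * cosh (l / 2))) has_real_derivative - (sinh (l / 2) / (4 * (cosh (l / 2))\<^sup>2))) (at l)"
      by (auto intro!: derivative_eq_intros simp: power2_eq_square field_simps)
  qed (use assms in \<open>auto simp: alternating_exp_series\<close>)
  ultimately have g: "g = sinh (l / 2) / (4 * (cosh (l / 2))\<^sup>2)" using DERIV_unique by fastforce
  have s0: "sinh (l / 2) \<ge> 0" using assms by simp
  have c1: "cosh (l / 2) \<ge> 1" by (rule cosh_real_ge_1)
  have "sinh (l / 2) \<le> cosh (l / 2)" by (simp add: sinh_def cosh_def)
  also have "\<dots> \<le> (cosh (l / 2))\<^sup>2" using c1 by (simp add: power2_eq_square)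
  finally have "sinh (l / 2) / (4 * (cosh (l / 2))\<^sup>2) \<le> 1 / 4" using c1
    by (simp add: field_simps)
  then show "0 \<le> (\<Sum>k. (-1) ^ k * half k * exp (- (l * half k)))"
    "(\<Sum>k. (-1) ^ k * half k * exp (- (l * half k))) \<le> 1 / 4"
    using s0 c1 by (simp_all add: g flip: g_def)
qed

lemma second_derivative_nonneg_at_min:
  fixes f f' :: "real \<Rightarrow> real"
  assumes f: "\<And>y. a < y \<Longrightarrow> y < b \<Longrightarrow> (f has_real_derivative f' y) (at y)"
    and f': "(f' has_real_derivative f'') (at x)"
    and x: "a < x" "x < b" and min: "\<And>y. a < y \<Longrightarrow> y < b \<Longrightarrow> f x \<le> f y"
  shows "f'' \<ge> 0"
proof (rule ccontr)
  assume "\<not> ?thesis"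
  then have "f'' < 0" by simp
  then obtain d where d: "d > 0" "\<And>h. h > 0 \<Longrightarrow> h < d \<Longrightarrow> f' (x + h) < f' x"
    using DERIV_neg_dec_right[OF f'] by blast
  have "f' x = 0"
  proof (rule DERIV_local_min[OF f[OF x]])
    show "0 < min (x - a) (b - x)" using x by simp
    show "\<forall>y. \<bar>x - y\<bar> < min (x - a) (b - x) \<longrightarrow> f x \<le> f y" using min by (auto simp: abs_if split: if_splits)
  qed
  define h where "h = min d (b - x) / 2"
  have h: "0 < h" "h < d" "x + h < b" using d x by (auto simp: h_def min_def field_simps)
  have "\<exists>z. x < z \<and> z < x + h \<and> f (x + h) - f x = (x + h - x) * f' z"
    by (rule MVT2) (use h x in \<open>auto intro!: f\<close>)
  then obtain z where z: "x < z" "z < x + h" "f (x + h) - f x = h * f' z" by auto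
  have "f' (x + (z - x)) < f' x" using z h by (intro d) auto
  then have "h * f' z < 0" using h \<open>f' x = 0\<close> by (simp add: mult_pos_neg)
  then show False using z min[of "x + h"] h x by auto
qed

text \<open>At a negative interior minimum the second derivative would be nonnegative, but x^2 f - p
  is negative there. The end conditions are one-sided, so they also admit functions with a positive
  limit.\<close>

lemma maximum_principle_half_line:
  fixes f f' p :: "real \<Rightarrow> real"
  assumes f: "\<And>l. l > 0 \<Longrightarrow> (f has_real_derivative f' l) (at l)"
    and f': "\<And>l. l > 0 \<Longrightarrow> (f' has_real_derivative (x\<^sup>2 * f l - p l)) (at l)"
    and p: "\<And>l. l > 0 \<Longrightarrow> p l \<ge> 0" and "x \<noteq> 0"
    and ends: "\<And>e. e > 0 \<Longrightarrow> \<forall>\<^sub>F l in at_right 0. f l > - e" "\<And>e. e > 0 \<Longrightarrow> \<forall>\<^sub>F l in at_top. f l > - e"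
    and "l > 0"
  shows "f l \<ge> 0"
proof (rule ccontr)
  assume "\<not> f l \<ge> 0"
  define e where "e = - f l"
  have e: "e > 0" using \<open>\<not> f l \<ge> 0\<close> by (simp add: e_def)
  obtain \<delta>' where \<delta>': "\<delta>' > 0" "\<And>y. 0 < y \<Longrightarrow> y < \<delta>' \<Longrightarrow> f y > - e"
    using ends(1)[OF e] by (auto simp: eventually_at_right_field)
  obtain R' where R': "\<And>y. y \<ge> R' \<Longrightarrow> f y > - e"
    using ends(2)[OF e] by (auto simp: eventually_at_top_linorder)
  define a where "a = min \<delta>' l / 2"
  define b where "b = max R' (l + 1)"
  have ab: "0 < a" "a < \<delta>'" "a < l" "l < b" "R' \<le> b"
    using \<delta>'(1) \<open>l > 0\<close> by (auto simp: a_def b_def min_def max_def)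
  have "continuous_on {a..b} f"
    using ab by (intro continuous_at_imp_continuous_on ballI DERIV_isCont[OF f]) auto
  then obtain m where m: "m \<in> {a..b}" "\<And>y. y \<in> {a..b} \<Longrightarrow> f m \<le> f y"
    using continuous_attains_inf[of "{a..b}" f] ab by auto
  have fm: "f m \<le> - e" using m(2)[of l] ab by (simp add: e_def)
  have "m \<noteq> a" "m \<noteq> b" using fm \<delta>'(2)[of a] R'[of b] ab by auto
  then have mi: "a < m" "m < b" using m(1) by auto
  have "x\<^sup>2 * f m - p m \<ge> 0"
    by (rule second_derivative_nonneg_at_min[where f = f and f' = f' and a = a and b = b and x = m])
       (use f f' mi m(2) ab in auto)
  moreover have "x\<^sup>2 * f m < 0" using fm e \<open>x \<noteq> 0\<close> by (intro mult_pos_neg) auto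
  ultimately show False using p[of m] mi ab by auto
qed

section \<open>The interpolating functions\<close>

text \<open>The index range -N..N+1 is symmetric about 1/2, so it splits exactly into the pairs -k
  and k + 1 with k \<le> N.\<close>

lemma K_partial_eq:
  "K_partial M N z = (\<Sum>k\<le>N. of_real (real_of_ereal (f_mu M (half k))) * cardinal_term k z)"
proof -
  have f_minus: "f_mu M (- x) = f_mu M x" for x by (simp add: f_mu_def)
  define h where "h = (\<lambda>n::int. (-1) ^ nat \<bar>n\<bar> * of_real (real_of_ereal (f_mu M (of_int n - 1 / 2))) * lterm (of_int n - 1 / 2) z)"
  have "(\<Sum>n\<in>{- int N .. int N + 1}. h n) = (\<Sum>k\<le>N. of_real (real_of_ereal (f_mu M (half k))) * cardinal_term k z)"
  proof (induction N)
    have h1: "h (int k + 1) = - ((-1) ^ k * of_real (real_of_ereal (f_mu M (half k))) * lterm (half k) z)" for k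
    proof -
      have "real_of_int (int k + 1) - 1 / 2 = half k" by (simp add: half_def)
      then show ?thesis unfolding h_def by (simp add: nat_add_distrib)
    qed
    have h2: "h (- int k) = (-1) ^ k * of_real (real_of_ereal (f_mu M (half k))) * lterm (- half k) z" for k
    proof -
      have "real_of_int (- int k) - 1 / 2 = - half k" by (simp add: half_def)
      then show ?thesis unfolding h_def by (simp add: f_minus)
    qed
    have pair: "h (- int k) + h (int k + 1) = of_real (real_of_ereal (f_mu M (half k))) * cardinal_term k z" for k
      unfolding h1 h2 by (simp add: cardinal_term_def algebra_simps)
    {
      case 0
      have "{- int 0 .. int 0 + 1} = {0, 1}" by auto
      then show ?case using pair[of 0] by simp
    next
      case (Suc N)
      have "{- int (Suc N) .. int (Suc N) + 1} = insert (- int (Suc N)) (insert (int (Suc N) + 1) {- int N .. int N + 1})"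
        by auto
      then have "(\<Sum>n\<in>{- int (Suc N) .. int (Suc N) + 1}. h n) = (h (- int (Suc N)) + h (int (Suc N) + 1)) + (\<Sum>n\<in>{- int N .. int N + 1}. h n)"
        by (simp add: add.assoc)
      then show ?case unfolding Suc pair by (simp add: add.commute)
    }
  qed
  then show ?thesis by (simp add: K_partial_def h_def)
qed

lemma summable_exp_half:
  assumes "l > 0"
  shows "summable (\<lambda>k. exp (- (l * half k)))"
  using summable_power_half_exp[OF assms, of 0] by simp

text \<open>The exponential weights make the sum over the integers absolutely convergent, so it may
  be split into the rays n \<ge> 1 and n \<le> 0 and recombined in pairs.\<close>

lemma K_lam_sums:
  assumes "l > 0"
  shows "(\<lambda>k. of_real (exp (- (l * half k))) * cardinal_term k z) sums K_lam l z"
proof -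
  define h where "h = (\<lambda>n::int. (-1) ^ nat \<bar>n\<bar> * of_real (exp (- l * \<bar>of_int n - 1 / 2\<bar>)) * lterm (of_int n - 1 / 2) z)"
  define g where "g = (\<lambda>s k. (-1) ^ k * of_real (exp (- (l * half k))) * lterm (s * half k) z)"
  have sm: "summable (\<lambda>k. norm (g s k))" if "s = 1 \<or> s = - 1" for s
  proof (rule summable_comparison_test')
    show "summable (\<lambda>k. exp (- (l * half k)) * exp (pi * \<bar>Im z\<bar>))"
      by (rule summable_mult2[OF summable_exp_half[OF assms]])
    fix k
    have "cos (pi * (s * half k)) = 0" using that by auto
    from norm_lterm_le[OF this, of z] show "norm (norm (g s k)) \<le> exp (- (l * half k)) * exp (pi * \<bar>Im z\<bar>)"
      by (simp add: g_def norm_mult norm_power)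
  qed
  have gs: "(g s has_sum (\<Sum>k. g s k)) UNIV" "g s sums (\<Sum>k. g s k)" if "s = 1 \<or> s = - 1" for s
    using norm_summable_imp_has_sum[OF sm[OF that]] summable_norm_cancel[OF sm[OF that]] by (auto simp: summable_sums)
  have h1: "h (int k + 1) = - g 1 k" for k
  proof -
    have "\<bar>real_of_int (int k + 1) - 1 / 2\<bar> = half k" "real_of_int (int k + 1) - 1 / 2 = half k" by (simp_all add: half_def)
    then show ?thesis unfolding h_def g_def by (simp add: nat_add_distrib)
  qed
  have h2: "h (- int k) = g (- 1) k" for k
  proof -
    have "\<bar>- real k - 1 / 2\<bar> = half k" "- real k - 1 / 2 = - half k" by (simp_all add: half_def)
    then show ?thesis by (simp add: h_def g_def)
  qed
  have "(h has_sum (- (\<Sum>k. g 1 k))) ((\<lambda>k. int k + 1) ` UNIV)"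
    by (subst has_sum_reindex) (auto simp: o_def h1 inj_def has_sum_uminus gs)
  moreover have "(h has_sum (\<Sum>k. g (- 1) k)) ((\<lambda>k. - int k) ` UNIV)"
    by (subst has_sum_reindex) (auto simp: o_def h2 inj_def gs)
  moreover have "(\<lambda>k. int k + 1) ` UNIV \<inter> (\<lambda>k. - int k) ` UNIV = {}" by auto
  ultimately have "(h has_sum (- (\<Sum>k. g 1 k) + (\<Sum>k. g (- 1) k))) ((\<lambda>k. int k + 1) ` UNIV \<union> (\<lambda>k. - int k) ` UNIV)"
    by (rule has_sum_Un_disjoint)
  moreover have "(\<lambda>k. int k + 1) ` UNIV \<union> (\<lambda>k. - int k) ` UNIV = UNIV"
  proof -
    have "n \<in> (\<lambda>k. int k + 1) ` UNIV \<union> (\<lambda>k. - int k) ` UNIV" for n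
    proof (cases "n \<ge> 1")
      case True
      then have "n = int (nat (n - 1)) + 1" by simp
      then show ?thesis by blast
    next
      case False
      then have "n = - int (nat (- n))" by simp
      then show ?thesis by blast
    qed
    then show ?thesis by blast
  qed
  ultimately have "K_lam l z = - (\<Sum>k. g 1 k) + (\<Sum>k. g (- 1) k)"
    unfolding K_lam_def h_def by (intro infsumI) simp
  moreover have "(\<lambda>k. - g 1 k + g (- 1) k) sums (- (\<Sum>k. g 1 k) + (\<Sum>k. g (- 1) k))"
    by (intro sums_add sums_minus gs) auto
  moreover have "- g 1 k + g (- 1) k = of_real (exp (- (l * half k))) * cardinal_term k z" for k
    by (simp add: g_def cardinal_term_def algebra_simps)
  ultimately show ?thesis by simp
qed

lemma K_lam_tendsto:
  assumes "l > 0"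
  shows "(\<lambda>N. \<Sum>k\<le>N. of_real (exp (- (l * half k))) * cardinal_term k z) \<longlonglongrightarrow> K_lam l z"
  using K_lam_sums[OF assms] by (simp add: sums_def_le)

text \<open>The subtracted constant is reproduced exactly because the cardinal series of 1 sums to
  1.\<close>

lemma cardinal_exp_sum_tendsto:
  assumes "l > 0"
  shows "(\<lambda>N. cardinal_exp_sum l N z) \<longlonglongrightarrow> K_lam l z - of_real (exp (- l))"
proof -
  have "(\<lambda>N. (\<Sum>k\<le>N. of_real (exp (- (l * half k))) * cardinal_term k z) - of_real (exp (- l)) * (\<Sum>k\<le>N. cardinal_term k z))
      \<longlonglongrightarrow> K_lam l z - of_real (exp (- l)) * 1"
    by (intro tendsto_intros K_lam_tendsto assms cardinal_series_one)
  then show ?thesis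
    by (simp add: cardinal_exp_sum_def sum_subtractf left_diff_distrib sum_distrib_left)
qed

definition cardinal_bound :: "complex \<Rightarrow> real" where
  "cardinal_bound z = 36 * (1 + (\<Sum>k. 1 / (half k)\<^sup>2)) * (1 + norm z) ^ 3 * exp (pi * \<bar>Im z\<bar>)"

lemma norm_K_lam_diff_le:
  assumes "l > 0"
  shows "norm (K_lam l z - of_real (exp (- l))) \<le> cardinal_bound z * lam_weight l"
proof (rule Lim_bounded[OF tendsto_norm[OF cardinal_exp_sum_tendsto[OF assms]]])
  show "\<forall>n\<ge>0. norm (cardinal_exp_sum l n z) \<le> cardinal_bound z * lam_weight l"
    using norm_cardinal_exp_sum_le[OF assms] by (simp add: cardinal_bound_def)
qed

lemma K_lam_of_real:
  assumes "l > 0"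
  shows "K_lam l (of_real x) \<in> \<real>"
proof (rule Lim_in_closed_set[OF closed_complex_Reals _ _ K_lam_tendsto[OF assms]])
  show "\<forall>\<^sub>F N in sequentially. (\<Sum>k\<le>N. of_real (exp (- (l * half k))) * cardinal_term k (of_real x)) \<in> \<real>"
    by (intro always_eventually allI sum_in_Reals Reals_mult cardinal_term_of_real) auto
qed auto

lemma K_lam_minus:
  assumes "l > 0"
  shows "K_lam l (- z) = K_lam l z"
  using sums_unique2[OF K_lam_sums[OF assms, of "- z", unfolded cardinal_term_minus] K_lam_sums[OF assms, of z]] .

lemma exp_type_le_polynomial:
  assumes G: "\<And>z. norm (G z) \<le> C * (1 + norm z) ^ 3 * exp (\<sigma> * \<bar>Im z\<bar>)" and "\<sigma> \<ge> 0"
  shows "exp_type_le G \<sigma>"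
  unfolding exp_type_le_def
proof (intro allI impI)
  fix \<epsilon> :: real assume e: "\<epsilon> > 0"
  have C0: "C \<ge> 0" using order_trans[OF norm_ge_zero G[of 0]] by simp
  \<comment> \<open>Each of the three factors 1 + |z| is absorbed by exp(\<epsilon>|z|/3).\<close>
  define d where "d = \<epsilon> / 3"
  define K where "K = 1 + 1 / d"
  have d: "d > 0" "K > 0" using e by (auto simp: d_def K_def intro: add_pos_pos)
  have "norm (G z) \<le> C * K ^ 3 * exp ((\<sigma> + \<epsilon>) * norm z)" for z
  proof -
    have "d * norm z \<le> exp (d * norm z)" using exp_ge_add_one_self[of "d * norm z"] by linarith
    then have "norm z \<le> 1 / d * exp (d * norm z)" using d by (simp add: field_simps)
    moreover have "1 \<le> exp (d * norm z)" using d by simp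
    ultimately have "1 + norm z \<le> K * exp (d * norm z)" unfolding K_def distrib_right by linarith
    then have "(1 + norm z) ^ 3 \<le> (K * exp (d * norm z)) ^ 3" by (intro power_mono) auto
    also have "\<dots> = K ^ 3 * exp (\<epsilon> * norm z)"
      by (simp add: power_mult_distrib exp_of_nat_mult[symmetric] d_def)
    finally have 1: "(1 + norm z) ^ 3 \<le> K ^ 3 * exp (\<epsilon> * norm z)" .
    have "norm (G z) \<le> C * (K ^ 3 * exp (\<epsilon> * norm z)) * exp (\<sigma> * norm z)"
      using C0 d \<open>\<sigma> \<ge> 0\<close> abs_Im_le_cmod[of z] 1
      by (intro order_trans[OF G] mult_mono) (auto intro!: mult_left_mono)
    also have "\<dots> = C * K ^ 3 * exp (\<epsilon> * norm z + \<sigma> * norm z)" by (simp add: exp_add)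
    finally show ?thesis by (simp add: algebra_simps)
  qed
  then show "\<exists>C. \<forall>z. norm (G z) \<le> C * exp ((\<sigma> + \<epsilon>) * norm z)" by blast
qed

lemma K_lam_entire:
  assumes "l > 0"
  shows "K_lam l holomorphic_on UNIV" "exp_type_le (K_lam l) pi"
proof -
  have b: "\<bar>exp (- (l * half k))\<bar> \<le> 2 * half k" for k
  proof -
    have "exp (- (l * half k)) \<le> 1" using assms by simp
    moreover have "\<bar>exp (- (l * half k))\<bar> = exp (- (l * half k))" by simp
    ultimately show ?thesis using half_ge[of k] by linarith
  qed
  have a: "(\<lambda>N. \<Sum>k\<le>N. (-1) ^ k * exp (- (l * half k)) / half k) \<longlonglongrightarrow> (\<Sum>k. (-1) ^ k * (exp (- (l * half k)) / half k))"
    using alt_sum_convergent[of l] assms by (simp add: alt_sum_def)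
  obtain G C where G: "G holomorphic_on UNIV"
    "\<And>R. uniform_limit (cball 0 R) (\<lambda>N z. \<Sum>k\<le>N. of_real (exp (- (l * half k))) * cardinal_term k z) G sequentially"
    "\<And>z. norm (G z) \<le> C * (1 + norm z) ^ 3 * exp (pi * \<bar>Im z\<bar>)"
    by (rule cardinal_series[OF b a]) (rule that; assumption)
  have "G z = K_lam l z" for z
    using tendsto_uniform_limitI[OF G(2)[of "norm z"], of z] K_lam_tendsto[OF assms, of z] LIMSEQ_unique by auto
  then have "G = K_lam l" by auto
  then show "K_lam l holomorphic_on UNIV" "exp_type_le (K_lam l) pi"
    using G(1) exp_type_le_polynomial[OF G(3)] by auto
qed

section \<open>Sign and size of the difference for one exponential\<close>

definition lam_diff :: "real \<Rightarrow> real \<Rightarrow> real" where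
  "lam_diff l x = exp (- (l * \<bar>x\<bar>)) - Re (K_lam l (of_real x))"

lemma lam_diff_minus: "l > 0 \<Longrightarrow> lam_diff l (- x) = lam_diff l x"
  using K_lam_minus[of l "of_real x"] by (simp add: lam_diff_def)

lemma lam_diff_eq_0:
  assumes "l > 0" "cos (pi * x) = 0"
  shows "lam_diff l x = 0"
proof -
  have 1: "lam_diff l (half m) = 0" for m
  proof -
    have "(\<lambda>k. of_real (exp (- (l * half k))) * cardinal_term k (of_real (half m))) sums (of_real (exp (- (l * half m))) * cardinal_term m (of_real (half m)))"
      by (rule sums_single[where f = "\<lambda>k. of_real (exp (- (l * half k))) * cardinal_term k (of_real (half m))", THEN sums_cong[THEN iffD1, rotated]])
         (auto simp: cardinal_term_half)
    then have "K_lam l (of_real (half m)) = of_real (exp (- (l * half m)))"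
      using sums_unique2[OF K_lam_sums[OF assms(1)]] by (simp add: cardinal_term_half)
    then show ?thesis by (simp add: lam_diff_def)
  qed
  obtain n :: int where "pi * x = of_int n * pi + pi / 2" using assms(2) unfolding cos_zero_iff_int2 by blast
  then have "pi * x = pi * (of_int n + 1 / 2)" by (simp add: algebra_simps)
  then have n: "x = of_int n + 1 / 2" by simp
  show ?thesis
  proof (cases "n \<ge> 0")
    case True
    then have "x = half (nat n)" by (simp add: n half_def)
    then show ?thesis using 1 by simp
  next
    case False
    then have "- x = half (nat (- n - 1))" by (simp add: n half_def)
    then have "lam_diff l (- x) = 0" using 1 by simp
    then show ?thesis by (simp add: lam_diff_minus assms)
  qed
qed

lemma abs_lam_diff_le:
  assumes "l > 0" "x \<noteq> 0"
  shows "\<bar>lam_diff l x\<bar> \<le> ((1 + 2 / (min \<bar>x\<bar> 1)\<^sup>2) * \<bar>\<bar>x\<bar> - 1\<bar> + cardinal_bound (of_real x)) * lam_weight l"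
proof -
  have "\<bar>Re (K_lam l (of_real x) - of_real (exp (- l)))\<bar> \<le> cardinal_bound (of_real x) * lam_weight l"
    using norm_K_lam_diff_le[OF assms(1)] abs_Re_le_cmod order_trans by blast
  moreover have "\<bar>exp (- (l * \<bar>x\<bar>)) - exp (- l)\<bar> \<le> (1 + 2 / (min \<bar>x\<bar> 1)\<^sup>2) * \<bar>\<bar>x\<bar> - 1\<bar> * lam_weight l"
    using assms by (intro abs_exp_diff_le) auto
  moreover have "Re (K_lam l (of_real x) - of_real (exp (- l))) = Re (K_lam l (of_real x)) - exp (- l)" by simp
  ultimately show ?thesis
    unfolding lam_diff_def distrib_right[of "(1 + 2 / (min \<bar>x\<bar> 1)\<^sup>2) * \<bar>\<bar>x\<bar> - 1\<bar>" "cardinal_bound (of_real x)"] by linarith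
qed

lemma lam_weight_tendsto_0: "(lam_weight \<longlongrightarrow> 0) (at_right 0)" "(lam_weight \<longlongrightarrow> 0) at_top"
proof -
  show "(lam_weight \<longlongrightarrow> 0) (at_right 0)" unfolding lam_weight_def[abs_def]
    by (rule tendsto_eq_intros refl | simp)+
  show "(lam_weight \<longlongrightarrow> 0) at_top"
  proof (rule tendsto_sandwich[OF _ _ tendsto_const tendsto_inverse_0_at_top[OF filterlim_ident]])
    show "\<forall>\<^sub>F l in at_top. 0 \<le> lam_weight l"
      using eventually_gt_at_top[of 0] by eventually_elim simp
    show "\<forall>\<^sub>F l in at_top. lam_weight l \<le> inverse l"
      using eventually_gt_at_top[of 0]
    proof eventually_elim
      case (elim l)
      then have "l / (l\<^sup>2 + 1) \<le> l / l\<^sup>2" by (intro divide_left_mono) (auto intro!: mult_pos_pos add_pos_pos)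
      then show ?case using elim by (simp add: lam_weight_def power2_eq_square inverse_eq_divide)
    qed
  qed
qed

text \<open>As a function of \<open>l\<close>, the quotient \<open>\<Psi> = (\<pi> / cos (\<pi> x)) lam_diff l x\<close> satisfies
  \<open>\<Psi>'' = x\<^sup>2 \<Psi> - 2 g\<close> with \<open>0 \<le> g \<le> 1/4\<close> and vanishes at 0 and at infinity, so the maximum
  principle applies to \<open>\<Psi>\<close> and to \<open>1 / (2 x\<^sup>2) - \<Psi>\<close>.\<close>
lemma lam_diff_sign_aux:
  assumes "l > 0" and x: "x > 0" and cx: "cos (pi * x) \<noteq> 0"
  shows "0 \<le> pi / cos (pi * x) * lam_diff l x" "pi / cos (pi * x) * lam_diff l x \<le> 1 / (2 * x\<^sup>2)"
proof -
  define c where "c = pi / cos (pi * x)"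
  have c0: "c \<noteq> 0" using cx by (simp add: c_def)
  define b where "b = (\<lambda>k. c * Re (cardinal_term k (of_real x)))"
  have bb: "\<bar>b k\<bar> \<le> (\<bar>c\<bar> * 2) * half k ^ 0" for k
    using norm_cardinal_term_le[of k "of_real x"] abs_Re_le_cmod[of "cardinal_term k (of_real x)"]
    by (simp add: b_def abs_mult mult_left_mono)
  have bb1: "\<bar>b k * half k\<bar> \<le> (\<bar>c\<bar> * 2) * half k ^ 1" for k
    using mult_right_mono[OF bb[of k], of "half k"] by (simp add: abs_mult)
  \<comment> \<open>This is \<open>cardinal_term_identity\<close> multiplied by (half k)^2 and
    divided by the cosine. It replaces the factor (half k)^2 produced by two derivatives in l by x^2
    plus a term free of x.\<close>
  have brec: "b k * half k * half k = x\<^sup>2 * b k + 2 * ((-1) ^ k * half k)" for k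
  proof -
    have "(1 - (of_real x / of_real (half k))\<^sup>2) = complex_of_real (1 - (x / half k)\<^sup>2)" by simp
    moreover have "(-1) ^ k * (2 / of_real (pi * half k)) * cos (of_real pi * of_real x) = complex_of_real ((-1) ^ k * (2 / (pi * half k)) * cos (pi * x))"
      by (simp flip: cos_of_real)
    ultimately have "(1 - (x / half k)\<^sup>2) * Re (cardinal_term k (of_real x)) = (-1) ^ k * (2 / (pi * half k)) * cos (pi * x)"
      using arg_cong[OF cardinal_term_identity[of "of_real x" k], of Re] by (simp only: Re_complex_of_real times_complex.simps Im_complex_of_real mult_zero_left diff_0_right)
    then have "(1 - (x / half k)\<^sup>2) * b k = (-1) ^ k * (2 / half k)"
      using cx by (simp add: b_def c_def field_simps)
    then have "((half k)\<^sup>2 * (1 - (x / half k)\<^sup>2)) * b k = (half k)\<^sup>2 * ((-1) ^ k * (2 / half k))"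
      by (simp only: mult.assoc)
    moreover have "(half k)\<^sup>2 * (1 - (x / half k)\<^sup>2) = (half k)\<^sup>2 - x\<^sup>2"
      by (simp add: right_diff_distrib power_divide)
    moreover have "(half k)\<^sup>2 * ((-1) ^ k * (2 / half k)) = 2 * ((-1) ^ k * half k)"
      by (simp add: power2_eq_square)
    ultimately show ?thesis by (simp add: power2_eq_square algebra_simps)
  qed
  define \<Psi> where "\<Psi> = (\<lambda>l. c * exp (- (l * x)) - (\<Sum>k. b k * exp (- (l * half k))))"
  define \<Psi>' where "\<Psi>' = (\<lambda>l. - c * x * exp (- (l * x)) + (\<Sum>k. b k * half k * exp (- (l * half k))))"
  define g where "g = (\<lambda>l. \<Sum>k. (-1) ^ k * half k * exp (- (l * half k)))"
  have \<Psi>_eq: "\<Psi> l = c * lam_diff l x" if "l > 0" for l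
  proof -
    have "(\<lambda>k. Re (of_real (exp (- (l * half k))) * cardinal_term k (of_real x))) sums Re (K_lam l (of_real x))"
      by (rule sums_Re[OF K_lam_sums[OF that]])
    then have "(\<lambda>k. c * Re (of_real (exp (- (l * half k))) * cardinal_term k (of_real x))) sums (c * Re (K_lam l (of_real x)))"
      by (rule sums_mult)
    then have "(\<Sum>k. b k * exp (- (l * half k))) = c * Re (K_lam l (of_real x))"
      by (simp add: b_def sums_iff mult_ac)
    then show ?thesis using x by (simp add: \<Psi>_def lam_diff_def algebra_simps)
  qed
  have d1: "(\<Psi> has_real_derivative \<Psi>' l) (at l)" if "l > 0" for l
    unfolding \<Psi>_def \<Psi>'_def
    by (rule derivative_eq_intros has_derivative_exp_series(1)[OF bb that] refl | simp)+
  have d2: "(\<Psi>' has_real_derivative (x\<^sup>2 * \<Psi> l - 2 * g l)) (at l)" if "l > 0" for l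
  proof -
    have s1: "summable (\<lambda>k. b k * exp (- (l * half k)))"
      by (rule has_derivative_exp_series(2)[OF bb that])
    have s2: "summable (\<lambda>k. (-1) ^ k * half k * exp (- (l * half k)))"
      by (rule has_derivative_exp_series(2)[of _ 1 1]) (use that in \<open>auto simp: abs_mult\<close>)
    have "(\<Sum>k. b k * half k * half k * exp (- (l * half k))) =
        (\<Sum>k. x\<^sup>2 * (b k * exp (- (l * half k))) + 2 * ((-1) ^ k * half k * exp (- (l * half k))))"
      unfolding brec by (simp add: algebra_simps)
    also have "\<dots> = x\<^sup>2 * (\<Sum>k. b k * exp (- (l * half k))) + 2 * g l"
      unfolding g_def by (subst suminf_add[symmetric]) (auto intro!: summable_mult s1 s2 simp: suminf_mult s1 s2)
    finally have e: "(\<Sum>k. b k * half k * half k * exp (- (l * half k))) = x\<^sup>2 * (\<Sum>k. b k * exp (- (l * half k))) + 2 * g l" .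
    have "(\<Psi>' has_real_derivative (- c * x * (- x * exp (- (l * x))) + - (\<Sum>k. b k * half k * half k * exp (- (l * half k))))) (at l)"
      unfolding \<Psi>'_def
      by (rule derivative_eq_intros has_derivative_exp_series(1)[OF bb1 that] refl | simp)+
    then show ?thesis unfolding e \<Psi>_def by (simp add: algebra_simps power2_eq_square)
  qed
  have g: "0 \<le> 2 * g l" "2 * g l \<le> 1 / 2" if "l > 0" for l
    using alternating_exp_series_deriv[OF that] by (simp_all add: g_def)
  obtain C where C: "\<And>l. l > 0 \<Longrightarrow> \<bar>\<Psi> l\<bar> \<le> C * lam_weight l"
  proof
    fix l :: real assume l: "l > 0"
    show "\<bar>\<Psi> l\<bar> \<le> (\<bar>c\<bar> * ((1 + 2 / (min \<bar>x\<bar> 1)\<^sup>2) * \<bar>\<bar>x\<bar> - 1\<bar> + cardinal_bound (of_real x))) * lam_weight l"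
      unfolding \<Psi>_eq[OF l] abs_mult mult.assoc[of "\<bar>c\<bar>"]
      using x by (intro mult_left_mono abs_lam_diff_le l) auto
  qed
  have lim: "(\<Psi> \<longlongrightarrow> 0) (at_right 0)" "(\<Psi> \<longlongrightarrow> 0) at_top"
  proof -
    show "(\<Psi> \<longlongrightarrow> 0) (at_right 0)"
    proof (rule Lim_null_comparison)
      show "((\<lambda>l. C * lam_weight l) \<longlongrightarrow> 0) (at_right 0)" by (rule tendsto_mult_right_zero[OF lam_weight_tendsto_0(1)])
      show "\<forall>\<^sub>F l in at_right 0. norm (\<Psi> l) \<le> C * lam_weight l"
        using C by (auto simp: eventually_at_filter)
    qed
    show "(\<Psi> \<longlongrightarrow> 0) at_top"
    proof (rule Lim_null_comparison)
      show "((\<lambda>l. C * lam_weight l) \<longlongrightarrow> 0) at_top" by (rule tendsto_mult_right_zero[OF lam_weight_tendsto_0(2)])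
      show "\<forall>\<^sub>F l in at_top. norm (\<Psi> l) \<le> C * lam_weight l"
        using eventually_gt_at_top[of 0] by eventually_elim (use C in auto)
    qed
  qed
  have "0 \<le> \<Psi> l"
  proof (rule maximum_principle_half_line[where f = \<Psi> and f' = \<Psi>' and x = x and p = "\<lambda>l. 2 * g l"])
    show "\<forall>\<^sub>F l in at_right 0. \<Psi> l > - e" "\<forall>\<^sub>F l in at_top. \<Psi> l > - e" if "e > 0" for e
      using order_tendstoD(1)[OF lim(1), of "- e"] order_tendstoD(1)[OF lim(2), of "- e"] that by auto
  qed (use d1 d2 g x \<open>l > 0\<close> in auto)
  moreover have "0 \<le> 1 / (2 * x\<^sup>2) - \<Psi> l"
  \<comment> \<open>The constant 1/(2 x^2) is the stationary solution for the source 1/2, the upper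
    bound for 2 g; hence the difference satisfies the same equation with the nonnegative source 1/2
    - 2 g.\<close>
  proof (rule maximum_principle_half_line[where f = "\<lambda>l. 1 / (2 * x\<^sup>2) - \<Psi> l" and f' = "\<lambda>l. - \<Psi>' l" and x = x and p = "\<lambda>l. 1 / 2 - 2 * g l"])
    show "((\<lambda>l. 1 / (2 * x\<^sup>2) - \<Psi> l) has_real_derivative - \<Psi>' l) (at l)" if "l > 0" for l
      using DERIV_diff[OF DERIV_const d1[OF that]] by simp
    show "((\<lambda>l. - \<Psi>' l) has_real_derivative (x\<^sup>2 * (1 / (2 * x\<^sup>2) - \<Psi> l) - (1 / 2 - 2 * g l))) (at l)" if "l > 0" for l
      using DERIV_minus[OF d2[OF that]] x by (simp add: algebra_simps)
    show "\<forall>\<^sub>F l in at_right 0. 1 / (2 * x\<^sup>2) - \<Psi> l > - e" "\<forall>\<^sub>F l in at_top. 1 / (2 * x\<^sup>2) - \<Psi> l > - e" if "e > 0" for e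
    proof -
      have p: "1 / (2 * x\<^sup>2) > 0" using x by simp
      show "\<forall>\<^sub>F l in at_right 0. 1 / (2 * x\<^sup>2) - \<Psi> l > - e"
        using order_tendstoD(2)[OF lim(1) that] by eventually_elim (use p in linarith)
      show "\<forall>\<^sub>F l in at_top. 1 / (2 * x\<^sup>2) - \<Psi> l > - e"
        using order_tendstoD(2)[OF lim(2) that] by eventually_elim (use p in linarith)
    qed
  qed (use g x \<open>l > 0\<close> in auto)
  ultimately show "0 \<le> pi / cos (pi * x) * lam_diff l x" "pi / cos (pi * x) * lam_diff l x \<le> 1 / (2 * x\<^sup>2)"
    using \<Psi>_eq[OF \<open>l > 0\<close>] by (auto simp: c_def)
qed

text \<open>The bound 1/x^2 supplies the decay in x that the weight estimate lacks, since
  \<open>cardinal_bound\<close> grows with x. Evenness reduces the claim to x > 0.\<close>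

lemma lam_diff_sign:
  assumes "l > 0" "x \<noteq> 0"
  shows "lam_diff l x * sgn (cos (pi * x)) = \<bar>lam_diff l x\<bar>" "\<bar>lam_diff l x\<bar> \<le> 1 / x\<^sup>2"
proof -
  have *: "lam_diff l x * sgn (cos (pi * x)) = \<bar>lam_diff l x\<bar> \<and> \<bar>lam_diff l x\<bar> \<le> 1 / x\<^sup>2" if x: "x > 0" for x
  proof (cases "cos (pi * x) = 0")
    case True
    then show ?thesis using lam_diff_eq_0[OF assms(1)] by simp
  next
    case False
    define \<psi> where "\<psi> = pi / cos (pi * x) * lam_diff l x"
    have \<psi>: "0 \<le> \<psi>" "\<psi> \<le> 1 / (2 * x\<^sup>2)" using lam_diff_sign_aux[OF assms(1) x False] by (auto simp: \<psi>_def)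
    have eq: "lam_diff l x = cos (pi * x) * (\<psi> / pi)" using False by (simp add: \<psi>_def)
    have ab: "\<bar>lam_diff l x\<bar> = \<bar>cos (pi * x)\<bar> * (\<psi> / pi)" unfolding eq abs_mult using \<psi> by simp
    have "\<bar>cos (pi * x)\<bar> * (\<psi> / pi) \<le> 1 * (1 / x\<^sup>2)"
    proof (rule mult_mono)
      have "\<psi> / pi \<le> \<psi> / 1" using \<psi> pi_ge_two by (intro divide_left_mono) auto
      also have "\<dots> \<le> 1 / (2 * x\<^sup>2)" using \<psi> by simp
      also have "\<dots> \<le> 1 / x\<^sup>2" using x by (intro divide_left_mono) auto
      finally show "\<psi> / pi \<le> 1 / x\<^sup>2" .
    qed (use \<psi> in auto)
    moreover have "lam_diff l x * sgn (cos (pi * x)) = \<bar>lam_diff l x\<bar>"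
      unfolding ab unfolding eq by (simp add: abs_sgn mult_ac)
    ultimately show ?thesis by (simp add: ab)
  qed
  show "lam_diff l x * sgn (cos (pi * x)) = \<bar>lam_diff l x\<bar>" "\<bar>lam_diff l x\<bar> \<le> 1 / x\<^sup>2"
    using *[of x] *[of "- x"] assms by (cases "x > 0"; simp add: lam_diff_minus)+
qed

section \<open>Integrals over the real line\<close>

lemma AE_nonzero_real: "AE x::real in lborel. x \<noteq> 0"
  by (rule AE_lborel_singleton)

lemma integral_split_at_0:
  fixes f :: "real \<Rightarrow> 'a :: {banach, second_countable_topology}"
  assumes [measurable]: "f \<in> borel_measurable borel"
    and p: "integrable lborel (\<lambda>x. indicator {0..} x *\<^sub>R f x)"
    and m: "integrable lborel (\<lambda>x. indicator {0..} x *\<^sub>R f (- x))"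
  shows "integrable lborel f"
    "(\<integral>x. f x \<partial>lborel) = (\<integral>x. indicator {0..} x *\<^sub>R f x \<partial>lborel) + (\<integral>x. indicator {0..} x *\<^sub>R f (- x) \<partial>lborel)"
proof -
  let ?h = "\<lambda>x. indicator {0..} (- x) *\<^sub>R f x"
  have m': "integrable lborel ?h"
    using lborel_integrable_real_affine[OF m, of "- 1" 0] by simp
  have mi: "(\<integral>x. ?h x \<partial>lborel) = (\<integral>x. indicator {0..} x *\<^sub>R f (- x) \<partial>lborel)"
    using lborel_integral_real_affine[of "- 1" "\<lambda>x. indicator {0..} x *\<^sub>R f (- x)" 0] by simp
  have ae: "AE x in lborel. indicator {0..} x *\<^sub>R f x + ?h x = f x"
    using AE_nonzero_real by eventually_elim (auto simp: indicator_def)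
  show "integrable lborel f"
    by (rule integrable_cong_AE_imp[OF Bochner_Integration.integrable_add[OF p m'] _ ae]) simp
  have "(\<integral>x. f x \<partial>lborel) = (\<integral>x. indicator {0..} x *\<^sub>R f x + ?h x \<partial>lborel)"
    by (rule integral_cong_AE) (use ae in auto)
  then show "(\<integral>x. f x \<partial>lborel) = (\<integral>x. indicator {0..} x *\<^sub>R f x \<partial>lborel) + (\<integral>x. indicator {0..} x *\<^sub>R f (- x) \<partial>lborel)"
    by (simp add: Bochner_Integration.integral_add[OF p m'] mi)
qed

lemma integrable_FTC_atLeast:
  fixes f :: "real \<Rightarrow> real"
  assumes [measurable]: "f \<in> borel_measurable borel"
    and f: "\<And>x. a \<le> x \<Longrightarrow> (F has_real_derivative f x) (at x)"
    and nonneg: "\<And>x. a \<le> x \<Longrightarrow> 0 \<le> f x" and lim: "(F \<longlongrightarrow> T) at_top"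
  shows "integrable lborel (\<lambda>x. indicator {a..} x *\<^sub>R f x)"
proof (rule integrableI_nn_integral_finite)
  have "(\<integral>\<^sup>+x. ennreal (indicator {a..} x *\<^sub>R f x) \<partial>lborel) = (\<integral>\<^sup>+x. ennreal (f x) * indicator {a..} x \<partial>lborel)"
    by (intro nn_integral_cong) (auto simp: indicator_def)
  also have "\<dots> = ennreal (T - F a)"
    by (rule nn_integral_FTC_atLeast) (use assms in auto)
  finally show "(\<integral>\<^sup>+x. ennreal (indicator {a..} x *\<^sub>R f x) \<partial>lborel) = ennreal (T - F a)" .
qed (use nonneg in \<open>auto simp: indicator_def\<close>)

lemma integrable_exp_half_line:
  assumes "l > (0::real)"
  shows "integrable lborel (\<lambda>x. indicator {0..} x *\<^sub>R exp (- (l * x)))"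
proof (rule integrable_FTC_atLeast[where F = "\<lambda>x. - exp (- (l * x)) / l" and T = 0])
  show "((\<lambda>x. - exp (- (l * x)) / l) has_real_derivative exp (- (l * x))) (at x)" for x
    using assms by (auto intro!: derivative_eq_intros)
  have "LIM x at_top. - (l * x) :> at_bot"
    unfolding filterlim_uminus_at_bot minus_minus
    by (rule filterlim_tendsto_pos_mult_at_top[OF tendsto_const assms filterlim_ident])
  then have "((\<lambda>x. exp (- (l * x))) \<longlongrightarrow> 0) at_top"
    by (rule filterlim_compose[OF exp_at_bot])
  from tendsto_divide[OF tendsto_minus[OF this] tendsto_const[of l]] assms
  show "((\<lambda>x. - exp (- (l * x)) / l) \<longlongrightarrow> 0) at_top" by simp
qed auto

lemma integrable_exp_abs:
  assumes "l > (0::real)"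
  shows "integrable lborel (\<lambda>x. exp (- (l * \<bar>x\<bar>)))"
proof (rule integral_split_at_0(1))
  have "(\<lambda>x. indicator {0..} x *\<^sub>R exp (- (l * \<bar>x\<bar>))) = (\<lambda>x. indicator {0..} x *\<^sub>R exp (- (l * x)))"
    by (auto simp: indicator_def)
  then show "integrable lborel (\<lambda>x. indicator {0..} x *\<^sub>R exp (- (l * \<bar>x\<bar>)))"
    "integrable lborel (\<lambda>x. indicator {0..} x *\<^sub>R exp (- (l * \<bar>- x\<bar>)))"
    using integrable_exp_half_line[OF assms] by simp_all
qed simp

lemma integral_exp_half_line_complex:
  assumes "Re s > 0"
  shows "integrable lborel (\<lambda>x. indicator {0..} x *\<^sub>R exp (- (s * of_real x)))"
    "(\<integral>x. indicator {0..} x *\<^sub>R exp (- (s * of_real x)) \<partial>lborel) = 1 / s"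
proof -
  let ?u = "\<lambda>x::real. indicator {0..} x *\<^sub>R exp (- (s * of_real x))"
  have s0: "s \<noteq> 0" using assms by auto
  show int: "integrable lborel ?u"
  proof (rule Bochner_Integration.integrable_bound[OF integrable_exp_half_line[OF assms]])
    show "AE x in lborel. norm (?u x) \<le> norm (indicator {0..} x *\<^sub>R exp (- (Re s * x)))"
      by (intro AE_I2) (auto simp: indicator_def)
  qed measurable
  have "integral {- real n..real n} ?u = (1 - exp (- (s * of_real (real n)))) / s" for n
  proof -
    have "((\<lambda>x. exp (- (s * of_real x))) has_integral (- exp (- (s * of_real (real n))) / s - (- exp (- (s * of_real 0)) / s))) {0..real n}"
    proof (rule fundamental_theorem_of_calculus)
      fix x :: real
      show "((\<lambda>x. - exp (- (s * of_real x)) / s) has_vector_derivative exp (- (s * of_real x))) (at x within {0..real n})"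
        by (rule has_vector_derivative_real_field) (use s0 in \<open>auto intro!: derivative_eq_intros\<close>)
    qed simp
    then have "((\<lambda>x. if x \<in> {0..real n} then exp (- (s * of_real x)) else 0) has_integral (- exp (- (s * of_real (real n))) / s - (- exp (- (s * of_real 0)) / s))) {- real n..real n}"
      by (subst has_integral_restrict) auto
    then have "(?u has_integral (- exp (- (s * of_real (real n))) / s - (- exp (- (s * of_real 0)) / s))) {- real n..real n}"
      by (rule has_integral_eq[rotated]) (auto simp: indicator_def)
    then show ?thesis by (simp add: integral_unique diff_divide_distrib)
  qed
  moreover have "(\<lambda>n. (1 - exp (- (s * of_real (real n)))) / s) \<longlonglongrightarrow> (1 - 0) / s"
  proof (intro tendsto_divide tendsto_diff tendsto_const s0)
    have "LIM n sequentially. - (Re s * real n) :> at_bot"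
      unfolding filterlim_uminus_at_bot minus_minus
      by (rule filterlim_tendsto_pos_mult_at_top[OF tendsto_const assms filterlim_real_sequentially])
    then have "(\<lambda>n. exp (- (Re s * real n))) \<longlonglongrightarrow> 0"
      by (rule filterlim_compose[OF exp_at_bot])
    then show "(\<lambda>n. exp (- (s * of_real (real n)))) \<longlonglongrightarrow> 0"
      by (subst tendsto_norm_zero_iff[symmetric]) simp
  qed
  ultimately show "(\<integral>x. ?u x \<partial>lborel) = 1 / s"
    using integral_over_reals_eq_limit[OF int] LIMSEQ_unique by simp blast
qed

lemma e2pi_of_real: "e2pi (of_real y) = cis (2 * pi * y)"
  by (simp add: e2pi_def cis_conv_exp mult_ac)

lemma norm_e2pi_of_real [simp]: "norm (e2pi (- of_real (t * x))) = 1"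
  by (simp only: of_real_minus[symmetric] e2pi_of_real norm_cis)

lemma borel_measurable_e2pi [measurable]: "(\<lambda>x::real. e2pi (- of_real (t * x))) \<in> borel_measurable borel"
  unfolding e2pi_def by measurable

lemma fourier_exp_abs:
  assumes "l > 0"
  shows "(\<integral>x. of_real (exp (- (l * \<bar>x\<bar>))) * e2pi (- of_real (t * x)) \<partial>lborel) = of_real (2 * l / (l\<^sup>2 + 4 * pi\<^sup>2 * t\<^sup>2))"
proof -
  define \<omega> where "\<omega> = 2 * pi * t"
  define s1 s2 where "s1 = Complex l \<omega>" and "s2 = Complex l (- \<omega>)"
  have s: "Re s1 > 0" "Re s2 > 0" using assms by (simp_all add: s1_def s2_def)
  let ?f = "\<lambda>x. complex_of_real (exp (- (l * \<bar>x\<bar>))) * e2pi (- of_real (t * x))"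
  have e1: "indicator {0..} x *\<^sub>R ?f x = indicator {0..} x *\<^sub>R exp (- (s1 * of_real x))" for x
    by (auto simp: indicator_def e2pi_def exp_of_real[symmetric] exp_add[symmetric] s1_def Complex_eq \<omega>_def algebra_simps)
  have e2: "indicator {0..} x *\<^sub>R ?f (- x) = indicator {0..} x *\<^sub>R exp (- (s2 * of_real x))" for x
    by (auto simp: indicator_def e2pi_def exp_of_real[symmetric] exp_add[symmetric] s2_def Complex_eq \<omega>_def algebra_simps)
  have "(\<integral>x. ?f x \<partial>lborel) = (\<integral>x. indicator {0..} x *\<^sub>R ?f x \<partial>lborel) + (\<integral>x. indicator {0..} x *\<^sub>R ?f (- x) \<partial>lborel)"
  proof (rule integral_split_at_0(2))
    show "integrable lborel (\<lambda>x. indicator {0..} x *\<^sub>R ?f x)" "integrable lborel (\<lambda>x. indicator {0..} x *\<^sub>R ?f (- x))"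
      unfolding e1 e2 by (rule integral_exp_half_line_complex(1)[OF s(1)], rule integral_exp_half_line_complex(1)[OF s(2)])
  qed measurable
  also have "\<dots> = 1 / s1 + 1 / s2"
    unfolding e1 e2 by (simp only: integral_exp_half_line_complex(2) s)
  also have "\<dots> = (s1 + s2) / (s1 * s2)" using s by (auto simp: add_divide_distrib)
  also have "s1 + s2 = of_real (2 * l)" by (simp add: s1_def s2_def complex_eq_iff)
  also have "s1 * s2 = of_real (l\<^sup>2 + 4 * pi\<^sup>2 * t\<^sup>2)"
    by (simp add: s1_def s2_def complex_eq_iff \<omega>_def power2_eq_square)
  finally show ?thesis by (simp only: of_real_divide)
qed

lemma cos_pi_pos_le_half: "0 \<le> x \<Longrightarrow> x < 1 / 2 \<Longrightarrow> cos (pi * x) > 0"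
  by (intro cos_gt_zero_pi) (auto simp: field_simps intro: order_less_le_trans[of _ 0])

lemma cos_pi_plus_one: "cos (pi * (1 + x)) = - cos (pi * x)"
  by (simp add: distrib_left cos_add)

lemma integral_exp_sgn_cos_unit:
  assumes "l > 0"
  shows "((\<lambda>x. exp (- (l * x)) * sgn (cos (pi * x))) has_integral (1 - 2 * exp (- (l / 2)) + exp (- l)) / l) {0..1}"
proof -
  have *: "((\<lambda>x. exp (- (l * x))) has_integral (- exp (- (l * b)) / l - (- exp (- (l * a)) / l))) {a..b}" if "a \<le> b" for a b
  proof (rule fundamental_theorem_of_calculus[OF that])
    fix x :: real
    have "((\<lambda>x. - exp (- (l * x)) / l) has_real_derivative exp (- (l * x))) (at x within {a..b})"
      using assms by (auto intro!: derivative_eq_intros)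
    then show "((\<lambda>x. - exp (- (l * x)) / l) has_vector_derivative exp (- (l * x))) (at x within {a..b})"
      by (simp add: has_real_derivative_iff_has_vector_derivative)
  qed
  have 1: "((\<lambda>x. exp (- (l * x)) * sgn (cos (pi * x))) has_integral (- exp (- (l * (1 / 2))) / l - (- exp (- (l * 0)) / l))) {0..1 / 2}"
    by (rule has_integral_spike_finite[OF _ _ *, of "{1 / 2}"]) (auto simp: cos_pi_pos_le_half)
  have 2: "((\<lambda>x. exp (- (l * x)) * sgn (cos (pi * x))) has_integral - (- exp (- (l * 1)) / l - (- exp (- (l * (1 / 2))) / l))) {1 / 2..1}"
  proof (rule has_integral_spike_finite[OF _ _ has_integral_neg[OF *], of "{1 / 2}"])
    fix x :: real assume x: "x \<in> {1 / 2..1} - {1 / 2}"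
    have "cos (pi * (1 - x)) > 0" using x by (intro cos_pi_pos_le_half) auto
    moreover have "cos (pi * (1 - x)) = - cos (pi * x)" by (simp add: right_diff_distrib cos_diff)
    ultimately show "exp (- (l * x)) * sgn (cos (pi * x)) = - exp (- (l * x))" by simp
  qed auto
  have "((\<lambda>x. exp (- (l * x)) * sgn (cos (pi * x))) has_integral
     (- exp (- (l * (1 / 2))) / l - (- exp (- (l * 0)) / l)) + - (- exp (- (l * 1)) / l - (- exp (- (l * (1 / 2))) / l))) {0..1}"
    by (rule has_integral_combine[OF _ _ 1 2]) auto
  then show ?thesis
    by (rule has_integral_eq_rhs) (simp add: diff_divide_distrib add_divide_distrib)
qed

text \<open>On the half line the integrand is multiplied by -exp(-l) under translation by 1. So its
  integral satisfies J = U - exp(-l) J, where U is the integral over [0, 1], and evenness doubles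
  it.\<close>

lemma integral_exp_abs_sgn_cos:
  assumes "l > 0"
  shows "(\<integral>x. exp (- (l * \<bar>x\<bar>)) * sgn (cos (pi * x)) \<partial>lborel) = 2 / l - 2 / l / cosh (l / 2)"
proof -
  define g where "g = (\<lambda>x. exp (- (l * x)) * sgn (cos (pi * x)))"
  define J where "J = (\<integral>x. indicator {0..} x *\<^sub>R g x \<partial>lborel)"
  have [measurable]: "g \<in> borel_measurable borel" unfolding g_def by measurable
  have Jint: "integrable lborel (\<lambda>x. indicator {0..} x *\<^sub>R g x)"
  proof (rule Bochner_Integration.integrable_bound[OF integrable_exp_half_line[OF assms]])
    show "AE x in lborel. norm (indicator {0..} x *\<^sub>R g x) \<le> norm (indicator {0..} x *\<^sub>R exp (- (l * x)))"
      by (intro AE_I2) (auto simp: indicator_def g_def abs_mult sgn_if)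
  qed measurable
  have U: "(\<integral>x. indicator {0..1} x *\<^sub>R g x \<partial>lborel) = (1 - 2 * exp (- (l / 2)) + exp (- l)) / l"
  proof -
    have "integrable lborel (\<lambda>x. indicator {0..1} x *\<^sub>R (indicator {0..} x *\<^sub>R g x))"
      by (rule integrable_mult_indicator[OF _ Jint]) simp
    also have "(\<lambda>x. indicator {0..1} x *\<^sub>R (indicator {0..} x *\<^sub>R g x)) = (\<lambda>x. indicator {0..1} x *\<^sub>R g x)"
      by (auto simp: indicator_def)
    finally have "set_integrable lborel {0..1} g" by (simp add: set_integrable_def)
    from set_borel_integral_eq_integral(2)[OF this] integral_unique[OF integral_exp_sgn_cos_unit[OF assms]]
    show ?thesis by (simp add: set_lebesgue_integral_def g_def)
  qed
  \<comment> \<open>At x = 0 both terms on the right contribute the value at 1, hence only almost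
    everywhere.\<close>
  have shift: "AE x in lborel. indicator {0..} (1 + x) *\<^sub>R g (1 + x) = indicator {0..1} (1 + x) *\<^sub>R g (1 + x) + (- exp (- l)) *\<^sub>R (indicator {0..} x *\<^sub>R g x)"
    using AE_nonzero_real
  proof eventually_elim
    case (elim x)
    have "g (1 + x) = - exp (- l) * g x"
      unfolding g_def cos_pi_plus_one by (simp add: distrib_left exp_add[symmetric] exp_diff[symmetric] sgn_minus)
    then show ?case using elim by (auto simp: indicator_def)
  qed
  have Uint: "integrable lborel (\<lambda>x. indicator {0..1} (1 + x) *\<^sub>R g (1 + x))"
  proof -
    have "integrable lborel (\<lambda>x. indicator {0..1} x *\<^sub>R (indicator {0..} x *\<^sub>R g x))"
      by (rule integrable_mult_indicator[OF _ Jint]) simp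
    also have "(\<lambda>x. indicator {0..1} x *\<^sub>R (indicator {0..} x *\<^sub>R g x)) = (\<lambda>x. indicator {0..1} x *\<^sub>R g x)"
      by (auto simp: indicator_def)
    finally show ?thesis using lborel_integrable_real_affine[of "\<lambda>x. indicator {0..1} x *\<^sub>R g x" 1 1] by simp
  qed
  have "J = (\<integral>x. indicator {0..} (1 + x) *\<^sub>R g (1 + x) \<partial>lborel)"
    unfolding J_def using lborel_integral_real_affine[of 1 "\<lambda>x. indicator {0..} x *\<^sub>R g x" 1] by simp
  also have "\<dots> = (\<integral>x. indicator {0..1} (1 + x) *\<^sub>R g (1 + x) + (- exp (- l)) *\<^sub>R (indicator {0..} x *\<^sub>R g x) \<partial>lborel)"
    by (rule integral_cong_AE[OF _ _ shift]) measurable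
  also have "\<dots> = (\<integral>x. indicator {0..1} (1 + x) *\<^sub>R g (1 + x) \<partial>lborel) + (- exp (- l)) * J"
    unfolding J_def by (subst Bochner_Integration.integral_add[OF Uint integrable_scaleR_right[OF Jint]]) simp
  also have "(\<integral>x. indicator {0..1} (1 + x) *\<^sub>R g (1 + x) \<partial>lborel) = (\<integral>x. indicator {0..1} x *\<^sub>R g x \<partial>lborel)"
    using lborel_integral_real_affine[of 1 "\<lambda>x. indicator {0..1} x *\<^sub>R g x" 1] by simp
  finally have J: "J * (1 + exp (- l)) = (1 - 2 * exp (- (l / 2)) + exp (- l)) / l"
    unfolding U by (simp add: algebra_simps)
  have "(\<integral>x. exp (- (l * \<bar>x\<bar>)) * sgn (cos (pi * x)) \<partial>lborel) = J + J"
  proof -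
    have e: "indicator {0..} x *\<^sub>R (exp (- (l * \<bar>x\<bar>)) * sgn (cos (pi * x))) = indicator {0..} x *\<^sub>R g x"
      "indicator {0..} x *\<^sub>R (exp (- (l * \<bar>- x\<bar>)) * sgn (cos (pi * - x))) = indicator {0..} x *\<^sub>R g x" for x :: real
      by (auto simp: indicator_def g_def)
    show ?thesis unfolding J_def
      by (subst integral_split_at_0(2)) (simp_all only: e Jint, measurable)
  qed
  also have "J = (1 - 2 * exp (- (l / 2)) + exp (- l)) / l / (1 + exp (- l))"
    unfolding J[symmetric] using add_pos_pos[of 1 "exp (- l)"] by simp
  also have "\<dots> = (1 - 1 / cosh (l / 2)) / l"
  proof -
    define u v where "u = exp (l / 2)" and "v = exp (- (l / 2))"
    have uv: "u > 0" "v > 0" "u * v = 1" "exp (- l) = v * v" by (simp_all add: u_def v_def exp_add[symmetric])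
    have "1 + v * v > 0" "u + v > 0" using uv by (auto intro: add_pos_pos)
    have "v * (u + v) = 1 + v * v" using uv by (simp add: algebra_simps)
    then have "(1 - 2 * v + v * v) / (1 + v * v) = 1 - 2 * v / (v * (u + v))"
      using \<open>1 + v * v > 0\<close> by (simp add: field_simps)
    also have "\<dots> = 1 - 1 / ((u + v) / 2)" using uv by simp
    also have "(u + v) / 2 = cosh (l / 2)" by (simp add: cosh_def u_def v_def)
    finally have "(1 - 2 * v + v * v) / (1 + v * v) / l = (1 - 1 / cosh (l / 2)) / l" by simp
    then show ?thesis unfolding uv(4) v_def[symmetric] by (simp add: mult.commute)
  qed
  finally show ?thesis by (simp add: diff_divide_distrib)
qed

lemma integrable_inverse_quadratic: "integrable lborel (\<lambda>x::real. 1 / (1 + x\<^sup>2))"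
proof (rule integral_split_at_0(1))
  have "integrable lborel (\<lambda>x::real. indicator {0..} x *\<^sub>R (1 / (1 + x\<^sup>2)))"
  proof (rule integrable_FTC_atLeast[where F = arctan and T = "pi / 2"])
    show "(arctan has_real_derivative 1 / (1 + x\<^sup>2)) (at x)" for x
      using DERIV_arctan[of x] by (simp add: divide_inverse)
    show "(\<lambda>x::real. 1 / (1 + x\<^sup>2)) \<in> borel_measurable borel" by measurable
  qed (auto intro: tendsto_arctan_at_top)
  then show "integrable lborel (\<lambda>x::real. indicator {0..} x *\<^sub>R (1 / (1 + x\<^sup>2)))"
    "integrable lborel (\<lambda>x::real. indicator {0..} x *\<^sub>R (1 / (1 + (- x)\<^sup>2)))" by simp_all
qed simp

lemma continuous_on_of_real_entire:
  assumes "F holomorphic_on UNIV"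
  shows "continuous_on A (\<lambda>x::real. F (of_real x))"
  by (rule continuous_on_compose2[OF holomorphic_on_imp_continuous_on[OF assms]]) (auto intro: continuous_intros)

lemma lam_diff_integrable:
  assumes "l > 0"
  shows "integrable lborel (lam_diff l)"
proof -
  have cont: "continuous_on A (lam_diff l)" for A
    unfolding lam_diff_def[abs_def]
    by (intro continuous_intros continuous_on_of_real_entire K_lam_entire assms)
  have [measurable]: "lam_diff l \<in> borel_measurable borel" by (rule borel_measurable_continuous_onI[OF cont])
  have "compact (lam_diff l ` {-1..1})" by (intro compact_continuous_image cont) auto
  then have "bounded (lam_diff l ` {-1..1})" by (rule compact_imp_bounded)
  then obtain B where "\<forall>y \<in> lam_diff l ` {-1..1}. norm y \<le> B" unfolding bounded_iff by blast
  then have B: "\<bar>lam_diff l x\<bar> \<le> B" if "x \<in> {-1..1}" for x using that by auto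
  have B0: "B \<ge> 0" using order_trans[OF abs_ge_zero B[of 0]] by simp
  \<comment> \<open>Inside [-1, 1] the compactness bound \<open>B\<close> is used with 1/(1 + x^2)
    \<ge> 1/2; outside, 1/x^2 \<le> 2/(1 + x^2).\<close>
  have bd: "\<bar>lam_diff l x\<bar> \<le> (2 * B + 2) * (1 / (1 + x\<^sup>2))" for x
  proof (cases "\<bar>x\<bar> \<le> 1")
    case True
    then have "\<bar>lam_diff l x\<bar> \<le> B" by (intro B) auto
    moreover have "x\<^sup>2 \<le> 1" using True by (simp add: abs_square_le_1)
    then have "1 / 2 \<le> 1 / (1 + x\<^sup>2)" by (intro divide_left_mono) (auto intro: add_pos_nonneg)
    then have "(2 * B + 2) * (1 / 2) \<le> (2 * B + 2) * (1 / (1 + x\<^sup>2))" using B0 by (intro mult_left_mono) auto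
    moreover have "(2 * B + 2) * (1 / 2) = B + 1" by simp
    ultimately show ?thesis by linarith
  next
    case False
    then have x: "x \<noteq> 0" "x\<^sup>2 \<ge> 1" using abs_square_less_1[of x] by auto
    have "\<bar>lam_diff l x\<bar> \<le> 1 / x\<^sup>2" by (rule lam_diff_sign(2)[OF assms x(1)])
    also have "\<dots> \<le> 2 * (1 / (1 + x\<^sup>2))" using x by (simp add: field_simps add_pos_nonneg)
    also have "\<dots> \<le> (2 * B + 2) * (1 / (1 + x\<^sup>2))" using B0 by (intro mult_right_mono) auto
    finally show ?thesis .
  qed
  show ?thesis
  proof (rule Bochner_Integration.integrable_bound)
    show "integrable lborel (\<lambda>x. (2 * B + 2) * (1 / (1 + x\<^sup>2)))"
      by (rule integrable_mult_right[OF integrable_inverse_quadratic])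
    show "AE x in lborel. norm (lam_diff l x) \<le> norm ((2 * B + 2) * (1 / (1 + x\<^sup>2)))"
      unfolding real_norm_def by (intro AE_I2 order_trans[OF bd abs_ge_self])
  qed measurable
qed

lemma K_lam_eq_exp_minus_lam_diff:
  assumes "l > 0"
  shows "K_lam l (of_real x) = of_real (exp (- (l * \<bar>x\<bar>)) - lam_diff l x)"
  using K_lam_of_real[OF assms, of x] by (simp add: lam_diff_def of_real_Re)

lemma K_lam_integrable:
  assumes "l > 0"
  shows "integrable lborel (\<lambda>x. K_lam l (of_real x))"
  unfolding K_lam_eq_exp_minus_lam_diff[OF assms]
  by (intro integrable_of_real Bochner_Integration.integrable_diff integrable_exp_abs lam_diff_integrable assms)

lemma integrable_mult_sgn_cos:
  fixes f :: "real \<Rightarrow> 'a :: {real_normed_algebra_1, banach, second_countable_topology}"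
  assumes "integrable lborel f"
  shows "integrable lborel (\<lambda>x. f x * of_real (sgn (cos (pi * x))))"
proof (rule Bochner_Integration.integrable_bound[OF assms])
  show "AE x in lborel. norm (f x * of_real (sgn (cos (pi * x)))) \<le> norm (f x)"
  proof (intro AE_I2)
    fix x
    have "norm (f x * of_real (sgn (cos (pi * x)))) \<le> norm (f x) * norm (of_real (sgn (cos (pi * x))) :: 'a)"
      by (rule norm_mult_ineq)
    also have "\<dots> \<le> norm (f x) * 1" by (intro mult_left_mono) (auto simp: sgn_if)
    finally show "norm (f x * of_real (sgn (cos (pi * x)))) \<le> norm (f x)" by simp
  qed
qed (use assms in measurable)

text \<open>The absolute value is multiplication by sgn(cos(\<pi> x)), to which the interpolating
  function is orthogonal, so only the elementary integral of the exponential against the sign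
  remains.\<close>

lemma integral_abs_lam_diff:
  assumes "l > 0"
  shows "(\<integral>x. \<bar>lam_diff l x\<bar> \<partial>lborel) = 2 / l - 2 / l / cosh (l / 2)"
proof -
  obtain C where C: "\<And>z. norm (K_lam l z) \<le> C * exp (pi * \<bar>Im z\<bar>)"
    using exp_type_le_integrable_bound[OF K_lam_entire[OF assms] pi_ge_zero K_lam_integrable[OF assms]] by blast
  have K0: "(\<integral>x. K_lam l (of_real x) * of_real (sgn (cos (pi * x))) \<partial>lborel) = 0"
    by (rule integral_sgn_cos_eq_0[OF K_lam_entire(1)[OF assms] K_lam_integrable[OF assms] C])
  have i1: "integrable lborel (\<lambda>x. exp (- (l * \<bar>x\<bar>)) * sgn (cos (pi * x)))"
    using integrable_mult_sgn_cos[OF integrable_exp_abs[OF assms]] by simp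
  have i2: "integrable lborel (\<lambda>x. lam_diff l x * sgn (cos (pi * x)))"
    using integrable_mult_sgn_cos[OF lam_diff_integrable[OF assms]] by simp
  have "(\<integral>x. K_lam l (of_real x) * of_real (sgn (cos (pi * x))) \<partial>lborel) =
     (\<integral>x. complex_of_real (exp (- (l * \<bar>x\<bar>)) * sgn (cos (pi * x)) - lam_diff l x * sgn (cos (pi * x))) \<partial>lborel)"
    by (simp add: K_lam_eq_exp_minus_lam_diff[OF assms] left_diff_distrib)
  also have "\<dots> = of_real ((\<integral>x. exp (- (l * \<bar>x\<bar>)) * sgn (cos (pi * x)) \<partial>lborel) - (\<integral>x. lam_diff l x * sgn (cos (pi * x)) \<partial>lborel))"
    by (simp only: integral_complex_of_real Bochner_Integration.integral_diff[OF i1 i2])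
  finally have "complex_of_real ((\<integral>x. exp (- (l * \<bar>x\<bar>)) * sgn (cos (pi * x)) \<partial>lborel) - (\<integral>x. lam_diff l x * sgn (cos (pi * x)) \<partial>lborel)) = 0"
    unfolding K0 by (rule sym)
  then have "(\<integral>x. exp (- (l * \<bar>x\<bar>)) * sgn (cos (pi * x)) \<partial>lborel) - (\<integral>x. lam_diff l x * sgn (cos (pi * x)) \<partial>lborel) = 0"
    by (simp only: of_real_eq_0_iff)
  then have "(\<integral>x. lam_diff l x * sgn (cos (pi * x)) \<partial>lborel) = 2 / l - 2 / l / cosh (l / 2)"
    unfolding integral_exp_abs_sgn_cos[OF assms] by linarith
  moreover have "(\<integral>x. \<bar>lam_diff l x\<bar> \<partial>lborel) = (\<integral>x. lam_diff l x * sgn (cos (pi * x)) \<partial>lborel)"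
  proof (rule integral_cong_AE)
    show "AE x in lborel. \<bar>lam_diff l x\<bar> = lam_diff l x * sgn (cos (pi * x))"
      using AE_nonzero_real by eventually_elim (simp add: lam_diff_sign(1)[OF assms])
  qed (use i2 lam_diff_integrable[OF assms] in auto)
  ultimately show ?thesis by simp
qed

text \<open>Rewrites the transform through \<open>lam_diff\<close>, which will be integrable jointly
  in l and x, so that it can be integrated over the measure by Fubini.\<close>

lemma Khat_eq:
  assumes "l > 0"
  shows "Khat l t = of_real (2 * l / (l\<^sup>2 + 4 * pi\<^sup>2 * t\<^sup>2)) - (\<integral>x. of_real (lam_diff l x) * e2pi (- of_real (t * x)) \<partial>lborel)"
proof -
  have i: "integrable lborel (\<lambda>x. complex_of_real (f x) * e2pi (- of_real (t * x)))" if f: "integrable lborel f" for f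
  proof (rule Bochner_Integration.integrable_bound[OF f])
    show "AE x in lborel. norm (complex_of_real (f x) * e2pi (- of_real (t * x))) \<le> norm (f x)"
      by (intro AE_I2) (simp only: norm_mult norm_e2pi_of_real norm_of_real, simp)
  qed (use f in measurable)
  show ?thesis
    unfolding Khat_def K_lam_eq_exp_minus_lam_diff[OF assms] of_real_diff left_diff_distrib
    by (subst Bochner_Integration.integral_diff) (intro i integrable_exp_abs lam_diff_integrable assms | simp only: fourier_exp_abs[OF assms])+
qed

text \<open>The factor 1 - sech(l/2) is at most 1, which serves for l > 1, and at most (l/2)^2 for l
  \<le> 1, where cosh(l/2) \<le> 1 + (l/2)^2.\<close>

lemma sech_weight_le:
  assumes "l > 0"
  shows "0 \<le> 2 / l - 2 / l / cosh (l / 2)" "2 / l - 2 / l / cosh (l / 2) \<le> 4 * lam_weight l"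
proof -
  have c: "cosh (l / 2) \<ge> 1" by (rule cosh_real_ge_1)
  have eq: "2 / l - 2 / l / cosh (l / 2) = 2 / l * (1 - 1 / cosh (l / 2))" by (simp add: right_diff_distrib)
  have r: "0 \<le> 1 - 1 / cosh (l / 2)" "1 - 1 / cosh (l / 2) \<le> 1" using c by (auto simp: field_simps)
  show "0 \<le> 2 / l - 2 / l / cosh (l / 2)" unfolding eq using assms r by (intro mult_nonneg_nonneg) auto
  have w: "l\<^sup>2 + 1 > 0" by (simp add: add_nonneg_pos)
  show "2 / l - 2 / l / cosh (l / 2) \<le> 4 * lam_weight l"
  proof (cases "l \<le> 1")
    case False
    have "2 / l * (1 - 1 / cosh (l / 2)) \<le> 2 / l * 1" using assms r by (intro mult_left_mono) auto
    also have "\<dots> \<le> 4 * lam_weight l"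
    proof -
      have "1 \<le> l\<^sup>2" using False by (simp add: power2_eq_square) (metis less_eq_real_def mult_mono' mult_1 not_le zero_le_one)
      then show ?thesis using assms w unfolding lam_weight_def by (simp add: field_simps power2_eq_square)
    qed
    finally show ?thesis unfolding eq .
  next
    case True
    have l2: "l / 2 \<ge> 0" "l / 2 \<le> 1" using assms True by auto
    have "exp (l / 2) \<le> 1 + l / 2 + (l / 2)\<^sup>2" using l2 by (rule exp_bound)
    \<comment> \<open>With y = l/2 this follows from exp(y) \<ge> 1 + y and (1 - y + y^2)(1 + y) = 1
      + y^3 \<ge> 1.\<close>
    moreover have "exp (- (l / 2)) \<le> 1 - l / 2 + (l / 2)\<^sup>2"
    proof -
      have "exp (- (l / 2)) * (1 + l / 2) \<le> exp (- (l / 2)) * exp (l / 2)"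
        by (intro mult_left_mono) auto
      also have "\<dots> = 1" by (simp add: exp_add[symmetric])
      also have "1 \<le> (1 - l / 2 + (l / 2)\<^sup>2) * (1 + l / 2)"
      proof -
        have "(1 - l / 2 + (l / 2)\<^sup>2) * (1 + l / 2) = 1 + (l / 2) ^ 3"
          by (simp add: power2_eq_square power3_eq_cube algebra_simps)
        then show ?thesis using assms by simp
      qed
      finally show ?thesis using assms by (simp add: mult_le_cancel_right)
    qed
    ultimately have "cosh (l / 2) \<le> 1 + (l / 2)\<^sup>2" by (simp add: cosh_def)
    moreover have "1 - 1 / cosh (l / 2) \<le> cosh (l / 2) - 1"
    proof -
      have "1 - 1 / cosh (l / 2) = (cosh (l / 2) - 1) / cosh (l / 2)" using c by (simp add: diff_divide_distrib)
      also have "\<dots> \<le> (cosh (l / 2) - 1) / 1" using c by (intro divide_left_mono) auto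
      finally show ?thesis by simp
    qed
    ultimately have "2 / l * (1 - 1 / cosh (l / 2)) \<le> 2 / l * (l / 2)\<^sup>2"
      using assms by (intro mult_left_mono) auto
    also have "\<dots> = l / 2" using assms by (simp add: power2_eq_square)
    also have "\<dots> \<le> 4 * lam_weight l"
    proof -
      have "l\<^sup>2 \<le> 1" using assms True by (simp add: power_le_one)
      then have "l * (l\<^sup>2 + 1) \<le> l * 8" using assms by (intro mult_left_mono) auto
      then show ?thesis using w by (simp add: lam_weight_def field_simps)
    qed
    finally show ?thesis unfolding eq .
  qed
qed

section \<open>Integration over the parameter\<close>

lemma enn2ereal_finite: "x < \<infinity> \<Longrightarrow> enn2ereal x = ereal (enn2real x)"
  by (cases x) auto

lemma ext_int_integrable:
  assumes "integrable M g"
  shows "ext_int M g = ereal (\<integral>l. g l \<partial>M)"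
proof -
  have "(\<integral>\<^sup>+ l. ennreal (g l) \<partial>M) < \<infinity>" "(\<integral>\<^sup>+ l. ennreal (- g l) \<partial>M) < \<infinity>"
    using real_integrable_def[of M g] assms by (auto simp: less_top)
  then show ?thesis
    unfolding ext_int_def by (simp add: enn2ereal_finite real_lebesgue_integral_def[OF assms])
qed

text \<open>Needed at x = 0, where 1 - exp(-l) may have infinite integral: subtracting an integrable
  function keeps the positive part infinite and the negative part finite.\<close>

lemma ext_int_diff_integrable:
  assumes g[measurable]: "g \<in> borel_measurable M" and g0: "\<And>l. l \<in> space M \<Longrightarrow> g l \<ge> 0" and k: "integrable M k"
  shows "ext_int M (\<lambda>l. g l - k l) = ext_int M g - ereal (\<integral>l. k l \<partial>M)"
proof (cases "integrable M g")
  case True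
  then show ?thesis using k by (simp add: ext_int_integrable)
next
  case False
  have [measurable]: "k \<in> borel_measurable M" using k by auto
  have K: "(\<integral>\<^sup>+ l. ennreal \<bar>k l\<bar> \<partial>M) < \<infinity>" using k by (simp add: integrable_iff_bounded)
  have G: "(\<integral>\<^sup>+ l. ennreal (g l) \<partial>M) = \<infinity>"
  proof (rule ccontr)
    assume "\<not> ?thesis"
    then have "(\<integral>\<^sup>+ l. ennreal (g l) \<partial>M) < \<infinity>" by (simp add: less_top)
    then have "integrable M g" using g0 by (intro integrableI_nonneg) auto
    then show False using False by simp
  qed
  have g_neg: "(\<integral>\<^sup>+ l. ennreal (- g l) \<partial>M) = 0"
    using g0 by (subst nn_integral_0_iff_AE) (auto simp: ennreal_neg)
  have P: "(\<integral>\<^sup>+ l. ennreal (g l - k l) \<partial>M) = \<infinity>"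
  proof (rule ccontr)
    assume "\<not> ?thesis"
    then have "(\<integral>\<^sup>+ l. ennreal (g l - k l) \<partial>M) + (\<integral>\<^sup>+ l. ennreal \<bar>k l\<bar> \<partial>M) < \<infinity>"
      using K by (simp add: less_top)
    moreover have "(\<integral>\<^sup>+ l. ennreal (g l) \<partial>M) \<le> (\<integral>\<^sup>+ l. ennreal (g l - k l) + ennreal \<bar>k l\<bar> \<partial>M)"
    proof (rule nn_integral_mono)
      fix l
      have "ennreal (g l) \<le> ennreal (max 0 (g l - k l) + \<bar>k l\<bar>)" by (intro ennreal_leI) auto
      also have "\<dots> = ennreal (g l - k l) + ennreal \<bar>k l\<bar>" by (simp add: ennreal_plus[symmetric] ennreal_max_0)
      finally show "ennreal (g l) \<le> ennreal (g l - k l) + ennreal \<bar>k l\<bar>" .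
    qed
    then have "(\<integral>\<^sup>+ l. ennreal (g l) \<partial>M) \<le> (\<integral>\<^sup>+ l. ennreal (g l - k l) \<partial>M) + (\<integral>\<^sup>+ l. ennreal \<bar>k l\<bar> \<partial>M)"
      by (simp add: nn_integral_add)
    ultimately have "(\<integral>\<^sup>+ l. ennreal (g l) \<partial>M) < \<infinity>" by (rule order_le_less_trans[rotated])
    then show False using G by simp
  qed
  have "(\<integral>\<^sup>+ l. ennreal (- (g l - k l)) \<partial>M) \<le> (\<integral>\<^sup>+ l. ennreal \<bar>k l\<bar> \<partial>M)"
    using g0 by (intro nn_integral_mono ennreal_leI) (auto simp: abs_if algebra_simps intro: order_trans[OF _ g0])
  then have Nf: "(\<integral>\<^sup>+ l. ennreal (- (g l - k l)) \<partial>M) < \<infinity>" using K by (rule order_le_less_trans)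
  have "ext_int M (\<lambda>l. g l - k l) = \<infinity>"
    unfolding ext_int_def P enn2ereal_finite[OF Nf] by simp
  moreover have "ext_int M g = \<infinity>" unfolding ext_int_def G g_neg by simp
  ultimately show ?thesis by simp
qed

lemma exp_type_le_diff:
  assumes "exp_type_le F \<sigma>" "exp_type_le G \<sigma>"
  shows "exp_type_le (\<lambda>z. F z - G z) \<sigma>"
  unfolding exp_type_le_def
proof (intro allI impI)
  fix \<epsilon> :: real assume e: "\<epsilon> > 0"
  obtain C D where C: "\<And>z. norm (F z) \<le> C * exp ((\<sigma> + \<epsilon>) * norm z)" and D: "\<And>z. norm (G z) \<le> D * exp ((\<sigma> + \<epsilon>) * norm z)"
    using assms e unfolding exp_type_le_def by metis
  have "norm (F z - G z) \<le> (C + D) * exp ((\<sigma> + \<epsilon>) * norm z)" for z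
    using norm_triangle_ineq4[of "F z" "G z"] C[of z] D[of z] by (simp add: distrib_right)
  then show "\<exists>C. \<forall>z. norm (F z - G z) \<le> C * exp ((\<sigma> + \<epsilon>) * norm z)" by blast
qed

lemma AE_lborel_obtain_in_interval:
  assumes "AE x in lborel. P x" "a < (b::real)"
  obtains x where "a < x" "x < b" "P x"
proof (rule ccontr)
  assume no: "\<not> thesis"
  have "AE x in lborel. x \<notin> {a<..<b}"
    using assms(1)
  proof eventually_elim
    case (elim x)
    then show ?case using no that by auto
  qed
  then have "{a<..<b} \<in> null_sets lborel" by (subst AE_iff_null_sets) auto
  then have "emeasure lborel {a<..<b} = 0" by auto
  then show False using assms(2) by simp
qed

section \<open>Functions obtained by integrating over the measure\<close>

locale lam_measure =
  fixes M :: "real measure"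
  assumes sets_M: "sets M = sets (restrict_space borel {0<..})"
    and finite_weight: "(\<integral>\<^sup>+ l. ennreal (l / (l\<^sup>2 + 1)) \<partial>M) < \<infinity>"
begin

lemma space_M: "space M = {0<..}"
  using sets_eq_imp_space_eq[OF sets_M] by (simp add: space_restrict_space)

lemma measurable_ident_M [measurable]: "(\<lambda>l. l) \<in> borel_measurable M"
proof -
  have "(\<lambda>l. l) \<in> restrict_space borel {0<..} \<rightarrow>\<^sub>M (borel :: real measure)"
    by (rule measurable_restrict_space1) simp
  then show ?thesis using measurable_cong_sets[OF sets_M refl] by blast
qed

lemma weight_integrable: "integrable M lam_weight"
proof (rule integrableI_nonneg)
  show "lam_weight \<in> borel_measurable M" unfolding lam_weight_def[abs_def] by measurable
  show "(\<integral>\<^sup>+ x. ennreal (lam_weight x) \<partial>M) < \<infinity>" using finite_weight by (simp add: lam_weight_def)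
qed (auto simp: space_M)

lemma integrable_if_le_weight:
  fixes f :: "real \<Rightarrow> 'a :: {banach, second_countable_topology}"
  assumes "f \<in> borel_measurable M" "\<And>l. l > 0 \<Longrightarrow> norm (f l) \<le> C * lam_weight l"
  shows "integrable M f"
proof (rule Bochner_Integration.integrable_bound[OF integrable_mult_right[OF weight_integrable, of C] assms(1)])
  show "AE l in M. norm (f l) \<le> norm (C * lam_weight l)"
    using assms(2) by (intro AE_I2) (auto simp: space_M intro: order_trans[OF _ abs_ge_self])
qed

text \<open>Required for Fubini. The weight is positive on the whole space and integrable, so its
  superlevel sets have finite measure by Markov's inequality and exhaust the space.\<close>

sublocale sigma_finite_measure M
proof
  define A where "A = (\<lambda>n. {l \<in> space M. 1 \<le> of_nat (Suc n) * ennreal (lam_weight l)})"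
  have [measurable]: "lam_weight \<in> borel_measurable M" using weight_integrable by auto
  have sA: "A n \<in> sets M" for n unfolding A_def by measurable
  have fA: "emeasure M (A n) \<noteq> \<infinity>" for n
  proof -
    have "emeasure M (A n) \<le> of_nat (Suc n) * (\<integral>\<^sup>+ l. ennreal (lam_weight l) \<partial>M)"
    proof -
      have "emeasure M (A n) \<le> of_nat (Suc n) * (\<integral>\<^sup>+ l. ennreal (lam_weight l) * indicator (space M) l \<partial>M)"
        unfolding A_def by (rule nn_integral_Markov_inequality) measurable
      also have "(\<integral>\<^sup>+ l. ennreal (lam_weight l) * indicator (space M) l \<partial>M) = (\<integral>\<^sup>+ l. ennreal (lam_weight l) \<partial>M)"
        by (intro nn_integral_cong) simp
      finally show ?thesis .
    qed
    also have "\<dots> < \<infinity>" using finite_weight by (simp add: lam_weight_def ennreal_mult_less_top of_nat_less_top)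
    finally show ?thesis by simp
  qed
  have "\<Union> (range A) = space M"
  proof
    show "\<Union> (range A) \<subseteq> space M" by (auto simp: A_def)
    show "space M \<subseteq> \<Union> (range A)"
    proof
      fix l assume l: "l \<in> space M"
      then have w: "lam_weight l > 0" by (auto simp: space_M lam_weight_pos)
      obtain n where "1 / lam_weight l < real n" using reals_Archimedean2 by blast
      then have "1 \<le> real (Suc n) * lam_weight l" using w by (simp add: field_simps)
      then have "ennreal 1 \<le> ennreal (real (Suc n) * lam_weight l)" by (rule ennreal_leI)
      also have "\<dots> = of_nat (Suc n) * ennreal (lam_weight l)"
        by (subst ennreal_mult') (use w in \<open>auto simp: ennreal_of_nat_eq_real_of_nat\<close>)
      finally have "l \<in> A n" using l by (simp add: A_def)
      then show "l \<in> \<Union> (range A)" by blast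
    qed
  qed
  then show "\<exists>A. countable A \<and> A \<subseteq> sets M \<and> \<Union> A = space M \<and> (\<forall>a\<in>A. emeasure M a \<noteq> \<infinity>)"
    using sA fA by (intro exI[of _ "range A"]) auto
qed

sublocale P: pair_sigma_finite M lborel ..

text \<open>Agrees with \<open>f_mu\<close> for x \<noteq> 0. At 0 the integrand need not be
  integrable, and the Bochner integral then takes its default value 0.\<close>

definition f_real :: "real \<Rightarrow> real" where
  "f_real x = (\<integral>l. exp (- (l * \<bar>x\<bar>)) - exp (- l) \<partial>M)"

lemma f_integrable:
  assumes "x \<noteq> 0"
  shows "integrable M (\<lambda>l. exp (- (l * \<bar>x\<bar>)) - exp (- l))"
  by (rule integrable_if_le_weight) (use abs_exp_diff_le[of _ "\<bar>x\<bar>"] assms in \<open>measurable, simp\<close>)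

lemma f_mu_eq:
  assumes "x \<noteq> 0"
  shows "f_mu M x = ereal (f_real x)"
  using ext_int_integrable[OF f_integrable[OF assms]] by (simp add: f_mu_def f_real_def)

lemma f_real_half_le: "\<bar>f_real (half k)\<bar> \<le> (9 * (\<integral>l. lam_weight l \<partial>M)) * half k"
proof -
  have "\<bar>f_real (half k)\<bar> \<le> (\<integral>l. \<bar>exp (- (l * \<bar>half k\<bar>)) - exp (- l)\<bar> \<partial>M)"
    unfolding f_real_def using integral_norm_bound[of M "\<lambda>l. exp (- (l * \<bar>half k\<bar>)) - exp (- l)"] by simp
  also have "\<dots> \<le> (\<integral>l. 9 * half k * lam_weight l \<partial>M)"
  proof (rule integral_mono)
    show "integrable M (\<lambda>l. \<bar>exp (- (l * \<bar>half k\<bar>)) - exp (- l)\<bar>)"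
      by (intro integrable_abs f_integrable) simp
    show "\<bar>exp (- (l * \<bar>half k\<bar>)) - exp (- l)\<bar> \<le> 9 * half k * lam_weight l" if "l \<in> space M" for l
      using abs_exp_half_diff_le[of l k] that by (simp add: space_M mult_ac)
  qed (rule integrable_mult_right[OF weight_integrable])
  also have "\<dots> = (9 * (\<integral>l. lam_weight l \<partial>M)) * half k" by simp
  finally show ?thesis .
qed

lemma alternating_f_real_convergent:
  "\<exists>\<alpha>. (\<lambda>N. \<Sum>k\<le>N. (-1) ^ k * f_real (half k) / half k) \<longlonglongrightarrow> \<alpha>"
proof -
  define A where "A = (\<lambda>l. \<Sum>k. (-1) ^ k * (exp (- (l * half k)) / half k))"
  have i: "integrable M (\<lambda>l. exp (- (l * half k)) - exp (- l))" for k
    using f_integrable[of "half k"] by simp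
  have alt_meas: "(\<lambda>l. alt_sum N l) \<in> borel_measurable M" for N
    unfolding alt_sum_def by measurable
  have eq: "(\<Sum>k\<le>N. (-1) ^ k * f_real (half k) / half k) = (\<integral>l. alt_sum N l - exp (- l) * alt_sum N 0 \<partial>M)" for N
  proof -
    have "(\<Sum>k\<le>N. (-1) ^ k * f_real (half k) / half k) = (\<Sum>k\<le>N. (\<integral>l. (-1) ^ k / half k * (exp (- (l * half k)) - exp (- l)) \<partial>M))"
      by (simp add: f_real_def)
    also have "\<dots> = (\<integral>l. (\<Sum>k\<le>N. (-1) ^ k / half k * (exp (- (l * half k)) - exp (- l))) \<partial>M)"
      by (rule Bochner_Integration.integral_sum[symmetric]) (rule integrable_mult_right[OF i])
    also have "(\<lambda>l. \<Sum>k\<le>N. (-1) ^ k / half k * (exp (- (l * half k)) - exp (- l))) = (\<lambda>l. alt_sum N l - exp (- l) * alt_sum N 0)"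
      by (simp add: alt_sum_def right_diff_distrib sum_subtractf sum_distrib_left mult_ac)
    finally show ?thesis .
  qed
  have "(\<lambda>N. \<integral>l. alt_sum N l - exp (- l) * alt_sum N 0 \<partial>M) \<longlonglongrightarrow> (\<integral>l. A l - exp (- l) * A 0 \<partial>M)"
  proof (rule integral_dominated_convergence[where w = "\<lambda>l. 36 * lam_weight l"])
    have lim: "(\<lambda>N. alt_sum N l - exp (- l) * alt_sum N 0) \<longlonglongrightarrow> A l - exp (- l) * A 0" if "l > 0" for l
      unfolding A_def by (intro tendsto_intros alt_sum_convergent) (use that in auto)
    then show "AE l in M. (\<lambda>N. alt_sum N l - exp (- l) * alt_sum N 0) \<longlonglongrightarrow> A l - exp (- l) * A 0"
      by (intro AE_I2) (auto simp: space_M)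
    show "(\<lambda>l. alt_sum N l - exp (- l) * alt_sum N 0) \<in> borel_measurable M" for N
      using alt_meas by measurable
    then show "(\<lambda>l. A l - exp (- l) * A 0) \<in> borel_measurable M"
      by (rule borel_measurable_LIMSEQ_metric) (use lim in \<open>auto simp: space_M\<close>)
    show "integrable M (\<lambda>l. 36 * lam_weight l)" by (rule integrable_mult_right[OF weight_integrable])
    show "AE l in M. norm (alt_sum N l - exp (- l) * alt_sum N 0) \<le> 36 * lam_weight l" for N
      using alt_sum_weight_bound by (intro AE_I2) (auto simp: space_M)
  qed
  then show ?thesis unfolding eq by blast
qed

lemma K_partial_f_real: "K_partial M N z = (\<Sum>k\<le>N. of_real (f_real (half k)) * cardinal_term k z)"
  by (simp add: K_partial_eq f_mu_eq)

lemma K_mu_entire: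
  "\<And>R. uniform_limit (cball 0 R) (K_partial M) (K_mu M) sequentially"
  "K_mu M holomorphic_on UNIV" "exp_type_le (K_mu M) pi"
proof -
  obtain \<alpha> where \<alpha>: "(\<lambda>N. \<Sum>k\<le>N. (-1) ^ k * f_real (half k) / half k) \<longlonglongrightarrow> \<alpha>"
    using alternating_f_real_convergent by blast
  obtain G C where G: "G holomorphic_on UNIV"
    "\<And>R. uniform_limit (cball 0 R) (\<lambda>N z. \<Sum>k\<le>N. of_real (f_real (half k)) * cardinal_term k z) G sequentially"
    "\<And>z. norm (G z) \<le> C * (1 + norm z) ^ 3 * exp (pi * \<bar>Im z\<bar>)"
    by (rule cardinal_series[OF f_real_half_le \<alpha>]) (rule that; assumption)
  have G2: "uniform_limit (cball 0 R) (K_partial M) G sequentially" for R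
    using G(2)[of R] by (simp add: K_partial_f_real[abs_def])
  have "K_mu M z = G z" for z
    unfolding K_mu_def by (rule limI, rule tendsto_uniform_limitI[OF G2[of "norm z"]]) simp
  then have "K_mu M = G" by auto
  then show "\<And>R. uniform_limit (cball 0 R) (K_partial M) (K_mu M) sequentially"
    "K_mu M holomorphic_on UNIV" "exp_type_le (K_mu M) pi"
    using G2 G(1) exp_type_le_polynomial[OF G(3)] by auto
qed

lemma K_partial_tendsto: "(\<lambda>N. K_partial M N z) \<longlonglongrightarrow> K_mu M z"
  by (rule tendsto_uniform_limitI[OF K_mu_entire(1)[of "norm z"]]) simp

lemma K_mu_of_real: "K_mu M (of_real x) \<in> \<real>"
proof (rule Lim_in_closed_set[OF closed_complex_Reals _ _ K_partial_tendsto])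
  show "\<forall>\<^sub>F N in sequentially. K_partial M N (of_real x) \<in> \<real>"
    unfolding K_partial_f_real
    by (intro always_eventually allI sum_in_Reals Reals_mult cardinal_term_of_real) auto
qed auto

lemma cardinal_exp_sum_measurable: "(\<lambda>l. cardinal_exp_sum l N z) \<in> borel_measurable M"
  unfolding cardinal_exp_sum_def by measurable

lemma K_lam_diff_integrable: "integrable M (\<lambda>l. K_lam l z - of_real (exp (- l)))"
proof (rule integrable_if_le_weight)
  show "(\<lambda>l. K_lam l z - of_real (exp (- l))) \<in> borel_measurable M"
    by (rule borel_measurable_LIMSEQ_metric[OF cardinal_exp_sum_measurable[of _ z]])
       (auto simp: space_M intro: cardinal_exp_sum_tendsto)
qed (rule norm_K_lam_diff_le)

text \<open>Interpolation commutes with integration for each partial sum, and the limit passes under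
  the integral because the bound on \<open>cardinal_exp_sum\<close> is uniform in
  \<open>N\<close>.\<close>

lemma K_mu_eq_integral: "K_mu M z = (\<integral>l. K_lam l z - of_real (exp (- l)) \<partial>M)"
proof (rule LIMSEQ_unique[OF K_partial_tendsto])
  have "K_partial M N z = (\<integral>l. cardinal_exp_sum l N z \<partial>M)" for N
  proof -
    have i: "integrable M (\<lambda>l. exp (- (l * half k)) - exp (- l))" for k
      using f_integrable[of "half k"] by simp
    have "(\<integral>l. cardinal_exp_sum l N z \<partial>M) = (\<Sum>k\<le>N. \<integral>l. of_real (exp (- (l * half k)) - exp (- l)) * cardinal_term k z \<partial>M)"
      unfolding cardinal_exp_sum_def by (rule Bochner_Integration.integral_sum) (intro integrable_mult_left integrable_of_real i)
    also have "\<dots> = (\<Sum>k\<le>N. of_real (f_real (half k)) * cardinal_term k z)"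
      by (simp add: f_real_def integral_complex_of_real del: of_real_diff)
    finally show ?thesis by (simp add: K_partial_f_real)
  qed
  moreover have "(\<lambda>N. \<integral>l. cardinal_exp_sum l N z \<partial>M) \<longlonglongrightarrow> (\<integral>l. K_lam l z - of_real (exp (- l)) \<partial>M)"
  proof (rule integral_dominated_convergence[where w = "\<lambda>l. cardinal_bound z * lam_weight l"])
    show "AE l in M. (\<lambda>N. cardinal_exp_sum l N z) \<longlonglongrightarrow> K_lam l z - of_real (exp (- l))"
      by (intro AE_I2 cardinal_exp_sum_tendsto) (auto simp: space_M)
    show "AE l in M. norm (cardinal_exp_sum l N z) \<le> cardinal_bound z * lam_weight l" for N
      unfolding cardinal_bound_def by (intro AE_I2 norm_cardinal_exp_sum_le) (auto simp: space_M)
  qed (use K_lam_diff_integrable cardinal_exp_sum_measurable weight_integrable in auto)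
  ultimately show "(\<lambda>N. K_partial M N z) \<longlonglongrightarrow> (\<integral>l. K_lam l z - of_real (exp (- l)) \<partial>M)" by simp
qed

lemma Re_K_lam_diff_integrable: "integrable M (\<lambda>l. Re (K_lam l z) - exp (- l))"
  using integrable_Re[OF K_lam_diff_integrable[of z]] by simp

lemma Re_K_mu: "Re (K_mu M z) = (\<integral>l. Re (K_lam l z) - exp (- l) \<partial>M)"
  unfolding K_mu_eq_integral using integral_Re[OF K_lam_diff_integrable[of z]] by simp

lemma exp_minus_K_lam_integrable:
  assumes "x \<noteq> 0"
  shows "integrable M (\<lambda>l. of_real (exp (- l * \<bar>x\<bar>)) - K_lam l (of_real x))"
  using Bochner_Integration.integrable_diff[OF integrable_of_real[OF f_integrable[OF assms]] K_lam_diff_integrable[of "of_real x"]]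
  by simp

lemma f_mu_minus_K_mu_eq: "f_mu M x - ereal (Re (K_mu M (of_real x))) = ext_int M (\<lambda>l. exp (- l * \<bar>x\<bar>) - Re (K_lam l (of_real x)))"
proof -
  define k where "k = (\<lambda>l. Re (K_lam l (of_real x)) - exp (- l))"
  define g where "g = (\<lambda>l. exp (- l * \<bar>x\<bar>) - exp (- l))"
  have k: "integrable M k" unfolding k_def by (rule Re_K_lam_diff_integrable)
  have kint: "(\<integral>l. k l \<partial>M) = Re (K_mu M (of_real x))" unfolding k_def Re_K_mu ..
  have [measurable]: "g \<in> borel_measurable M" unfolding g_def by measurable
  have "ext_int M (\<lambda>l. g l - k l) = ext_int M g - ereal (\<integral>l. k l \<partial>M)"
  \<comment> \<open>Only at x = 0 can \<open>g\<close> fail to be integrable, and there it equals 1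
    - exp(-l), which is nonnegative.\<close>
  proof (cases "x = 0")
    case True
    then show ?thesis by (intro ext_int_diff_integrable k) (auto simp: g_def space_M)
  next
    case False
    have "integrable M g" using f_integrable[OF False] by (simp add: g_def)
    then show ?thesis using k by (simp add: ext_int_integrable)
  qed
  moreover have "f_mu M x = ext_int M g" by (simp add: f_mu_def g_def)
  moreover have "(\<lambda>l. exp (- l * \<bar>x\<bar>) - Re (K_lam l (of_real x))) = (\<lambda>l. g l - k l)"
    by (simp add: g_def k_def)
  ultimately show ?thesis by (simp only: kint)
qed

lemma lam_diff_integrable_M:
  assumes "x \<noteq> 0"
  shows "integrable M (\<lambda>l. lam_diff l x)"
  using Bochner_Integration.integrable_diff[OF f_integrable[OF assms] Re_K_lam_diff_integrable[of "of_real x"]]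
  by (simp add: lam_diff_def)

lemma diffF_eq:
  assumes "x \<noteq> 0"
  shows "diffF M x = (\<integral>l. lam_diff l x \<partial>M)"
proof -
  have "diffF M x = (\<integral>l. exp (- (l * \<bar>x\<bar>)) - exp (- l) \<partial>M) - (\<integral>l. Re (K_lam l (of_real x)) - exp (- l) \<partial>M)"
    by (simp add: diffF_def f_mu_eq[OF assms] f_real_def Re_K_mu)
  also have "\<dots> = (\<integral>l. lam_diff l x \<partial>M)"
    by (subst Bochner_Integration.integral_diff[symmetric, OF f_integrable[OF assms] Re_K_lam_diff_integrable])
       (simp add: lam_diff_def)
  finally show ?thesis .
qed

lemma cardinal_term_measurable [measurable]: "(\<lambda>x::real. cardinal_term k (of_real x)) \<in> borel_measurable borel"
  by (rule borel_measurable_continuous_onI[OF continuous_on_of_real_entire[OF cardinal_term_holomorphic]])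

lemma lam_diff_measurable_pair: "(\<lambda>(l, x). lam_diff l x) \<in> borel_measurable (M \<Otimes>\<^sub>M lborel)"
proof -
  define f where "f = (\<lambda>N p. exp (- (fst p * \<bar>snd p\<bar>)) - Re (\<Sum>k\<le>N. of_real (exp (- (fst p * half k))) * cardinal_term k (of_real (snd p))))"
  have "(\<lambda>p. lam_diff (fst p) (snd p)) \<in> borel_measurable (M \<Otimes>\<^sub>M lborel)"
  proof (rule borel_measurable_LIMSEQ_metric)
    show "f N \<in> borel_measurable (M \<Otimes>\<^sub>M lborel)" for N
      unfolding f_def by measurable
    show "(\<lambda>N. f N p) \<longlonglongrightarrow> lam_diff (fst p) (snd p)" if "p \<in> space (M \<Otimes>\<^sub>M lborel)" for p
    proof -
      have "fst p > 0" using that by (auto simp: space_pair_measure space_M)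
      then show ?thesis unfolding f_def lam_diff_def by (intro tendsto_diff tendsto_Re K_lam_tendsto tendsto_const)
    qed
  qed
  then show ?thesis by (simp add: case_prod_unfold)
qed

lemma sech_weight_integrable: "integrable M (\<lambda>l. 2 / l - 2 / l / cosh (l / 2))"
proof (rule integrable_if_le_weight)
  show "norm (2 / l - 2 / l / cosh (l / 2)) \<le> 4 * lam_weight l" if "l > 0" for l
    using sech_weight_le[OF that] by simp
  have [measurable]: "cosh \<in> borel_measurable (borel :: real measure)"
    by (intro borel_measurable_continuous_onI continuous_intros)
  show "(\<lambda>l. 2 / l - 2 / l / cosh (l / 2)) \<in> borel_measurable M" by measurable
qed

text \<open>The inner integral of the absolute value is known exactly, and the resulting sech weight
  is integrable over the measure.\<close>

lemma lam_diff_integrable_pair: "integrable (M \<Otimes>\<^sub>M lborel) (\<lambda>(l, x). lam_diff l x)"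
proof (rule P.Fubini_integrable[OF lam_diff_measurable_pair])
  have "integrable M (\<lambda>l. \<integral>x. \<bar>lam_diff l x\<bar> \<partial>lborel) \<longleftrightarrow> integrable M (\<lambda>l. 2 / l - 2 / l / cosh (l / 2))"
    by (rule Bochner_Integration.integrable_cong) (auto simp: space_M integral_abs_lam_diff)
  then show "integrable M (\<lambda>l. \<integral>x. norm (case (l, x) of (l, x) \<Rightarrow> lam_diff l x) \<partial>lborel)"
    using sech_weight_integrable by simp
  show "AE l in M. integrable lborel (\<lambda>x. case (l, x) of (l, x) \<Rightarrow> lam_diff l x)"
    by (intro AE_I2) (simp add: space_M lam_diff_integrable)
qed

lemma AE_diffF_eq: "AE x in lborel. diffF M x = (\<integral>l. lam_diff l x \<partial>M)"
  using AE_nonzero_real by eventually_elim (rule diffF_eq)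

lemma diffF_measurable [measurable]: "diffF M \<in> borel_measurable borel"
proof -
  have [measurable]: "(\<lambda>x. \<integral>l. lam_diff l x \<partial>M) \<in> borel_measurable borel"
    using P.integrable_snd[OF lam_diff_integrable_pair] by auto
  have "diffF M = (\<lambda>x. if x = 0 then diffF M 0 else \<integral>l. lam_diff l x \<partial>M)"
    by (auto simp: diffF_eq)
  also have "\<dots> \<in> borel_measurable borel" by measurable
  finally show ?thesis .
qed

lemma diffF_integrable: "integrable lborel (diffF M)"
  by (rule integrable_cong_AE_imp[OF P.integrable_snd[OF lam_diff_integrable_pair]])
     (use AE_diffF_eq in auto)

text \<open>The sign of \<open>lam_diff l x\<close> is the same for all l, so integrating over the
  measure causes no cancellation and the absolute value may be moved inside the integral.\<close>

lemma AE_diffF_sgn: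
  "AE x in lborel. diffF M x * sgn (cos (pi * x)) = \<bar>diffF M x\<bar>"
  "AE x in lborel. \<bar>diffF M x\<bar> = (\<integral>l. \<bar>lam_diff l x\<bar> \<partial>M)"
proof -
  have *: "AE x in lborel. diffF M x * sgn (cos (pi * x)) = \<bar>diffF M x\<bar> \<and> \<bar>diffF M x\<bar> = (\<integral>l. \<bar>lam_diff l x\<bar> \<partial>M)"
    using AE_nonzero_real AE_cos_pi_nonzero
  proof eventually_elim
    case (elim x)
    have "diffF M x * sgn (cos (pi * x)) = (\<integral>l. lam_diff l x * sgn (cos (pi * x)) \<partial>M)"
      by (simp add: diffF_eq elim)
    also have "\<dots> = (\<integral>l. \<bar>lam_diff l x\<bar> \<partial>M)"
      by (rule Bochner_Integration.integral_cong) (auto simp: space_M lam_diff_sign(1) elim)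
    finally have 1: "diffF M x * sgn (cos (pi * x)) = (\<integral>l. \<bar>lam_diff l x\<bar> \<partial>M)" .
    have "0 \<le> (\<integral>l. \<bar>lam_diff l x\<bar> \<partial>M)" by simp
    then have "0 \<le> diffF M x * sgn (cos (pi * x))" using 1 by simp
    then have "diffF M x * sgn (cos (pi * x)) = \<bar>diffF M x * sgn (cos (pi * x))\<bar>" by simp
    also have "\<dots> = \<bar>diffF M x\<bar>" using elim by (simp add: abs_mult)
    finally show ?case using 1 by simp
  qed
  then show "AE x in lborel. diffF M x * sgn (cos (pi * x)) = \<bar>diffF M x\<bar>"
    "AE x in lborel. \<bar>diffF M x\<bar> = (\<integral>l. \<bar>lam_diff l x\<bar> \<partial>M)" by auto
qed

lemma integral_abs_diffF: "(\<integral>x. \<bar>diffF M x\<bar> \<partial>lborel) = (\<integral>l. 2 / l - 2 / l / cosh (l / 2) \<partial>M)"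
proof -
  have i: "integrable (M \<Otimes>\<^sub>M lborel) (\<lambda>(l, x). \<bar>lam_diff l x\<bar>)"
    using integrable_abs[OF lam_diff_integrable_pair] by (simp add: case_prod_unfold)
  have "(\<integral>x. \<bar>diffF M x\<bar> \<partial>lborel) = (\<integral>x. (\<integral>l. \<bar>lam_diff l x\<bar> \<partial>M) \<partial>lborel)"
    by (rule integral_cong_AE) (use AE_diffF_sgn(2) P.integrable_snd[OF i] in auto)
  also have "\<dots> = (\<integral>l. (\<integral>x. \<bar>lam_diff l x\<bar> \<partial>lborel) \<partial>M)" by (rule P.Fubini_integral[OF i])
  also have "\<dots> = (\<integral>l. 2 / l - 2 / l / cosh (l / 2) \<partial>M)"
    by (rule Bochner_Integration.integral_cong) (auto simp: space_M integral_abs_lam_diff)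
  finally show ?thesis .
qed

lemma fourier_diffF:
  assumes "t \<noteq> 0"
  shows "(\<integral> x. of_real (diffF M x) * e2pi (- of_real (t * x)) \<partial>lborel)
     = of_real (\<integral> l. 2 * l / (l\<^sup>2 + 4 * pi\<^sup>2 * t\<^sup>2) \<partial>M) - (\<integral> l. Khat l t \<partial>M)"
proof -
  define e where "e = (\<lambda>x. e2pi (- of_real (t * x)))"
  define \<Phi> where "\<Phi> = (\<lambda>l. \<integral>x. of_real (lam_diff l x) * e x \<partial>lborel)"
  define w where "w = (\<lambda>l. 2 * l / (l\<^sup>2 + 4 * pi\<^sup>2 * t\<^sup>2))"
  have em [measurable]: "e \<in> borel_measurable borel" unfolding e_def by measurable
  have ne: "norm (e x) = 1" for x unfolding e_def by (rule norm_e2pi_of_real)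
  have i: "integrable (M \<Otimes>\<^sub>M lborel) (\<lambda>(l, x). of_real (lam_diff l x) * e x)"
  proof (rule Bochner_Integration.integrable_bound[OF lam_diff_integrable_pair])
    have [measurable]: "(\<lambda>p. lam_diff (fst p) (snd p)) \<in> borel_measurable (M \<Otimes>\<^sub>M lborel)"
      using lam_diff_measurable_pair by (simp add: case_prod_unfold)
    show "(\<lambda>(l, x). of_real (lam_diff l x) * e x) \<in> borel_measurable (M \<Otimes>\<^sub>M lborel)"
      unfolding case_prod_unfold by measurable
    show "AE p in M \<Otimes>\<^sub>M lborel. norm (case p of (l, x) \<Rightarrow> of_real (lam_diff l x) * e x) \<le> norm (case p of (l, x) \<Rightarrow> lam_diff l x)"
      by (intro AE_I2) (auto simp: norm_mult ne)
  qed
  have \<Phi>i: "integrable M \<Phi>" unfolding \<Phi>_def by (rule P.integrable_fst[OF i])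
  \<comment> \<open>Here t \<noteq> 0 matters: it keeps the denominator away from 0, so that the
    quotient is O(l) for small l.\<close>
  have wi: "integrable M w"
  proof (rule integrable_if_le_weight)
    show "w \<in> borel_measurable M" unfolding w_def by measurable
    define c where "c = 4 * pi\<^sup>2 * t\<^sup>2"
    have c: "c > 0" using assms by (simp add: c_def)
    fix l :: real assume l: "l > 0"
    have p: "l\<^sup>2 + 1 > 0" "l\<^sup>2 + c > 0" using c by (auto intro: add_nonneg_pos)
    have "l\<^sup>2 + 1 \<le> (1 + 1 / c) * (l\<^sup>2 + c)" using c by (simp add: field_simps)
    then have "1 / (l\<^sup>2 + c) \<le> (1 + 1 / c) / (l\<^sup>2 + 1)"
      by (simp only: pos_divide_le_eq[OF p(2)] times_divide_eq_left pos_le_divide_eq[OF p(1)] mult_1_left)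
    then have "2 * l * (1 / (l\<^sup>2 + c)) \<le> 2 * l * ((1 + 1 / c) / (l\<^sup>2 + 1))"
      using l by (intro mult_left_mono) auto
    then have "2 * l / (l\<^sup>2 + c) \<le> 2 * (1 + 1 / c) * (l / (l\<^sup>2 + 1))"
      by (simp add: mult_ac)
    then show "norm (w l) \<le> 2 * (1 + 1 / c) * lam_weight l"
      using l p by (simp add: w_def c_def[symmetric] lam_weight_def)
  qed
  have Kh: "Khat l t = of_real (w l) - \<Phi> l" if "l > 0" for l
    using Khat_eq[OF that, of t] by (simp add: w_def \<Phi>_def e_def)
  have "(\<integral>x. of_real (diffF M x) * e x \<partial>lborel) = (\<integral>x. (\<integral>l. of_real (lam_diff l x) * e x \<partial>M) \<partial>lborel)"
  proof (rule integral_cong_AE)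
    show "AE x in lborel. of_real (diffF M x) * e x = (\<integral>l. of_real (lam_diff l x) * e x \<partial>M)"
      using AE_nonzero_real
    proof eventually_elim
      case (elim x)
      have "(\<integral>l. of_real (lam_diff l x) * e x \<partial>M) = (\<integral>l. of_real (lam_diff l x) \<partial>M) * e x"
        by (rule Bochner_Integration.integral_mult_left) (intro integrable_of_real lam_diff_integrable_M elim)
      then show ?case by (simp add: diffF_eq elim integral_complex_of_real)
    qed
    show "(\<lambda>x. \<integral>l. of_real (lam_diff l x) * e x \<partial>M) \<in> borel_measurable lborel"
      using P.integrable_snd[OF i] by auto
    have "complex_of_real \<in> borel_measurable borel" by measurable
    from measurable_compose[OF borel_measurable_integrable[OF diffF_integrable] this]
    show "(\<lambda>x. of_real (diffF M x) * e x) \<in> borel_measurable lborel"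
      by (rule borel_measurable_times) (use em in simp)
  qed
  also have "\<dots> = (\<integral>l. \<Phi> l \<partial>M)" unfolding \<Phi>_def by (rule P.Fubini_integral[OF i])
  \<comment> \<open>Written as w - (w - \<Phi>) because w - \<Phi> is \<open>Khat\<close>, and
    \<open>w\<close> and \<open>\<Phi>\<close> are separately integrable.\<close>
  also have "\<dots> = (\<integral>l. of_real (w l) \<partial>M) - (\<integral>l. of_real (w l) - \<Phi> l \<partial>M)"
    by (subst Bochner_Integration.integral_diff[OF integrable_of_real[OF wi] \<Phi>i]) simp
  also have "(\<integral>l. of_real (w l) - \<Phi> l \<partial>M) = (\<integral>l. Khat l t \<partial>M)"
    by (rule Bochner_Integration.integral_cong) (auto simp: space_M Kh)
  finally show ?thesis by (simp add: e_def w_def integral_complex_of_real del: of_real_divide)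
qed

section \<open>Extremality and the case of equality\<close>

lemma f_real_tendsto:
  assumes "a \<noteq> 0" and X: "X \<longlonglongrightarrow> a" and near: "\<And>n. \<bar>X n - a\<bar> \<le> \<bar>a\<bar> / 2"
  shows "(\<lambda>n. f_real (X n)) \<longlonglongrightarrow> f_real a"
  unfolding f_real_def
proof (rule integral_dominated_convergence)
  \<comment> \<open>The points \<open>X n\<close> stay between |a|/2 and 2|a| in modulus, so the
    constant of \<open>abs_exp_diff_le\<close> can be chosen independently of n.\<close>
  define m where "m = min (\<bar>a\<bar> / 2) 1"
  have m: "m > 0" using assms by (simp add: m_def)
  define C where "C = (1 + 2 / m\<^sup>2) * (2 * \<bar>a\<bar> + 1)"
  show "integrable M (\<lambda>l. C * lam_weight l)" by (rule integrable_mult_right[OF weight_integrable])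
  show "AE l in M. norm (exp (- (l * \<bar>X n\<bar>)) - exp (- l)) \<le> C * lam_weight l" for n
  proof (intro AE_I2)
    fix l assume "l \<in> space M"
    then have l: "l > 0" by (simp add: space_M)
    have x: "\<bar>a\<bar> / 2 \<le> \<bar>X n\<bar>" "\<bar>X n\<bar> \<le> 2 * \<bar>a\<bar>" using near[of n] by linarith+
    then have x0: "\<bar>X n\<bar> > 0" using assms by linarith
    have "m\<^sup>2 \<le> (min \<bar>X n\<bar> 1)\<^sup>2" using x m by (intro power_mono) (auto simp: m_def)
    then have "2 / (min \<bar>X n\<bar> 1)\<^sup>2 \<le> 2 / m\<^sup>2" using m x0 by (intro divide_left_mono) auto
    then have "(1 + 2 / (min \<bar>X n\<bar> 1)\<^sup>2) * \<bar>\<bar>X n\<bar> - 1\<bar> \<le> C"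
      unfolding C_def using x by (intro mult_mono) auto
    then have "(1 + 2 / (min \<bar>X n\<bar> 1)\<^sup>2) * \<bar>\<bar>X n\<bar> - 1\<bar> * lam_weight l \<le> C * lam_weight l"
      using l by (intro mult_right_mono) auto
    then show "norm (exp (- (l * \<bar>X n\<bar>)) - exp (- l)) \<le> C * lam_weight l"
      using abs_exp_diff_le[OF l x0] by simp
  qed
  show "AE l in M. (\<lambda>n. exp (- (l * \<bar>X n\<bar>)) - exp (- l)) \<longlonglongrightarrow> exp (- (l * \<bar>a\<bar>)) - exp (- l)"
    by (intro AE_I2 tendsto_intros X)
qed measurable

lemma f_real_eq_K_mu:
  assumes "cos (pi * a) = 0"
  shows "of_real (f_real a) = K_mu M (of_real a)" "a \<noteq> 0"
proof -
  show a0: "a \<noteq> 0" using assms by auto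
  have "diffF M a = 0" unfolding diffF_eq[OF a0]
    by (rule integral_eq_zero_AE) (auto intro!: AE_I2 simp: space_M lam_diff_eq_0 assms)
  then have "f_real a = Re (K_mu M (of_real a))" by (simp add: diffF_def f_mu_eq[OF a0])
  then show "of_real (f_real a) = K_mu M (of_real a)" using K_mu_of_real[of a] by (simp add: of_real_Re)
qed

text \<open>A function whose phase is that of \<open>cos (\<pi> x)\<close> almost everywhere has opposite phases on the two
  sides of a zero of the cosine.\<close>
lemma eq_0_if_phase_changes:
  fixes Kt :: "complex \<Rightarrow> complex"
  assumes Kt: "Kt holomorphic_on UNIV" and a: "cos (pi * a) = 0"
    and phase: "AE x in lborel. (of_real (f_real x) - Kt (of_real x)) * of_real (sgn (cos (pi * x))) = of_real (norm (of_real (f_real x) - Kt (of_real x)))"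
  shows "Kt (of_real a) = K_mu M (of_real a)"
proof -
  define h where "h = (\<lambda>x. of_real (f_real x) - Kt (of_real x))"
  have a0: "a \<noteq> 0" using f_real_eq_K_mu(2)[OF a] .
  have sin: "sin (pi * a) \<noteq> 0" using a sin_cos_squared_add[of "pi * a"] by (auto simp del: sin_cos_squared_add sin_cos_squared_add2)
  have side: "h a * of_real (- s * sgn (sin (pi * a))) = of_real (norm (h a))" if s: "s = 1 \<or> s = - 1" for s
  proof -
    \<comment> \<open>The first entry forces convergence to \<open>a\<close>, 1/2 keeps the points
      closer to \<open>a\<close> than the next zero of the cosine, and |a|/2 keeps them away from 0,
      where \<open>f_real\<close> is not controlled.\<close>
    define \<delta> where "\<delta> = (\<lambda>n. min (1 / real (Suc n)) (min (1 / 2) (\<bar>a\<bar> / 2)))"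
    have \<delta>: "\<delta> n > 0" "\<delta> n \<le> 1 / real (Suc n)" "\<delta> n \<le> 1 / 2" "\<delta> n \<le> \<bar>a\<bar> / 2" for n
      using a0 by (auto simp: \<delta>_def)
    have "\<exists>x. 0 < s * (x - a) \<and> s * (x - a) < \<delta> n \<and> h x * of_real (sgn (cos (pi * x))) = of_real (norm (h x))" for n
    proof (cases "s = 1")
      case True
      obtain x where "a < x" "x < a + \<delta> n" "h x * of_real (sgn (cos (pi * x))) = of_real (norm (h x))"
        using AE_lborel_obtain_in_interval[OF phase, of a "a + \<delta> n"] \<delta>(1)[of n] unfolding h_def by auto
      then show ?thesis using True by (intro exI[of _ x]) auto
    next
      case False
      obtain x where "a - \<delta> n < x" "x < a" "h x * of_real (sgn (cos (pi * x))) = of_real (norm (h x))"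
        using AE_lborel_obtain_in_interval[OF phase, of "a - \<delta> n" a] \<delta>(1)[of n] unfolding h_def by auto
      then show ?thesis using False s by (intro exI[of _ x]) auto
    qed
    then obtain X where X: "\<And>n. 0 < s * (X n - a)" "\<And>n. s * (X n - a) < \<delta> n"
      "\<And>n. h (X n) * of_real (sgn (cos (pi * X n))) = of_real (norm (h (X n)))" by metis
    have dist: "\<bar>X n - a\<bar> < \<delta> n" for n using X(1)[of n] X(2)[of n] s by auto
    have sg: "sgn (cos (pi * X n)) = - s * sgn (sin (pi * a))" for n
    proof -
      define u where "u = s * (X n - a)"
      have u: "0 < u" "u \<le> 1 / 2" using X(1,2)[of n] \<delta>(3)[of n] by (auto simp: u_def)
      have "X n = a + s * u" using s by (auto simp: u_def)
      then have "cos (pi * X n) = - sin (pi * a) * sin (s * (pi * u))"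
        by (simp add: distrib_left cos_add a mult_ac)
      moreover have "sin (s * (pi * u)) = s * sin (pi * u)" using s by auto
      moreover have "sin (pi * u) > 0" using u by (intro sin_gt_zero) (auto simp: mult_less_cancel_left1 intro: order_le_less_trans)
      ultimately show ?thesis using s by (auto simp: sgn_mult)
    qed
    have lim: "X \<longlonglongrightarrow> a"
    proof (rule LIM_zero_cancel, rule Lim_null_comparison)
      show "\<forall>\<^sub>F n in sequentially. norm (X n - a) \<le> inverse (real (Suc n))"
        using dist \<delta>(2) by (intro always_eventually allI) (auto simp: inverse_eq_divide intro: less_imp_le order_less_le_trans)
      show "(\<lambda>n. inverse (real (Suc n))) \<longlonglongrightarrow> 0" by (rule LIMSEQ_inverse_real_of_nat)
    qed
    have "(\<lambda>n. f_real (X n)) \<longlonglongrightarrow> f_real a"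
    proof (rule f_real_tendsto[OF a0 lim])
      show "\<bar>X n - a\<bar> \<le> \<bar>a\<bar> / 2" for n using dist[of n] \<delta>(4)[of n] by linarith
    qed
    moreover have "(\<lambda>n. Kt (of_real (X n))) \<longlonglongrightarrow> Kt (of_real a)"
    proof (rule isCont_tendsto_compose[where g = Kt])
      show "isCont Kt (of_real a)"
        using holomorphic_on_imp_continuous_on[OF Kt] by (simp add: continuous_on_eq_continuous_at)
    qed (intro tendsto_intros lim)
    ultimately have hl: "(\<lambda>n. h (X n)) \<longlonglongrightarrow> h a" unfolding h_def by (intro tendsto_intros)
    have "(\<lambda>n. h (X n) * of_real (- s * sgn (sin (pi * a)))) \<longlonglongrightarrow> h a * of_real (- s * sgn (sin (pi * a)))"
      by (intro tendsto_intros hl)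
    moreover have "h (X n) * of_real (- s * sgn (sin (pi * a))) = of_real (norm (h (X n)))" for n
      using X(3)[of n] unfolding sg .
    ultimately have "(\<lambda>n. complex_of_real (norm (h (X n)))) \<longlonglongrightarrow> h a * of_real (- s * sgn (sin (pi * a)))" by simp
    moreover have "(\<lambda>n. complex_of_real (norm (h (X n)))) \<longlonglongrightarrow> of_real (norm (h a))" by (intro tendsto_intros hl)
    ultimately show ?thesis by (rule LIMSEQ_unique)
  qed
  have "complex_of_real (norm (h a)) = - of_real (norm (h a))" using side[of 1] side[of "- 1"] by simp
  then have "h a = 0" by simp
  then show ?thesis by (simp add: h_def f_real_eq_K_mu(1)[OF a])
qed

text \<open>The distance function \<open>h\<close> is \<open>diffF\<close> plus an entire function
  \<open>F\<close> of type \<pi>. If \<open>h\<close> is integrable so is \<open>F\<close>, which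
  then drops out of the integral against sgn(cos(\<pi> x)), leaving \<open>I\<close>. The competitor
  may be complex on the real line, so real parts are compared with moduli.\<close>

lemma L1_distance_ge:
  assumes Kt: "Kt holomorphic_on UNIV" "exp_type_le Kt pi"
  defines "I \<equiv> (\<integral> l. 2 / l - 2 / l / cosh (l / 2) \<partial>M)"
  defines "N \<equiv> (\<integral>\<^sup>+ x. ennreal (norm (of_real (real_of_ereal (f_mu M x)) - Kt (of_real x))) \<partial>lborel)"
  shows "ennreal I \<le> N" "N = ennreal I \<longleftrightarrow> Kt = K_mu M"
proof -
  define h where "h = (\<lambda>x. of_real (real_of_ereal (f_mu M x)) - Kt (of_real x))"
  define F where "F = (\<lambda>z. K_mu M z - Kt z)"
  have F: "F holomorphic_on UNIV" "exp_type_le F pi"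
    unfolding F_def using Kt K_mu_entire by (auto intro!: holomorphic_intros exp_type_le_diff)
  have hF: "h x = of_real (diffF M x) + F (of_real x)" for x
    using K_mu_of_real[of x] by (simp add: h_def diffF_def F_def of_real_Re)
  have [measurable]: "(\<lambda>x::real. F (of_real x)) \<in> borel_measurable borel"
    by (rule borel_measurable_continuous_onI[OF continuous_on_of_real_entire[OF F(1)]])
  have hm [measurable]: "h \<in> borel_measurable borel" unfolding hF[abs_def] by measurable
  have I: "(\<integral>x. \<bar>diffF M x\<bar> \<partial>lborel) = I" unfolding I_def by (rule integral_abs_diffF)
  have N: "N = (\<integral>\<^sup>+ x. ennreal (norm (h x)) \<partial>lborel)" by (simp add: N_def h_def)
  have NI: "N = ennreal I" if "Kt = K_mu M"
  proof -
    have "norm (h x) = \<bar>diffF M x\<bar>" for x using that by (simp add: hF F_def)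
    then have "N = (\<integral>\<^sup>+ x. ennreal \<bar>diffF M x\<bar> \<partial>lborel)" by (simp add: N)
    also have "\<dots> = ennreal I"
      unfolding I[symmetric] by (rule nn_integral_eq_integral) (use diffF_integrable in auto)
    finally show ?thesis .
  qed
  have "ennreal I \<le> N \<and> (N = ennreal I \<longrightarrow> Kt = K_mu M)"
  proof (cases "N = \<infinity>")
    case True
    then show ?thesis by simp
  next
    case False
    then have "(\<integral>\<^sup>+ x. ennreal (norm (h x)) \<partial>lborel) < \<infinity>" by (simp add: N less_top)
    then have hi: "integrable lborel h" by (simp add: integrable_iff_bounded)
    have Nh: "N = ennreal (\<integral>x. norm (h x) \<partial>lborel)"
      unfolding N by (rule nn_integral_eq_integral) (use hi in auto)
    have "(\<lambda>x. F (of_real x)) = (\<lambda>x. h x - of_real (diffF M x))" by (simp add: hF)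
    then have Fi: "integrable lborel (\<lambda>x. F (of_real x))"
      using Bochner_Integration.integrable_diff[OF hi integrable_of_real[OF diffF_integrable]] by simp
    obtain C where C: "\<And>z. norm (F z) \<le> C * exp (pi * \<bar>Im z\<bar>)"
      using exp_type_le_integrable_bound[OF F pi_ge_zero Fi] by blast
    let ?s = "\<lambda>x. sgn (cos (pi * x))"
    have hsi: "integrable lborel (\<lambda>x. h x * of_real (?s x))" by (rule integrable_mult_sgn_cos[OF hi])
    have "(\<integral>x. h x * of_real (?s x) \<partial>lborel) = (\<integral>x. of_real (diffF M x) * of_real (?s x) + F (of_real x) * of_real (?s x) \<partial>lborel)"
      by (simp add: hF distrib_right)
    also have "\<dots> = (\<integral>x. of_real (diffF M x) * of_real (?s x) \<partial>lborel) + (\<integral>x. F (of_real x) * of_real (?s x) \<partial>lborel)"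
      by (rule Bochner_Integration.integral_add) (intro integrable_mult_sgn_cos integrable_of_real diffF_integrable Fi)+
    also have "(\<integral>x. F (of_real x) * of_real (?s x) \<partial>lborel) = 0"
      by (rule integral_sgn_cos_eq_0[OF F(1) Fi C])
    also have "(\<integral>x. complex_of_real (diffF M x) * of_real (?s x) \<partial>lborel) = (\<integral>x. complex_of_real \<bar>diffF M x\<bar> \<partial>lborel)"
      by (rule integral_cong_AE) (use AE_diffF_sgn(1) in \<open>auto simp flip: of_real_mult\<close>)
    also have "\<dots> = of_real I" unfolding I[symmetric] by (rule integral_complex_of_real)
    finally have hs: "(\<integral>x. h x * of_real (?s x) \<partial>lborel) = of_real I" by simp
    have Re_hs: "(\<integral>x. Re (h x * of_real (?s x)) \<partial>lborel) = I"
      using integral_Re[OF hsi] hs by simp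
    have le: "Re (h x * of_real (?s x)) \<le> norm (h x)" for x
    proof -
      have "Re (h x * of_real (?s x)) \<le> norm (h x * of_real (?s x))" by (rule complex_Re_le_cmod)
      also have "\<dots> \<le> norm (h x) * 1" unfolding norm_mult by (intro mult_left_mono) (auto simp: sgn_if)
      finally show ?thesis by simp
    qed
    have Re_i: "integrable lborel (\<lambda>x. Re (h x * of_real (?s x)))" by (rule integrable_Re[OF hsi])
    have "I \<le> (\<integral>x. norm (h x) \<partial>lborel)"
      unfolding Re_hs[symmetric] by (rule integral_mono[OF Re_i integrable_norm[OF hi] le])
    then have "ennreal I \<le> N" unfolding Nh by (rule ennreal_leI)
    moreover have "Kt = K_mu M" if "N = ennreal I"
    proof -
      have I0: "I \<ge> 0" unfolding I[symmetric] by simp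
      have "ennreal (\<integral>x. norm (h x) \<partial>lborel) = ennreal I" using that Nh by simp
      then have eq: "(\<integral>x. norm (h x) \<partial>lborel) = I" using I0 by (subst (asm) ennreal_inj) auto
      \<comment> \<open>The integrand is nonnegative, so equality of the integrals forces it to
        vanish almost everywhere; a complex number whose real part equals its modulus is real and
        nonnegative, which fixes the phase of \<open>h\<close>.\<close>
      have "(\<integral>x. norm (h x) - Re (h x * of_real (?s x)) \<partial>lborel) = 0"
        by (subst Bochner_Integration.integral_diff[OF integrable_norm[OF hi] Re_i]) (simp only: eq Re_hs diff_self)
      then have "AE x in lborel. norm (h x) - Re (h x * of_real (?s x)) = 0"
        by (subst (asm) integral_nonneg_eq_0_iff_AE)
           (use le in \<open>auto intro!: Bochner_Integration.integrable_diff integrable_norm hi Re_i simp del: times_complex.simps\<close>)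
      then have phase: "AE x in lborel. (of_real (f_real x) - Kt (of_real x)) * of_real (?s x) = of_real (norm (of_real (f_real x) - Kt (of_real x)))"
        using AE_nonzero_real AE_cos_pi_nonzero
      proof eventually_elim
        case (elim x)
        define y where "y = h x * of_real (?s x)"
        have "norm y = norm (h x)" using elim(3) by (simp add: y_def norm_mult)
        then have "Re y = norm y" using elim(1) by (simp add: y_def del: times_complex.simps)
        then have "y = of_real (norm y)" using cmod_power2[of y] by (simp add: complex_eq_iff)
        then show ?case using \<open>norm y = norm (h x)\<close> by (simp add: y_def h_def f_mu_eq[OF elim(2)])
      qed
      have zeros: "F z = 0" if z: "cos (of_real pi * z) = 0" for z
      proof -
        obtain n :: int where n: "z = of_real (of_int n + 1 / 2)" using z unfolding cos_pi_eq_0_iff_complex by blast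
        have "cos (pi * (of_int n + 1 / 2)) = 0"
          unfolding cos_zero_iff_int2 by (rule exI[of _ n]) (simp add: algebra_simps)
        from eq_0_if_phase_changes[OF Kt(1) this phase] show ?thesis by (simp only: F_def n diff_self)
      qed
      have "F z = 0" for z
        by (rule exp_type_pi_eq_0_if_zero_on_half_integers[OF F(1) Fi C zeros])
      then show ?thesis by (auto simp: F_def)
    qed
    ultimately show ?thesis by blast
  qed
  then show "ennreal I \<le> N" "N = ennreal I \<longleftrightarrow> Kt = K_mu M" using NI by auto
qed

end

text \<open>The L1 distance to a competitor is a nonnegative integral, so competitors at infinite
  distance are covered. Where \<open>f_mu\<close> is infinite, which can happen only at 0,
  \<open>real_of_ereal\<close> gives 0; this affects a null set.\<close>

theorem theorem1p2:
  fixes M :: "real measure"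
  assumes "sets M = sets (restrict_space borel {0<..})"
    and "(\<integral>\<^sup>+ l. ennreal (l / (l\<^sup>2 + 1)) \<partial>M) < \<infinity>"
  shows "(\<forall>C. compact C \<longrightarrow> uniform_limit C (K_partial M) (K_mu M) sequentially)
       \<and> K_mu M holomorphic_on UNIV
       \<and> (\<forall>x::real. K_mu M (of_real x) \<in> \<real>)
       \<and> exp_type_le (K_mu M) pi
       \<and> (\<forall>x::real. x \<noteq> 0 \<longrightarrow>
            integrable M (\<lambda>l. of_real (exp (- l * \<bar>x\<bar>)) - K_lam l (of_real x)))
       \<and> (\<forall>x::real. f_mu M x - ereal (Re (K_mu M (of_real x)))
            = ext_int M (\<lambda>l. exp (- l * \<bar>x\<bar>) - Re (K_lam l (of_real x))))
       \<and> integrable lborel (diffF M)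
       \<and> (\<integral> x. \<bar>diffF M x\<bar> \<partial>lborel) = (\<integral> l. 2 / l - 2 / l / cosh (l / 2) \<partial>M)
       \<and> (\<forall>t::real. t \<noteq> 0 \<longrightarrow>
            (\<integral> x. of_real (diffF M x) * e2pi (- of_real (t * x)) \<partial>lborel)
            = of_real (\<integral> l. 2 * l / (l\<^sup>2 + 4 * pi\<^sup>2 * t\<^sup>2) \<partial>M) - (\<integral> l. Khat l t \<partial>M))
       \<and> (\<forall>Kt. Kt holomorphic_on UNIV \<and> exp_type_le Kt pi \<longrightarrow>
            (\<integral>\<^sup>+ x. ennreal (norm (of_real (real_of_ereal (f_mu M x)) - Kt (of_real x))) \<partial>lborel)
              \<ge> ennreal (\<integral> l. 2 / l - 2 / l / cosh (l / 2) \<partial>M)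
            \<and> ((\<integral>\<^sup>+ x. ennreal (norm (of_real (real_of_ereal (f_mu M x)) - Kt (of_real x))) \<partial>lborel)
                 = ennreal (\<integral> l. 2 / l - 2 / l / cosh (l / 2) \<partial>M)
               \<longleftrightarrow> Kt = K_mu M))"
proof -
  interpret lam_measure M using assms by unfold_locales
  have unif: "uniform_limit C (K_partial M) (K_mu M) sequentially" if C: "compact C" for C
  proof -
    obtain R where "C \<subseteq> cball 0 R"
      using compact_imp_bounded[OF C] by (auto simp: bounded_iff subset_iff)
    then show ?thesis by (rule uniform_limit_on_subset[OF K_mu_entire(1)])
  qed
  show ?thesis
    by (intro conjI allI impI unif K_mu_entire(2,3) K_mu_of_real exp_minus_K_lam_integrable f_mu_minus_K_mu_eq diffF_integrable
        integral_abs_diffF fourier_diffF L1_distance_ge) auto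
qed

end
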